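(* (1) No Boolean formal space can have a point unless excluded middle is accepted: in $\mathrm{CZF}^*$, if some Boolean formal space has a point then [R]EM holds; in each of $\mathrm{CTT}^*$, HHA, IZF, if some Boolean formal space has a point then EM holds. (2) No De Morgan formal space can have a point unless De Morgan law is accepted: in $\mathrm{CZF}^*$, if some De Morgan formal space has a point then [R]DML holds; in each of $\mathrm{CTT}^*$, HHA, IZF, if some De Morgan formal space has a point then DML holds.
   Context: Systems. CZF is Aczel's constructive set theory; CTT is Martin-Löf's constructive type theory; IZF is CZF with full separation and powerset; HHA is intuitionistic higher-order Heyting arithmetic (topos logic). $\mathrm{CZF}^*$ denotes an arbitrary fixed extension of CZF consistent with the scheme GUP-CZF: for every set $I$, $(\forall x)(\exists y\in I)A(x,y)\to(\exists y\in I)(\forall x)A(x,y)$. $\mathrm{CTT}^*$ denotes an arbitrary fixed extension of CTT consistent with GUP-CTT: for every set $I$, every $R$ mapping a proposition and an element of $I$ to a proposition, and every $F$ from propositions to $I$ with $R(P,F(P))$ for all $P$, there is $\bar i\in I$ with $R(P,\bar i)$ for all $P$. Logical principles. EM: $P\vee\neg P$ for all propositions $P$. DML: $\neg\neg P\vee\neg P$ for all $P$. In set theory, $\mathsf{Pow}(\{\top\})$ is the class of subsets of $\{\top\}$ and $p^*\equiv\{x\in\{\top\}:x\notin p\}$; [R]EM: $(\forall p\in\mathsf{Pow}(\{\top\}))\,p\cup p^*=\{\top\}$; [R]DML: $(\forall p\in\mathsf{Pow}(\{\top\}))\,p^{**}\cup p^*=\{\top\}$. Formal spaces. A formal space is a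 pair $(S,\vartriangleleft)$ with $S$ a set and $\vartriangleleft$ a relation (a class in CZF) between elements and subsets of $S$ such that: $a\in U$ implies $a\vartriangleleft U$; $a\vartriangleleft U$ and $U\vartriangleleft V$ imply $a\vartriangleleft V$; $a\vartriangleleft U$ and $a\vartriangleleft V$ imply $a\vartriangleleft U\downarrow V$; and (in CZF) $\{a\in S:a\vartriangleleft U\}$ is a set for every $U\subseteq S$. Here $U\vartriangleleft V$ means $(\forall u\in U)\,u\vartriangleleft V$, $U\downarrow V\equiv\{d\in S:(\exists u\in U)\,d\vartriangleleft\{u\}\ \&\ (\exists v\in V)\,d\vartriangleleft\{v\}\}$, and $a\downarrow U$ means $\{a\}\downarrow U$, $a\downarrow b$ means $\{a\}\downarrow\{b\}$. The pseudocomplement of $U\subseteq S$ is $U^*\equiv\{a\in S:a\downarrow U\vartriangleleft\emptyset\}$. $S$ is Boolean if $S\vartriangleleft U\cup U^*$ for all $U\subseteq S$ (i.e. its frame of saturated subsets is Boolean), and De Morgan if $S\vartriangleleft U^{**}\cup U^*$ for all $U\subseteq S$. (One may always assume that $S$ has a top element $1_S$, i.e. $S\vartriangleleft\{1_S\}$; then $S$ may be replaced by $1_S$ on the left of these conditions.) A point of $S$ is a subset $\alpha\subseteq S$ such that: $\alpha$ is inhabited; $a,b\in\alpha$ implies $(\exists c\in\alpha)\,c\in a\downarrow b$; $a\in\alpha$ and $a\vartriangleleft U$ imply $(\exists b\in U)\,b\in\alpha$. *)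

theory Defs
  imports Main
begin

text \<open>
  The systems CZF, IZF, HHA and CTT are deeply embedded: formulas, terms and types are
  datatypes with de Bruijn indices, and provability is an inductive predicate whose rules are
  intuitionistic.  The classical logic of the metatheory does not enter the object systems.

  To keep the axioms and definitions of the object theories readable, they are written with
  HOAS-style builders.  A builder is a function from the current binding depth to syntax; the
  variable bound at depth \<open>l\<close> has index \<open>d - Suc l\<close> when it is used at depth \<open>d\<close>.  Thus a
  builder applied to depth \<open>0\<close> is an ordinary piece of de Bruijn syntax, its variables need
  no explicit shifting, and no capture can occur.
\<close>

section \<open>First-order set theory\<close>

subsection \<open>Intuitionistic first-order logic in the language of membership and equality\<close>

text \<open>The only terms are variables, so that substitutions are renamings.\<close>

datatype fm =
    SMem nat nat | SEq nat nat | SBot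
  | SAnd fm fm | SOr fm fm | SImp fm fm
  | SAll fm | SEx fm

definition up :: "(nat \<Rightarrow> nat) \<Rightarrow> nat \<Rightarrow> nat" where
  "up f = case_nat 0 (\<lambda>n. Suc (f n))"

primrec sren :: "(nat \<Rightarrow> nat) \<Rightarrow> fm \<Rightarrow> fm" where
  "sren f (SMem x y) = SMem (f x) (f y)"
| "sren f (SEq x y) = SEq (f x) (f y)"
| "sren f SBot = SBot"
| "sren f (SAnd A B) = SAnd (sren f A) (sren f B)"
| "sren f (SOr A B) = SOr (sren f A) (sren f B)"
| "sren f (SImp A B) = SImp (sren f A) (sren f B)"
| "sren f (SAll A) = SAll (sren (up f) A)"
| "sren f (SEx A) = SEx (sren (up f) A)"

definition sinst :: "nat \<Rightarrow> fm \<Rightarrow> fm" where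
  "sinst t A = sren (case_nat t (\<lambda>n. n)) A"

text \<open>
  \<open>sprov T \<Gamma> A\<close>: \<open>A\<close> is derivable from the hypotheses \<open>\<Gamma>\<close> in the theory \<open>T\<close>.  The axioms of
  \<open>T\<close> may have free variables (parameters) and are read as universally closed, so all their
  instances are available; the variables of \<open>\<Gamma>\<close> are fixed.
\<close>

inductive sprov :: "fm set \<Rightarrow> fm set \<Rightarrow> fm \<Rightarrow> bool" for T where
  sAx: "A \<in> T \<Longrightarrow> sprov T \<Gamma> (sren f A)"
| sHyp: "A \<in> \<Gamma> \<Longrightarrow> sprov T \<Gamma> A"
| sBotE: "sprov T \<Gamma> SBot \<Longrightarrow> sprov T \<Gamma> A"
| sAndI: "sprov T \<Gamma> A \<Longrightarrow> sprov T \<Gamma> B \<Longrightarrow> sprov T \<Gamma> (SAnd A B)"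
| sAndE1: "sprov T \<Gamma> (SAnd A B) \<Longrightarrow> sprov T \<Gamma> A"
| sAndE2: "sprov T \<Gamma> (SAnd A B) \<Longrightarrow> sprov T \<Gamma> B"
| sOrI1: "sprov T \<Gamma> A \<Longrightarrow> sprov T \<Gamma> (SOr A B)"
| sOrI2: "sprov T \<Gamma> B \<Longrightarrow> sprov T \<Gamma> (SOr A B)"
| sOrE: "sprov T \<Gamma> (SOr A B) \<Longrightarrow> sprov T (insert A \<Gamma>) C \<Longrightarrow> sprov T (insert B \<Gamma>) C
    \<Longrightarrow> sprov T \<Gamma> C"
| sImpI: "sprov T (insert A \<Gamma>) B \<Longrightarrow> sprov T \<Gamma> (SImp A B)"
| sImpE: "sprov T \<Gamma> (SImp A B) \<Longrightarrow> sprov T \<Gamma> A \<Longrightarrow> sprov T \<Gamma> B"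
| sAllI: "sprov T (sren Suc ` \<Gamma>) A \<Longrightarrow> sprov T \<Gamma> (SAll A)"
| sAllE: "sprov T \<Gamma> (SAll A) \<Longrightarrow> sprov T \<Gamma> (sinst t A)"
| sExI: "sprov T \<Gamma> (sinst t A) \<Longrightarrow> sprov T \<Gamma> (SEx A)"
| sExE: "sprov T \<Gamma> (SEx A) \<Longrightarrow> sprov T (insert A (sren Suc ` \<Gamma>)) (sren Suc C) \<Longrightarrow> sprov T \<Gamma> C"
| sEqRefl: "sprov T \<Gamma> (SEq t t)"
| sEqSubst: "sprov T \<Gamma> (SEq s t) \<Longrightarrow> sprov T \<Gamma> (sinst s A) \<Longrightarrow> sprov T \<Gamma> (sinst t A)"

definition sconsistent :: "fm set \<Rightarrow> bool" where
  "sconsistent T \<longleftrightarrow> \<not> sprov T {} SBot"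

subsection \<open>Builders\<close>

type_synonym vb = "nat \<Rightarrow> nat"
type_synonym fb = "nat \<Rightarrow> fm"

definition bvar :: "nat \<Rightarrow> nat \<Rightarrow> nat" where
  "bvar l d = d - Suc l"

definition smem :: "vb \<Rightarrow> vb \<Rightarrow> fb" (infix "\<in>\<^sub>s" 50) where
  "smem x y = (\<lambda>d. SMem (x d) (y d))"

definition seq :: "vb \<Rightarrow> vb \<Rightarrow> fb" (infix "=\<^sub>s" 50) where
  "seq x y = (\<lambda>d. SEq (x d) (y d))"

definition sbot :: fb ("\<bottom>\<^sub>s") where
  "sbot = (\<lambda>d. SBot)"

definition sand :: "fb \<Rightarrow> fb \<Rightarrow> fb" (infixr "\<and>\<^sub>s" 35) where
  "sand A B = (\<lambda>d. SAnd (A d) (B d))"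

definition sor :: "fb \<Rightarrow> fb \<Rightarrow> fb" (infixr "\<or>\<^sub>s" 30) where
  "sor A B = (\<lambda>d. SOr (A d) (B d))"

definition simpl :: "fb \<Rightarrow> fb \<Rightarrow> fb" (infixr "\<longrightarrow>\<^sub>s" 25) where
  "simpl A B = (\<lambda>d. SImp (A d) (B d))"

definition siff :: "fb \<Rightarrow> fb \<Rightarrow> fb" (infix "\<longleftrightarrow>\<^sub>s" 25) where
  "siff A B = ((A \<longrightarrow>\<^sub>s B) \<and>\<^sub>s (B \<longrightarrow>\<^sub>s A))"

definition snot :: "fb \<Rightarrow> fb" ("\<not>\<^sub>s _" [40] 40) where
  "snot A = (A \<longrightarrow>\<^sub>s \<bottom>\<^sub>s)"

definition sall :: "(vb \<Rightarrow> fb) \<Rightarrow> fb" (binder "\<forall>\<^sub>s" 10) where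
  "sall F = (\<lambda>d. SAll (F (bvar d) (Suc d)))"

definition sex :: "(vb \<Rightarrow> fb) \<Rightarrow> fb" (binder "\<exists>\<^sub>s" 10) where
  "sex F = (\<lambda>d. SEx (F (bvar d) (Suc d)))"

text \<open>
  A formula \<open>\<phi>(v\<^sub>0, \<dots>, v\<^sub>k)\<close> with further parameters: \<open>sapp \<phi> [x\<^sub>0, \<dots>, x\<^sub>k]\<close> puts \<open>x\<^sub>i\<close>
  for the variable with index \<open>i \<le> k\<close>, and turns the remaining variables into parameters,
  that is, free variables of the whole formula.
\<close>

definition sapp :: "fm \<Rightarrow> vb list \<Rightarrow> fb" where
  "sapp \<phi> xs = (\<lambda>d. sren (\<lambda>n. if n < length xs then (xs ! n) d else n - length xs + d) \<phi>)"

subsection \<open>The axioms of CZF and IZF\<close>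

text \<open>Bounded formulas; in both quantifier clauses the bound is the variable \<open>v\<close> outside.\<close>

inductive delta0 :: "fm \<Rightarrow> bool" where
  "delta0 (SMem x y)"
| "delta0 (SEq x y)"
| "delta0 SBot"
| "delta0 A \<Longrightarrow> delta0 B \<Longrightarrow> delta0 (SAnd A B)"
| "delta0 A \<Longrightarrow> delta0 B \<Longrightarrow> delta0 (SOr A B)"
| "delta0 A \<Longrightarrow> delta0 B \<Longrightarrow> delta0 (SImp A B)"
| "delta0 A \<Longrightarrow> delta0 (SAll (SImp (SMem 0 (Suc v)) A))"
| "delta0 A \<Longrightarrow> delta0 (SEx (SAnd (SMem 0 (Suc v)) A))"

definition ssubset :: "vb \<Rightarrow> vb \<Rightarrow> fb" (infix "\<subseteq>\<^sub>s" 50) where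
  "ssubset x y = (\<forall>\<^sub>s z. z \<in>\<^sub>s x \<longrightarrow>\<^sub>s z \<in>\<^sub>s y)"

definition sempty :: "vb \<Rightarrow> fb" where
  "sempty x = (\<forall>\<^sub>s z. \<not>\<^sub>s z \<in>\<^sub>s x)"

definition ssucc :: "vb \<Rightarrow> vb \<Rightarrow> fb" where
  "ssucc y x = (\<forall>\<^sub>s z. z \<in>\<^sub>s x \<longleftrightarrow>\<^sub>s (z \<in>\<^sub>s y \<or>\<^sub>s z =\<^sub>s y))"

definition ax_ext :: fb where
  "ax_ext = (\<forall>\<^sub>s x. \<forall>\<^sub>s y. (\<forall>\<^sub>s z. z \<in>\<^sub>s x \<longleftrightarrow>\<^sub>s z \<in>\<^sub>s y) \<longrightarrow>\<^sub>s x =\<^sub>s y)"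

definition ax_pair :: fb where
  "ax_pair = (\<forall>\<^sub>s x. \<forall>\<^sub>s y. \<exists>\<^sub>s z. \<forall>\<^sub>s w. w \<in>\<^sub>s z \<longleftrightarrow>\<^sub>s (w =\<^sub>s x \<or>\<^sub>s w =\<^sub>s y))"

definition ax_union :: fb where
  "ax_union = (\<forall>\<^sub>s x. \<exists>\<^sub>s y. \<forall>\<^sub>s z. z \<in>\<^sub>s y \<longleftrightarrow>\<^sub>s (\<exists>\<^sub>s w. w \<in>\<^sub>s x \<and>\<^sub>s z \<in>\<^sub>s w))"

definition ax_infinity :: fb where
  "ax_infinity =
    (\<exists>\<^sub>s a. \<forall>\<^sub>s x. x \<in>\<^sub>s a \<longleftrightarrow>\<^sub>s (sempty x \<or>\<^sub>s (\<exists>\<^sub>s y. y \<in>\<^sub>s a \<and>\<^sub>s ssucc y x)))"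

definition ax_set_induction :: "fm \<Rightarrow> fb" where
  "ax_set_induction \<phi> =
    ((\<forall>\<^sub>s x. (\<forall>\<^sub>s y. y \<in>\<^sub>s x \<longrightarrow>\<^sub>s sapp \<phi> [y]) \<longrightarrow>\<^sub>s sapp \<phi> [x]) \<longrightarrow>\<^sub>s (\<forall>\<^sub>s x. sapp \<phi> [x]))"

definition ax_separation :: "fm \<Rightarrow> fb" where
  "ax_separation \<phi> = (\<forall>\<^sub>s a. \<exists>\<^sub>s b. \<forall>\<^sub>s x. x \<in>\<^sub>s b \<longleftrightarrow>\<^sub>s (x \<in>\<^sub>s a \<and>\<^sub>s sapp \<phi> [x]))"

definition ax_strong_collection :: "fm \<Rightarrow> fb" where
  "ax_strong_collection \<phi> =
    (\<forall>\<^sub>s a. (\<forall>\<^sub>s x. x \<in>\<^sub>s a \<longrightarrow>\<^sub>s (\<exists>\<^sub>s y. sapp \<phi> [x, y])) \<longrightarrow>\<^sub>s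
      (\<exists>\<^sub>s b. (\<forall>\<^sub>s x. x \<in>\<^sub>s a \<longrightarrow>\<^sub>s (\<exists>\<^sub>s y. y \<in>\<^sub>s b \<and>\<^sub>s sapp \<phi> [x, y])) \<and>\<^sub>s
            (\<forall>\<^sub>s y. y \<in>\<^sub>s b \<longrightarrow>\<^sub>s (\<exists>\<^sub>s x. x \<in>\<^sub>s a \<and>\<^sub>s sapp \<phi> [x, y]))))"

definition ax_subset_collection :: "fm \<Rightarrow> fb" where
  "ax_subset_collection \<phi> =
    (\<forall>\<^sub>s a. \<forall>\<^sub>s b. \<exists>\<^sub>s c. \<forall>\<^sub>s u.
      (\<forall>\<^sub>s x. x \<in>\<^sub>s a \<longrightarrow>\<^sub>s (\<exists>\<^sub>s y. y \<in>\<^sub>s b \<and>\<^sub>s sapp \<phi> [x, y, u])) \<longrightarrow>\<^sub>s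
      (\<exists>\<^sub>s e. e \<in>\<^sub>s c \<and>\<^sub>s
        (\<forall>\<^sub>s x. x \<in>\<^sub>s a \<longrightarrow>\<^sub>s (\<exists>\<^sub>s y. y \<in>\<^sub>s e \<and>\<^sub>s sapp \<phi> [x, y, u])) \<and>\<^sub>s
        (\<forall>\<^sub>s y. y \<in>\<^sub>s e \<longrightarrow>\<^sub>s (\<exists>\<^sub>s x. x \<in>\<^sub>s a \<and>\<^sub>s sapp \<phi> [x, y, u]))))"

definition ax_powerset :: fb where
  "ax_powerset = (\<forall>\<^sub>s x. \<exists>\<^sub>s y. \<forall>\<^sub>s z. z \<in>\<^sub>s y \<longleftrightarrow>\<^sub>s z \<subseteq>\<^sub>s x)"

definition CZF :: "fm set" where
  "CZF = {ax_ext 0, ax_pair 0, ax_union 0, ax_infinity 0}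
    \<union> {ax_set_induction \<phi> 0 | \<phi>. True}
    \<union> {ax_separation \<phi> 0 | \<phi>. delta0 \<phi>}
    \<union> {ax_strong_collection \<phi> 0 | \<phi>. True}
    \<union> {ax_subset_collection \<phi> 0 | \<phi>. True}"

definition IZF :: "fm set" where
  "IZF = CZF \<union> {ax_separation \<phi> 0 | \<phi>. True} \<union> {ax_powerset 0}"

definition GUP_CZF :: "fm set" where
  "GUP_CZF = {(\<forall>\<^sub>s I. (\<forall>\<^sub>s x. \<exists>\<^sub>s y. y \<in>\<^sub>s I \<and>\<^sub>s sapp \<phi> [x, y]) \<longrightarrow>\<^sub>s
                    (\<exists>\<^sub>s y. y \<in>\<^sub>s I \<and>\<^sub>s (\<forall>\<^sub>s x. sapp \<phi> [x, y]))) 0 | \<phi>. True}"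

definition CZF_star :: "fm set \<Rightarrow> bool" where
  "CZF_star T \<longleftrightarrow> CZF \<subseteq> T \<and> sconsistent (T \<union> GUP_CZF)"

subsection \<open>Formal spaces in set theory\<close>

text \<open>
  Class terms \<open>{x. K x}\<close> are represented by the builder \<open>K\<close>; a class relation \<open>C\<close> by a binary
  builder.  As usual for class terms, \<open>a \<lhd> {x. K x}\<close> abbreviates that \<open>{x. K x}\<close> is a set \<open>W\<close>
  with \<open>a \<lhd> W\<close>.  All classes to which this is applied below are provably sets: in CZF because
  the classes \<open>{a \<in> S. a \<lhd> U}\<close> are required to be sets, in IZF by full separation.
\<close>

type_synonym cls = "vb \<Rightarrow> fb"

definition selem :: "vb \<Rightarrow> cls" where
  "selem U = (\<lambda>x. x \<in>\<^sub>s U)"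

definition ssing :: "vb \<Rightarrow> cls" where
  "ssing u = (\<lambda>x. x =\<^sub>s u)"

definition snull :: cls where
  "snull = (\<lambda>x. \<bottom>\<^sub>s)"

definition scup :: "cls \<Rightarrow> cls \<Rightarrow> cls" where
  "scup K L = (\<lambda>x. K x \<or>\<^sub>s L x)"

definition sclseq :: "cls \<Rightarrow> cls \<Rightarrow> fb" where
  "sclseq K L = (\<forall>\<^sub>s x. K x \<longleftrightarrow>\<^sub>s L x)"

definition scov :: "(vb \<Rightarrow> vb \<Rightarrow> fb) \<Rightarrow> vb \<Rightarrow> cls \<Rightarrow> fb" where
  "scov C a K = (\<exists>\<^sub>s W. sclseq (selem W) K \<and>\<^sub>s C a W)"

definition sdown :: "vb \<Rightarrow> (vb \<Rightarrow> vb \<Rightarrow> fb) \<Rightarrow> cls \<Rightarrow> cls \<Rightarrow> cls" where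
  "sdown S C K L = (\<lambda>d. d \<in>\<^sub>s S \<and>\<^sub>s (\<exists>\<^sub>s u. K u \<and>\<^sub>s scov C d (ssing u))
                              \<and>\<^sub>s (\<exists>\<^sub>s v. L v \<and>\<^sub>s scov C d (ssing v)))"

definition sstar :: "vb \<Rightarrow> (vb \<Rightarrow> vb \<Rightarrow> fb) \<Rightarrow> cls \<Rightarrow> cls" where
  "sstar S C K = (\<lambda>a. a \<in>\<^sub>s S \<and>\<^sub>s (\<forall>\<^sub>s d. sdown S C (ssing a) K d \<longrightarrow>\<^sub>s scov C d snull))"

definition sspace :: "vb \<Rightarrow> (vb \<Rightarrow> vb \<Rightarrow> fb) \<Rightarrow> fb" where
  "sspace S C =
    ((\<forall>\<^sub>s a. \<forall>\<^sub>s U. a \<in>\<^sub>s S \<longrightarrow>\<^sub>s U \<subseteq>\<^sub>s S \<longrightarrow>\<^sub>s a \<in>\<^sub>s U \<longrightarrow>\<^sub>s C a U) \<and>\<^sub>s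
     (\<forall>\<^sub>s a. \<forall>\<^sub>s U. \<forall>\<^sub>s V. a \<in>\<^sub>s S \<longrightarrow>\<^sub>s U \<subseteq>\<^sub>s S \<longrightarrow>\<^sub>s V \<subseteq>\<^sub>s S \<longrightarrow>\<^sub>s
        C a U \<longrightarrow>\<^sub>s (\<forall>\<^sub>s u. u \<in>\<^sub>s U \<longrightarrow>\<^sub>s C u V) \<longrightarrow>\<^sub>s C a V) \<and>\<^sub>s
     (\<forall>\<^sub>s a. \<forall>\<^sub>s U. \<forall>\<^sub>s V. a \<in>\<^sub>s S \<longrightarrow>\<^sub>s U \<subseteq>\<^sub>s S \<longrightarrow>\<^sub>s V \<subseteq>\<^sub>s S \<longrightarrow>\<^sub>s
        C a U \<longrightarrow>\<^sub>s C a V \<longrightarrow>\<^sub>s scov C a (sdown S C (selem U) (selem V))))"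

text \<open>The additional requirement on formal spaces in CZF.\<close>

definition ssmall :: "vb \<Rightarrow> (vb \<Rightarrow> vb \<Rightarrow> fb) \<Rightarrow> fb" where
  "ssmall S C =
    (\<forall>\<^sub>s U. U \<subseteq>\<^sub>s S \<longrightarrow>\<^sub>s (\<exists>\<^sub>s W. sclseq (selem W) (\<lambda>a. a \<in>\<^sub>s S \<and>\<^sub>s C a U)))"

definition sBoolean :: "vb \<Rightarrow> (vb \<Rightarrow> vb \<Rightarrow> fb) \<Rightarrow> fb" where
  "sBoolean S C = (\<forall>\<^sub>s U. U \<subseteq>\<^sub>s S \<longrightarrow>\<^sub>s (\<forall>\<^sub>s a. a \<in>\<^sub>s S \<longrightarrow>\<^sub>s
    scov C a (scup (selem U) (sstar S C (selem U)))))"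

definition sDeMorgan :: "vb \<Rightarrow> (vb \<Rightarrow> vb \<Rightarrow> fb) \<Rightarrow> fb" where
  "sDeMorgan S C = (\<forall>\<^sub>s U. U \<subseteq>\<^sub>s S \<longrightarrow>\<^sub>s (\<forall>\<^sub>s a. a \<in>\<^sub>s S \<longrightarrow>\<^sub>s
    scov C a (scup (sstar S C (sstar S C (selem U))) (sstar S C (selem U)))))"

definition spoint :: "vb \<Rightarrow> (vb \<Rightarrow> vb \<Rightarrow> fb) \<Rightarrow> vb \<Rightarrow> fb" where
  "spoint S C \<alpha> =
    (\<alpha> \<subseteq>\<^sub>s S \<and>\<^sub>s
     (\<exists>\<^sub>s a. a \<in>\<^sub>s \<alpha>) \<and>\<^sub>s
     (\<forall>\<^sub>s a. \<forall>\<^sub>s b. a \<in>\<^sub>s \<alpha> \<longrightarrow>\<^sub>s b \<in>\<^sub>s \<alpha> \<longrightarrow>\<^sub>s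
        (\<exists>\<^sub>s c. c \<in>\<^sub>s \<alpha> \<and>\<^sub>s sdown S C (ssing a) (ssing b) c)) \<and>\<^sub>s
     (\<forall>\<^sub>s a. \<forall>\<^sub>s U. a \<in>\<^sub>s \<alpha> \<longrightarrow>\<^sub>s U \<subseteq>\<^sub>s S \<longrightarrow>\<^sub>s C a U \<longrightarrow>\<^sub>s
        (\<exists>\<^sub>s b. b \<in>\<^sub>s U \<and>\<^sub>s b \<in>\<^sub>s \<alpha>)))"

text \<open>
  The cover of a formal space is a class, given by a formula \<open>\<phi>(a, U)\<close>, possibly with
  parameters.
\<close>

definition CZF_Boolean_with_point :: "fm \<Rightarrow> fb" where
  "CZF_Boolean_with_point \<phi> = (let C = (\<lambda>a U. sapp \<phi> [a, U]) in
    \<exists>\<^sub>s S. sspace S C \<and>\<^sub>s ssmall S C \<and>\<^sub>s sBoolean S C \<and>\<^sub>s (\<exists>\<^sub>s \<alpha>. spoint S C \<alpha>))"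

definition CZF_DeMorgan_with_point :: "fm \<Rightarrow> fb" where
  "CZF_DeMorgan_with_point \<phi> = (let C = (\<lambda>a U. sapp \<phi> [a, U]) in
    \<exists>\<^sub>s S. sspace S C \<and>\<^sub>s ssmall S C \<and>\<^sub>s sDeMorgan S C \<and>\<^sub>s (\<exists>\<^sub>s \<alpha>. spoint S C \<alpha>))"

definition IZF_Boolean_with_point :: "fm \<Rightarrow> fb" where
  "IZF_Boolean_with_point \<phi> = (let C = (\<lambda>a U. sapp \<phi> [a, U]) in
    \<exists>\<^sub>s S. sspace S C \<and>\<^sub>s sBoolean S C \<and>\<^sub>s (\<exists>\<^sub>s \<alpha>. spoint S C \<alpha>))"

definition IZF_DeMorgan_with_point :: "fm \<Rightarrow> fb" where
  "IZF_DeMorgan_with_point \<phi> = (let C = (\<lambda>a U. sapp \<phi> [a, U]) in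
    \<exists>\<^sub>s S. sspace S C \<and>\<^sub>s sDeMorgan S C \<and>\<^sub>s (\<exists>\<^sub>s \<alpha>. spoint S C \<alpha>))"

subsection \<open>Logical principles in set theory\<close>

text \<open>The set \<open>\<top>\<close> is the empty set, so that \<open>{\<top>}\<close> is the usual one-element set.\<close>

definition sone :: cls where
  "sone = (\<lambda>x. sempty x)"

definition spstar :: "cls \<Rightarrow> cls" where
  "spstar K = (\<lambda>x. sone x \<and>\<^sub>s \<not>\<^sub>s K x)"

definition REM :: fb where
  "REM = (\<forall>\<^sub>s p. (\<forall>\<^sub>s x. x \<in>\<^sub>s p \<longrightarrow>\<^sub>s sone x) \<longrightarrow>\<^sub>s
    sclseq (scup (selem p) (spstar (selem p))) sone)"

definition RDML :: fb where
  "RDML = (\<forall>\<^sub>s p. (\<forall>\<^sub>s x. x \<in>\<^sub>s p \<longrightarrow>\<^sub>s sone x) \<longrightarrow>\<^sub>s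
    sclseq (scup (spstar (spstar (selem p))) (spstar (selem p))) sone)"

text \<open>In IZF propositions are formulas, and EM and DML are schemes.\<close>

definition sEM :: "fm \<Rightarrow> fb" where
  "sEM \<psi> = (sapp \<psi> [] \<or>\<^sub>s \<not>\<^sub>s sapp \<psi> [])"

definition sDML :: "fm \<Rightarrow> fb" where
  "sDML \<psi> = (\<not>\<^sub>s \<not>\<^sub>s sapp \<psi> [] \<or>\<^sub>s \<not>\<^sub>s sapp \<psi> [])"


section \<open>Intuitionistic higher-order Heyting arithmetic\<close>

subsection \<open>Topos logic\<close>

text \<open>The pure type theory of Lambek and Scott; formulas are terms of type \<open>HOmega\<close>.\<close>

datatype hty = HOne | HNum | HOmega | HPow hty | HProd hty hty

datatype htm =
    HVar nat | HStar | HPair htm htm | HZero | HSucc htm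
  | HCompr hty htm | HMem htm htm | HEq htm htm
  | HBot | HAnd htm htm | HOr htm htm | HImp htm htm
  | HAll hty htm | HEx hty htm

primrec hren :: "(nat \<Rightarrow> nat) \<Rightarrow> htm \<Rightarrow> htm" where
  "hren f (HVar n) = HVar (f n)"
| "hren f HStar = HStar"
| "hren f (HPair s t) = HPair (hren f s) (hren f t)"
| "hren f HZero = HZero"
| "hren f (HSucc t) = HSucc (hren f t)"
| "hren f (HCompr \<tau> A) = HCompr \<tau> (hren (up f) A)"
| "hren f (HMem s t) = HMem (hren f s) (hren f t)"
| "hren f (HEq s t) = HEq (hren f s) (hren f t)"
| "hren f HBot = HBot"
| "hren f (HAnd A B) = HAnd (hren f A) (hren f B)"
| "hren f (HOr A B) = HOr (hren f A) (hren f B)"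
| "hren f (HImp A B) = HImp (hren f A) (hren f B)"
| "hren f (HAll \<tau> A) = HAll \<tau> (hren (up f) A)"
| "hren f (HEx \<tau> A) = HEx \<tau> (hren (up f) A)"

definition hup :: "(nat \<Rightarrow> htm) \<Rightarrow> nat \<Rightarrow> htm" where
  "hup \<sigma> = case_nat (HVar 0) (\<lambda>n. hren Suc (\<sigma> n))"

primrec hsub :: "(nat \<Rightarrow> htm) \<Rightarrow> htm \<Rightarrow> htm" where
  "hsub \<sigma> (HVar n) = \<sigma> n"
| "hsub \<sigma> HStar = HStar"
| "hsub \<sigma> (HPair s t) = HPair (hsub \<sigma> s) (hsub \<sigma> t)"
| "hsub \<sigma> HZero = HZero"
| "hsub \<sigma> (HSucc t) = HSucc (hsub \<sigma> t)"
| "hsub \<sigma> (HCompr \<tau> A) = HCompr \<tau> (hsub (hup \<sigma>) A)"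
| "hsub \<sigma> (HMem s t) = HMem (hsub \<sigma> s) (hsub \<sigma> t)"
| "hsub \<sigma> (HEq s t) = HEq (hsub \<sigma> s) (hsub \<sigma> t)"
| "hsub \<sigma> HBot = HBot"
| "hsub \<sigma> (HAnd A B) = HAnd (hsub \<sigma> A) (hsub \<sigma> B)"
| "hsub \<sigma> (HOr A B) = HOr (hsub \<sigma> A) (hsub \<sigma> B)"
| "hsub \<sigma> (HImp A B) = HImp (hsub \<sigma> A) (hsub \<sigma> B)"
| "hsub \<sigma> (HAll \<tau> A) = HAll \<tau> (hsub (hup \<sigma>) A)"
| "hsub \<sigma> (HEx \<tau> A) = HEx \<tau> (hsub (hup \<sigma>) A)"

definition hinst :: "htm \<Rightarrow> htm \<Rightarrow> htm" where
  "hinst t A = hsub (case_nat t HVar) A"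

text \<open>In a context \<open>\<Delta>\<close> the variable with index \<open>n\<close> has type \<open>\<Delta> ! n\<close>.\<close>

inductive htyp :: "hty list \<Rightarrow> htm \<Rightarrow> hty \<Rightarrow> bool" where
  "n < length \<Delta> \<Longrightarrow> htyp \<Delta> (HVar n) (\<Delta> ! n)"
| "htyp \<Delta> HStar HOne"
| "htyp \<Delta> s \<sigma> \<Longrightarrow> htyp \<Delta> t \<tau> \<Longrightarrow> htyp \<Delta> (HPair s t) (HProd \<sigma> \<tau>)"
| "htyp \<Delta> HZero HNum"
| "htyp \<Delta> t HNum \<Longrightarrow> htyp \<Delta> (HSucc t) HNum"
| "htyp (\<tau> # \<Delta>) A HOmega \<Longrightarrow> htyp \<Delta> (HCompr \<tau> A) (HPow \<tau>)"
| "htyp \<Delta> s \<tau> \<Longrightarrow> htyp \<Delta> t (HPow \<tau>) \<Longrightarrow> htyp \<Delta> (HMem s t) HOmega"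
| "htyp \<Delta> s \<tau> \<Longrightarrow> htyp \<Delta> t \<tau> \<Longrightarrow> htyp \<Delta> (HEq s t) HOmega"
| "htyp \<Delta> HBot HOmega"
| "htyp \<Delta> A HOmega \<Longrightarrow> htyp \<Delta> B HOmega \<Longrightarrow> htyp \<Delta> (HAnd A B) HOmega"
| "htyp \<Delta> A HOmega \<Longrightarrow> htyp \<Delta> B HOmega \<Longrightarrow> htyp \<Delta> (HOr A B) HOmega"
| "htyp \<Delta> A HOmega \<Longrightarrow> htyp \<Delta> B HOmega \<Longrightarrow> htyp \<Delta> (HImp A B) HOmega"
| "htyp (\<tau> # \<Delta>) A HOmega \<Longrightarrow> htyp \<Delta> (HAll \<tau> A) HOmega"
| "htyp (\<tau> # \<Delta>) A HOmega \<Longrightarrow> htyp \<Delta> (HEx \<tau> A) HOmega"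

subsection \<open>Builders\<close>

type_synonym hb = "nat \<Rightarrow> htm"

definition hvar :: "nat \<Rightarrow> hb" where
  "hvar l = (\<lambda>d. HVar (d - Suc l))"

definition hstar :: hb where
  "hstar = (\<lambda>d. HStar)"

definition hpair :: "hb \<Rightarrow> hb \<Rightarrow> hb" ("\<langle>_,/ _\<rangle>\<^sub>h") where
  "hpair s t = (\<lambda>d. HPair (s d) (t d))"

definition hzero :: hb where
  "hzero = (\<lambda>d. HZero)"

definition hsucc :: "hb \<Rightarrow> hb" where
  "hsucc t = (\<lambda>d. HSucc (t d))"

definition hmem :: "hb \<Rightarrow> hb \<Rightarrow> hb" (infix "\<in>\<^sub>h" 50) where
  "hmem s t = (\<lambda>d. HMem (s d) (t d))"

definition heq :: "hb \<Rightarrow> hb \<Rightarrow> hb" (infix "=\<^sub>h" 50) where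
  "heq s t = (\<lambda>d. HEq (s d) (t d))"

definition hbot :: hb ("\<bottom>\<^sub>h") where
  "hbot = (\<lambda>d. HBot)"

definition hand :: "hb \<Rightarrow> hb \<Rightarrow> hb" (infixr "\<and>\<^sub>h" 35) where
  "hand A B = (\<lambda>d. HAnd (A d) (B d))"

definition hor :: "hb \<Rightarrow> hb \<Rightarrow> hb" (infixr "\<or>\<^sub>h" 30) where
  "hor A B = (\<lambda>d. HOr (A d) (B d))"

definition himpl :: "hb \<Rightarrow> hb \<Rightarrow> hb" (infixr "\<longrightarrow>\<^sub>h" 25) where
  "himpl A B = (\<lambda>d. HImp (A d) (B d))"

definition hiff :: "hb \<Rightarrow> hb \<Rightarrow> hb" (infix "\<longleftrightarrow>\<^sub>h" 25) where
  "hiff A B = ((A \<longrightarrow>\<^sub>h B) \<and>\<^sub>h (B \<longrightarrow>\<^sub>h A))"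

definition hnot :: "hb \<Rightarrow> hb" ("\<not>\<^sub>h _" [40] 40) where
  "hnot A = (A \<longrightarrow>\<^sub>h \<bottom>\<^sub>h)"

definition hall :: "hty \<Rightarrow> (hb \<Rightarrow> hb) \<Rightarrow> hb" where
  "hall \<tau> F = (\<lambda>d. HAll \<tau> (F (hvar d) (Suc d)))"

definition hex :: "hty \<Rightarrow> (hb \<Rightarrow> hb) \<Rightarrow> hb" where
  "hex \<tau> F = (\<lambda>d. HEx \<tau> (F (hvar d) (Suc d)))"

definition hcompr :: "hty \<Rightarrow> (hb \<Rightarrow> hb) \<Rightarrow> hb" where
  "hcompr \<tau> F = (\<lambda>d. HCompr \<tau> (F (hvar d) (Suc d)))"

syntax
  "_hall" :: "pttrn \<Rightarrow> hty \<Rightarrow> hb \<Rightarrow> hb" ("(3\<forall>\<^sub>h_:_./ _)" [0, 0, 10] 10)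
  "_hex" :: "pttrn \<Rightarrow> hty \<Rightarrow> hb \<Rightarrow> hb" ("(3\<exists>\<^sub>h_:_./ _)" [0, 0, 10] 10)
  "_hcompr" :: "pttrn \<Rightarrow> hty \<Rightarrow> hb \<Rightarrow> hb" ("(1\<lbrace>_:_./ _\<rbrace>)")
translations
  "\<forall>\<^sub>h x:\<tau>. A" == "CONST hall \<tau> (\<lambda>x. A)"
  "\<exists>\<^sub>h x:\<tau>. A" == "CONST hex \<tau> (\<lambda>x. A)"
  "\<lbrace>x:\<tau>. A\<rbrace>" == "CONST hcompr \<tau> (\<lambda>x. A)"

subsection \<open>Provability\<close>

text \<open>Extensionality, products, and the Peano axioms; all are closed formulas.\<close>

definition hha_axioms :: "htm set" where
  "hha_axioms =
     {(\<forall>\<^sub>h p:HOmega. \<forall>\<^sub>h q:HOmega. (p \<longleftrightarrow>\<^sub>h q) \<longrightarrow>\<^sub>h p =\<^sub>h q) 0,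
      (\<forall>\<^sub>h z:HOne. z =\<^sub>h hstar) 0,
      (\<forall>\<^sub>h x:HNum. \<not>\<^sub>h hsucc x =\<^sub>h hzero) 0,
      (\<forall>\<^sub>h x:HNum. \<forall>\<^sub>h y:HNum. hsucc x =\<^sub>h hsucc y \<longrightarrow>\<^sub>h x =\<^sub>h y) 0,
      (\<forall>\<^sub>h u:HPow HNum. hzero \<in>\<^sub>h u \<and>\<^sub>h (\<forall>\<^sub>h x:HNum. x \<in>\<^sub>h u \<longrightarrow>\<^sub>h hsucc x \<in>\<^sub>h u) \<longrightarrow>\<^sub>h
         (\<forall>\<^sub>h x:HNum. x \<in>\<^sub>h u)) 0}
   \<union> {(\<forall>\<^sub>h u:HPow \<tau>. \<forall>\<^sub>h v:HPow \<tau>. (\<forall>\<^sub>h x:\<tau>. x \<in>\<^sub>h u \<longleftrightarrow>\<^sub>h x \<in>\<^sub>h v) \<longrightarrow>\<^sub>h u =\<^sub>h v) 0 | \<tau>. True}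
   \<union> {(\<forall>\<^sub>h z:HProd \<sigma> \<tau>. \<exists>\<^sub>h x:\<sigma>. \<exists>\<^sub>h y:\<tau>. z =\<^sub>h \<langle>x, y\<rangle>\<^sub>h) 0 | \<sigma> \<tau>. True}
   \<union> {(\<forall>\<^sub>h x:\<sigma>. \<forall>\<^sub>h x':\<sigma>. \<forall>\<^sub>h y:\<tau>. \<forall>\<^sub>h y':\<tau>.
         \<langle>x, y\<rangle>\<^sub>h =\<^sub>h \<langle>x', y'\<rangle>\<^sub>h \<longrightarrow>\<^sub>h x =\<^sub>h x' \<and>\<^sub>h y =\<^sub>h y') 0 | \<sigma> \<tau>. True}"

inductive hprov :: "hty list \<Rightarrow> htm set \<Rightarrow> htm \<Rightarrow> bool" where
  hAx: "A \<in> hha_axioms \<Longrightarrow> hprov \<Delta> \<Gamma> A"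
| hComprI: "htyp \<Delta> t \<tau> \<Longrightarrow> htyp (\<tau> # \<Delta>) A HOmega \<Longrightarrow> hprov \<Delta> \<Gamma> (hinst t A)
    \<Longrightarrow> hprov \<Delta> \<Gamma> (HMem t (HCompr \<tau> A))"
| hComprE: "htyp \<Delta> t \<tau> \<Longrightarrow> htyp (\<tau> # \<Delta>) A HOmega \<Longrightarrow> hprov \<Delta> \<Gamma> (HMem t (HCompr \<tau> A))
    \<Longrightarrow> hprov \<Delta> \<Gamma> (hinst t A)"
| hEqRefl: "htyp \<Delta> t \<tau> \<Longrightarrow> hprov \<Delta> \<Gamma> (HEq t t)"
| hEqSubst: "htyp \<Delta> s \<tau> \<Longrightarrow> htyp \<Delta> t \<tau> \<Longrightarrow> htyp (\<tau> # \<Delta>) A HOmega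
    \<Longrightarrow> hprov \<Delta> \<Gamma> (HEq s t) \<Longrightarrow> hprov \<Delta> \<Gamma> (hinst s A) \<Longrightarrow> hprov \<Delta> \<Gamma> (hinst t A)"
| hHyp: "A \<in> \<Gamma> \<Longrightarrow> htyp \<Delta> A HOmega \<Longrightarrow> hprov \<Delta> \<Gamma> A"
| hBotE: "hprov \<Delta> \<Gamma> HBot \<Longrightarrow> htyp \<Delta> A HOmega \<Longrightarrow> hprov \<Delta> \<Gamma> A"
| hAndI: "hprov \<Delta> \<Gamma> A \<Longrightarrow> hprov \<Delta> \<Gamma> B \<Longrightarrow> hprov \<Delta> \<Gamma> (HAnd A B)"
| hAndE1: "hprov \<Delta> \<Gamma> (HAnd A B) \<Longrightarrow> hprov \<Delta> \<Gamma> A"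
| hAndE2: "hprov \<Delta> \<Gamma> (HAnd A B) \<Longrightarrow> hprov \<Delta> \<Gamma> B"
| hOrI1: "hprov \<Delta> \<Gamma> A \<Longrightarrow> htyp \<Delta> B HOmega \<Longrightarrow> hprov \<Delta> \<Gamma> (HOr A B)"
| hOrI2: "hprov \<Delta> \<Gamma> B \<Longrightarrow> htyp \<Delta> A HOmega \<Longrightarrow> hprov \<Delta> \<Gamma> (HOr A B)"
| hOrE: "hprov \<Delta> \<Gamma> (HOr A B) \<Longrightarrow> hprov \<Delta> (insert A \<Gamma>) C \<Longrightarrow> hprov \<Delta> (insert B \<Gamma>) C
    \<Longrightarrow> hprov \<Delta> \<Gamma> C"
| hImpI: "htyp \<Delta> A HOmega \<Longrightarrow> hprov \<Delta> (insert A \<Gamma>) B \<Longrightarrow> hprov \<Delta> \<Gamma> (HImp A B)"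
| hImpE: "hprov \<Delta> \<Gamma> (HImp A B) \<Longrightarrow> hprov \<Delta> \<Gamma> A \<Longrightarrow> hprov \<Delta> \<Gamma> B"
| hAllI: "hprov (\<tau> # \<Delta>) (hren Suc ` \<Gamma>) A \<Longrightarrow> hprov \<Delta> \<Gamma> (HAll \<tau> A)"
| hAllE: "hprov \<Delta> \<Gamma> (HAll \<tau> A) \<Longrightarrow> htyp \<Delta> t \<tau> \<Longrightarrow> hprov \<Delta> \<Gamma> (hinst t A)"
| hExI: "htyp \<Delta> t \<tau> \<Longrightarrow> htyp (\<tau> # \<Delta>) A HOmega \<Longrightarrow> hprov \<Delta> \<Gamma> (hinst t A)
    \<Longrightarrow> hprov \<Delta> \<Gamma> (HEx \<tau> A)"
| hExE: "hprov \<Delta> \<Gamma> (HEx \<tau> A) \<Longrightarrow> hprov (\<tau> # \<Delta>) (insert A (hren Suc ` \<Gamma>)) (hren Suc C)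
    \<Longrightarrow> htyp \<Delta> C HOmega \<Longrightarrow> hprov \<Delta> \<Gamma> C"

subsection \<open>Formal spaces in HHA\<close>

text \<open>
  A set is a subset of a type: \<open>S\<close> has type \<open>HPow \<tau>\<close>, the cover \<open>R\<close> has type
  \<open>HPow (HProd \<tau> (HPow \<tau>))\<close>, and subsets of \<open>S\<close> have type \<open>HPow \<tau>\<close>.
\<close>

definition hsubset :: "hty \<Rightarrow> hb \<Rightarrow> hb \<Rightarrow> hb" where
  "hsubset \<tau> U V = (\<forall>\<^sub>h x:\<tau>. x \<in>\<^sub>h U \<longrightarrow>\<^sub>h x \<in>\<^sub>h V)"

definition hsing :: "hty \<Rightarrow> hb \<Rightarrow> hb" where
  "hsing \<tau> u = \<lbrace>x:\<tau>. x =\<^sub>h u\<rbrace>"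

definition hnull :: "hty \<Rightarrow> hb" where
  "hnull \<tau> = \<lbrace>x:\<tau>. \<bottom>\<^sub>h\<rbrace>"

definition hcup :: "hty \<Rightarrow> hb \<Rightarrow> hb \<Rightarrow> hb" where
  "hcup \<tau> U V = \<lbrace>x:\<tau>. x \<in>\<^sub>h U \<or>\<^sub>h x \<in>\<^sub>h V\<rbrace>"

definition hcovers :: "hty \<Rightarrow> hb \<Rightarrow> hb \<Rightarrow> hb \<Rightarrow> hb" where
  "hcovers \<tau> R U V = (\<forall>\<^sub>h u:\<tau>. u \<in>\<^sub>h U \<longrightarrow>\<^sub>h \<langle>u, V\<rangle>\<^sub>h \<in>\<^sub>h R)"

definition hdown :: "hty \<Rightarrow> hb \<Rightarrow> hb \<Rightarrow> hb \<Rightarrow> hb \<Rightarrow> hb" where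
  "hdown \<tau> S R U V = \<lbrace>d:\<tau>. d \<in>\<^sub>h S
     \<and>\<^sub>h (\<exists>\<^sub>h u:\<tau>. u \<in>\<^sub>h U \<and>\<^sub>h \<langle>d, hsing \<tau> u\<rangle>\<^sub>h \<in>\<^sub>h R)
     \<and>\<^sub>h (\<exists>\<^sub>h v:\<tau>. v \<in>\<^sub>h V \<and>\<^sub>h \<langle>d, hsing \<tau> v\<rangle>\<^sub>h \<in>\<^sub>h R)\<rbrace>"

definition hpstar :: "hty \<Rightarrow> hb \<Rightarrow> hb \<Rightarrow> hb \<Rightarrow> hb" where
  "hpstar \<tau> S R U =
    \<lbrace>a:\<tau>. a \<in>\<^sub>h S \<and>\<^sub>h hcovers \<tau> R (hdown \<tau> S R (hsing \<tau> a) U) (hnull \<tau>)\<rbrace>"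

definition hspace :: "hty \<Rightarrow> hb \<Rightarrow> hb \<Rightarrow> hb" where
  "hspace \<tau> S R =
    ((\<forall>\<^sub>h a:\<tau>. \<forall>\<^sub>h U:HPow \<tau>. a \<in>\<^sub>h S \<longrightarrow>\<^sub>h hsubset \<tau> U S \<longrightarrow>\<^sub>h a \<in>\<^sub>h U \<longrightarrow>\<^sub>h \<langle>a, U\<rangle>\<^sub>h \<in>\<^sub>h R) \<and>\<^sub>h
     (\<forall>\<^sub>h a:\<tau>. \<forall>\<^sub>h U:HPow \<tau>. \<forall>\<^sub>h V:HPow \<tau>.
        a \<in>\<^sub>h S \<longrightarrow>\<^sub>h hsubset \<tau> U S \<longrightarrow>\<^sub>h hsubset \<tau> V S \<longrightarrow>\<^sub>h
        \<langle>a, U\<rangle>\<^sub>h \<in>\<^sub>h R \<longrightarrow>\<^sub>h hcovers \<tau> R U V \<longrightarrow>\<^sub>h \<langle>a, V\<rangle>\<^sub>h \<in>\<^sub>h R) \<and>\<^sub>h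
     (\<forall>\<^sub>h a:\<tau>. \<forall>\<^sub>h U:HPow \<tau>. \<forall>\<^sub>h V:HPow \<tau>.
        a \<in>\<^sub>h S \<longrightarrow>\<^sub>h hsubset \<tau> U S \<longrightarrow>\<^sub>h hsubset \<tau> V S \<longrightarrow>\<^sub>h
        \<langle>a, U\<rangle>\<^sub>h \<in>\<^sub>h R \<longrightarrow>\<^sub>h \<langle>a, V\<rangle>\<^sub>h \<in>\<^sub>h R \<longrightarrow>\<^sub>h \<langle>a, hdown \<tau> S R U V\<rangle>\<^sub>h \<in>\<^sub>h R))"

definition hBoolean :: "hty \<Rightarrow> hb \<Rightarrow> hb \<Rightarrow> hb" where
  "hBoolean \<tau> S R = (\<forall>\<^sub>h U:HPow \<tau>. hsubset \<tau> U S \<longrightarrow>\<^sub>h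
     hcovers \<tau> R S (hcup \<tau> U (hpstar \<tau> S R U)))"

definition hDeMorgan :: "hty \<Rightarrow> hb \<Rightarrow> hb \<Rightarrow> hb" where
  "hDeMorgan \<tau> S R = (\<forall>\<^sub>h U:HPow \<tau>. hsubset \<tau> U S \<longrightarrow>\<^sub>h
     hcovers \<tau> R S (hcup \<tau> (hpstar \<tau> S R (hpstar \<tau> S R U)) (hpstar \<tau> S R U)))"

definition hpoint :: "hty \<Rightarrow> hb \<Rightarrow> hb \<Rightarrow> hb \<Rightarrow> hb" where
  "hpoint \<tau> S R \<alpha> =
    (hsubset \<tau> \<alpha> S \<and>\<^sub>h
     (\<exists>\<^sub>h a:\<tau>. a \<in>\<^sub>h \<alpha>) \<and>\<^sub>h
     (\<forall>\<^sub>h a:\<tau>. \<forall>\<^sub>h b:\<tau>. a \<in>\<^sub>h \<alpha> \<longrightarrow>\<^sub>h b \<in>\<^sub>h \<alpha> \<longrightarrow>\<^sub>h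
        (\<exists>\<^sub>h c:\<tau>. c \<in>\<^sub>h \<alpha> \<and>\<^sub>h c \<in>\<^sub>h hdown \<tau> S R (hsing \<tau> a) (hsing \<tau> b))) \<and>\<^sub>h
     (\<forall>\<^sub>h a:\<tau>. \<forall>\<^sub>h U:HPow \<tau>. a \<in>\<^sub>h \<alpha> \<longrightarrow>\<^sub>h hsubset \<tau> U S \<longrightarrow>\<^sub>h \<langle>a, U\<rangle>\<^sub>h \<in>\<^sub>h R \<longrightarrow>\<^sub>h
        (\<exists>\<^sub>h b:\<tau>. b \<in>\<^sub>h U \<and>\<^sub>h b \<in>\<^sub>h \<alpha>)))"

definition HHA_Boolean_with_point :: "hty \<Rightarrow> hb" where
  "HHA_Boolean_with_point \<tau> =
    (\<exists>\<^sub>h S:HPow \<tau>. \<exists>\<^sub>h R:HPow (HProd \<tau> (HPow \<tau>)).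
       hspace \<tau> S R \<and>\<^sub>h hBoolean \<tau> S R \<and>\<^sub>h (\<exists>\<^sub>h \<alpha>:HPow \<tau>. hpoint \<tau> S R \<alpha>))"

definition HHA_DeMorgan_with_point :: "hty \<Rightarrow> hb" where
  "HHA_DeMorgan_with_point \<tau> =
    (\<exists>\<^sub>h S:HPow \<tau>. \<exists>\<^sub>h R:HPow (HProd \<tau> (HPow \<tau>)).
       hspace \<tau> S R \<and>\<^sub>h hDeMorgan \<tau> S R \<and>\<^sub>h (\<exists>\<^sub>h \<alpha>:HPow \<tau>. hpoint \<tau> S R \<alpha>))"

definition hEM :: hb where
  "hEM = (\<forall>\<^sub>h p:HOmega. p \<or>\<^sub>h \<not>\<^sub>h p)"

definition hDML :: hb where
  "hDML = (\<forall>\<^sub>h p:HOmega. \<not>\<^sub>h \<not>\<^sub>h p \<or>\<^sub>h \<not>\<^sub>h p)"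


section \<open>Constructive type theory\<close>

subsection \<open>Syntax of the logical framework\<close>

text \<open>
  Martin-Loef type theory is presented in Martin-Loef's logical framework (monomorphic sets, as
  in Nordstroem, Petersson and Smith).  Types are \<open>Set\<close>, \<open>El A\<close> for a set \<open>A\<close>, and dependent
  function types \<open>(x:A)B\<close>; the set formers, introduction constants and elimination constants
  are typed constants.  Propositions are sets.
\<close>

datatype cst =
    N0 | N0case
  | N1 | N1elem | N1case
  | Nat | Zero | Succ | Natrec
  | Plus | Inl | Inr | When
  | Pi | Lambda | Apply
  | Sigma | Pair | Split
  | Id | Refl | Idpeel
  | W | Sup | Wrec
  | Univ nat | Dec nat
  | UN0 nat | UN1 nat | UNat nat | UPlus nat | UPi nat | USigma nat | UId nat | UW nat
  | UUniv nat | ULift nat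
  | GupI | GupR
  | Ext nat

datatype ttm = Var nat | Cst cst | App ttm ttm | Lam ttm

datatype tty = TSet | TEl ttm | TFun tty tty

primrec tren :: "(nat \<Rightarrow> nat) \<Rightarrow> ttm \<Rightarrow> ttm" where
  "tren f (Var n) = Var (f n)"
| "tren f (Cst c) = Cst c"
| "tren f (App s t) = App (tren f s) (tren f t)"
| "tren f (Lam t) = Lam (tren (up f) t)"

definition tup :: "(nat \<Rightarrow> ttm) \<Rightarrow> nat \<Rightarrow> ttm" where
  "tup \<sigma> = case_nat (Var 0) (\<lambda>n. tren Suc (\<sigma> n))"

primrec tsub :: "(nat \<Rightarrow> ttm) \<Rightarrow> ttm \<Rightarrow> ttm" where
  "tsub \<sigma> (Var n) = \<sigma> n"
| "tsub \<sigma> (Cst c) = Cst c"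
| "tsub \<sigma> (App s t) = App (tsub \<sigma> s) (tsub \<sigma> t)"
| "tsub \<sigma> (Lam t) = Lam (tsub (tup \<sigma>) t)"

primrec tyren :: "(nat \<Rightarrow> nat) \<Rightarrow> tty \<Rightarrow> tty" where
  "tyren f TSet = TSet"
| "tyren f (TEl t) = TEl (tren f t)"
| "tyren f (TFun A B) = TFun (tyren f A) (tyren (up f) B)"

primrec tysub :: "(nat \<Rightarrow> ttm) \<Rightarrow> tty \<Rightarrow> tty" where
  "tysub \<sigma> TSet = TSet"
| "tysub \<sigma> (TEl t) = TEl (tsub \<sigma> t)"
| "tysub \<sigma> (TFun A B) = TFun (tysub \<sigma> A) (tysub (tup \<sigma>) B)"

definition tinst :: "ttm \<Rightarrow> ttm \<Rightarrow> ttm" where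
  "tinst t b = tsub (case_nat t Var) b"

definition tyinst :: "ttm \<Rightarrow> tty \<Rightarrow> tty" where
  "tyinst t B = tysub (case_nat t Var) B"

subsection \<open>Judgements, rules and derivability\<close>

datatype judg =
    Ctx "tty list"
  | IsTy "tty list" tty
  | EqTy "tty list" tty tty
  | HasTy "tty list" ttm tty
  | EqTm "tty list" ttm ttm tty

text \<open>
  A type theory is a set of rules, each a pair of premises and conclusion; an extension of a
  theory is a larger set of rules.
\<close>

type_synonym rule = "judg list \<times> judg"

inductive derives :: "rule set \<Rightarrow> judg \<Rightarrow> bool" for R where
  "(Js, J) \<in> R \<Longrightarrow> \<forall>J' \<in> set Js. derives R J' \<Longrightarrow> derives R J"

text \<open>The head of a context is the most recently declared variable, which has index \<open>0\<close>.\<close>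

inductive_set LF :: "rule set" where
  CtxNil: "([], Ctx []) \<in> LF"
| CtxCons: "([Ctx \<Gamma>, IsTy \<Gamma> A], Ctx (A # \<Gamma>)) \<in> LF"
| TyRefl: "([IsTy \<Gamma> A], EqTy \<Gamma> A A) \<in> LF"
| TySym: "([EqTy \<Gamma> A B], EqTy \<Gamma> B A) \<in> LF"
| TyTrans: "([EqTy \<Gamma> A B, EqTy \<Gamma> B C], EqTy \<Gamma> A C) \<in> LF"
| TmRefl: "([HasTy \<Gamma> a A], EqTm \<Gamma> a a A) \<in> LF"
| TmSym: "([EqTm \<Gamma> a b A], EqTm \<Gamma> b a A) \<in> LF"
| TmTrans: "([EqTm \<Gamma> a b A, EqTm \<Gamma> b c A], EqTm \<Gamma> a c A) \<in> LF"
| TmConv: "([HasTy \<Gamma> a A, EqTy \<Gamma> A B], HasTy \<Gamma> a B) \<in> LF"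
| EqConv: "([EqTm \<Gamma> a b A, EqTy \<Gamma> A B], EqTm \<Gamma> a b B) \<in> LF"
| Assm: "n < length \<Gamma> \<Longrightarrow> ([Ctx \<Gamma>], HasTy \<Gamma> (Var n) (tyren (\<lambda>m. m + Suc n) (\<Gamma> ! n))) \<in> LF"
| SetF: "([Ctx \<Gamma>], IsTy \<Gamma> TSet) \<in> LF"
| ElF: "([HasTy \<Gamma> a TSet], IsTy \<Gamma> (TEl a)) \<in> LF"
| ElEq: "([EqTm \<Gamma> a b TSet], EqTy \<Gamma> (TEl a) (TEl b)) \<in> LF"
| FunF: "([IsTy \<Gamma> A, IsTy (A # \<Gamma>) B], IsTy \<Gamma> (TFun A B)) \<in> LF"
| FunEq: "([EqTy \<Gamma> A A', EqTy (A # \<Gamma>) B B'], EqTy \<Gamma> (TFun A B) (TFun A' B')) \<in> LF"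
| LamI: "([IsTy \<Gamma> A, HasTy (A # \<Gamma>) b B], HasTy \<Gamma> (Lam b) (TFun A B)) \<in> LF"
| LamEq: "([IsTy \<Gamma> A, EqTm (A # \<Gamma>) b b' B], EqTm \<Gamma> (Lam b) (Lam b') (TFun A B)) \<in> LF"
| AppE: "([HasTy \<Gamma> f (TFun A B), HasTy \<Gamma> a A], HasTy \<Gamma> (App f a) (tyinst a B)) \<in> LF"
| AppEq: "([EqTm \<Gamma> f f' (TFun A B), EqTm \<Gamma> a a' A], EqTm \<Gamma> (App f a) (App f' a') (tyinst a B)) \<in> LF"
| Beta: "([HasTy (A # \<Gamma>) b B, HasTy \<Gamma> a A],
    EqTm \<Gamma> (App (Lam b) a) (tinst a b) (tyinst a B)) \<in> LF"
| Eta: "([HasTy \<Gamma> f (TFun A B)], EqTm \<Gamma> (Lam (App (tren Suc f) (Var 0))) f (TFun A B)) \<in> LF"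

subsection \<open>Builders\<close>

type_synonym tb = "nat \<Rightarrow> ttm"
type_synonym tyb = "nat \<Rightarrow> tty"

definition tvar :: "nat \<Rightarrow> tb" where
  "tvar l = (\<lambda>d. Var (d - Suc l))"

definition tcst :: "cst \<Rightarrow> tb" ("\<lfloor>_\<rfloor>") where
  "tcst c = (\<lambda>d. Cst c)"

definition tapp :: "tb \<Rightarrow> tb \<Rightarrow> tb" (infixl "\<cdot>" 80) where
  "tapp s t = (\<lambda>d. App (s d) (t d))"

definition tlam :: "(tb \<Rightarrow> tb) \<Rightarrow> tb" (binder "\<lambda>\<^sub>t" 10) where
  "tlam F = (\<lambda>d. Lam (F (tvar d) (Suc d)))"

definition tset :: tyb where
  "tset = (\<lambda>d. TSet)"

definition tel :: "tb \<Rightarrow> tyb" where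
  "tel A = (\<lambda>d. TEl (A d))"

definition tfun :: "tyb \<Rightarrow> (tb \<Rightarrow> tyb) \<Rightarrow> tyb" where
  "tfun A B = (\<lambda>d. TFun (A d) (B (tvar d) (Suc d)))"

definition tarrow :: "tyb \<Rightarrow> tyb \<Rightarrow> tyb" (infixr "\<rightarrow>\<^sub>t" 20) where
  "tarrow A B = tfun A (\<lambda>x. B)"

syntax
  "_tfun" :: "pttrn \<Rightarrow> tyb \<Rightarrow> tyb \<Rightarrow> tyb" ("(3\<Prod>\<^sub>t_:_./ _)" [0, 0, 10] 10)
translations
  "\<Prod>\<^sub>t x:A. B" == "CONST tfun A (\<lambda>x. B)"

text \<open>Propositions as sets.\<close>

definition tall :: "tb \<Rightarrow> (tb \<Rightarrow> tb) \<Rightarrow> tb" where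
  "tall A F = \<lfloor>Pi\<rfloor> \<cdot> A \<cdot> tlam F"

definition tex :: "tb \<Rightarrow> (tb \<Rightarrow> tb) \<Rightarrow> tb" where
  "tex A F = \<lfloor>Sigma\<rfloor> \<cdot> A \<cdot> tlam F"

syntax
  "_tall" :: "pttrn \<Rightarrow> tb \<Rightarrow> tb \<Rightarrow> tb" ("(3\<forall>\<^sub>t_:_./ _)" [0, 0, 10] 10)
  "_tex" :: "pttrn \<Rightarrow> tb \<Rightarrow> tb \<Rightarrow> tb" ("(3\<exists>\<^sub>t_:_./ _)" [0, 0, 10] 10)
translations
  "\<forall>\<^sub>t x:A. B" == "CONST tall A (\<lambda>x. B)"
  "\<exists>\<^sub>t x:A. B" == "CONST tex A (\<lambda>x. B)"

definition tand :: "tb \<Rightarrow> tb \<Rightarrow> tb" (infixr "\<and>\<^sub>t" 35) where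
  "tand A B = (\<exists>\<^sub>t x:A. B)"

definition tor :: "tb \<Rightarrow> tb \<Rightarrow> tb" (infixr "\<or>\<^sub>t" 30) where
  "tor A B = \<lfloor>Plus\<rfloor> \<cdot> A \<cdot> B"

definition timpl :: "tb \<Rightarrow> tb \<Rightarrow> tb" (infixr "\<longrightarrow>\<^sub>t" 25) where
  "timpl A B = (\<forall>\<^sub>t x:A. B)"

definition tnot :: "tb \<Rightarrow> tb" ("\<not>\<^sub>t _" [40] 40) where
  "tnot A = (A \<longrightarrow>\<^sub>t \<lfloor>N0\<rfloor>)"

subsection \<open>The sets of Martin-Loef type theory\<close>

definition tfam :: "tb \<Rightarrow> tyb" where
  "tfam A = (tel A \<rightarrow>\<^sub>t tset)"

text \<open>
  Typings of the constants: empty and unit set, natural numbers, disjoint unions, dependent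
  products and sums, identity sets, well-orderings, and a cumulative hierarchy of universes
  with decoding \<open>Dec n\<close>.
\<close>

definition ctt_constants :: "(cst \<times> tyb) set" where
  "ctt_constants =
    {(N0, tset),
     (N0case, \<Prod>\<^sub>t C:tfam \<lfloor>N0\<rfloor>. \<Prod>\<^sub>t a:tel \<lfloor>N0\<rfloor>. tel (C \<cdot> a)),
     (N1, tset),
     (N1elem, tel \<lfloor>N1\<rfloor>),
     (N1case, \<Prod>\<^sub>t C:tfam \<lfloor>N1\<rfloor>. tel (C \<cdot> \<lfloor>N1elem\<rfloor>) \<rightarrow>\<^sub>t (\<Prod>\<^sub>t a:tel \<lfloor>N1\<rfloor>. tel (C \<cdot> a))),
     (Nat, tset),
     (Zero, tel \<lfloor>Nat\<rfloor>),
     (Succ, tel \<lfloor>Nat\<rfloor> \<rightarrow>\<^sub>t tel \<lfloor>Nat\<rfloor>),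
     (Natrec, \<Prod>\<^sub>t C:tfam \<lfloor>Nat\<rfloor>. tel (C \<cdot> \<lfloor>Zero\<rfloor>) \<rightarrow>\<^sub>t
        (\<Prod>\<^sub>t n:tel \<lfloor>Nat\<rfloor>. tel (C \<cdot> n) \<rightarrow>\<^sub>t tel (C \<cdot> (\<lfloor>Succ\<rfloor> \<cdot> n))) \<rightarrow>\<^sub>t
        (\<Prod>\<^sub>t n:tel \<lfloor>Nat\<rfloor>. tel (C \<cdot> n))),
     (Plus, tset \<rightarrow>\<^sub>t tset \<rightarrow>\<^sub>t tset),
     (Inl, \<Prod>\<^sub>t A:tset. \<Prod>\<^sub>t B:tset. tel A \<rightarrow>\<^sub>t tel (\<lfloor>Plus\<rfloor> \<cdot> A \<cdot> B)),
     (Inr, \<Prod>\<^sub>t A:tset. \<Prod>\<^sub>t B:tset. tel B \<rightarrow>\<^sub>t tel (\<lfloor>Plus\<rfloor> \<cdot> A \<cdot> B)),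
     (When, \<Prod>\<^sub>t A:tset. \<Prod>\<^sub>t B:tset. \<Prod>\<^sub>t C:tfam (\<lfloor>Plus\<rfloor> \<cdot> A \<cdot> B).
        (\<Prod>\<^sub>t a:tel A. tel (C \<cdot> (\<lfloor>Inl\<rfloor> \<cdot> A \<cdot> B \<cdot> a))) \<rightarrow>\<^sub>t
        (\<Prod>\<^sub>t b:tel B. tel (C \<cdot> (\<lfloor>Inr\<rfloor> \<cdot> A \<cdot> B \<cdot> b))) \<rightarrow>\<^sub>t
        (\<Prod>\<^sub>t c:tel (\<lfloor>Plus\<rfloor> \<cdot> A \<cdot> B). tel (C \<cdot> c))),
     (Pi, \<Prod>\<^sub>t A:tset. tfam A \<rightarrow>\<^sub>t tset),
     (Lambda, \<Prod>\<^sub>t A:tset. \<Prod>\<^sub>t B:tfam A. (\<Prod>\<^sub>t x:tel A. tel (B \<cdot> x)) \<rightarrow>\<^sub>t tel (\<lfloor>Pi\<rfloor> \<cdot> A \<cdot> B)),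
     (Apply, \<Prod>\<^sub>t A:tset. \<Prod>\<^sub>t B:tfam A. tel (\<lfloor>Pi\<rfloor> \<cdot> A \<cdot> B) \<rightarrow>\<^sub>t (\<Prod>\<^sub>t a:tel A. tel (B \<cdot> a))),
     (Sigma, \<Prod>\<^sub>t A:tset. tfam A \<rightarrow>\<^sub>t tset),
     (Pair, \<Prod>\<^sub>t A:tset. \<Prod>\<^sub>t B:tfam A. \<Prod>\<^sub>t a:tel A. tel (B \<cdot> a) \<rightarrow>\<^sub>t tel (\<lfloor>Sigma\<rfloor> \<cdot> A \<cdot> B)),
     (Split, \<Prod>\<^sub>t A:tset. \<Prod>\<^sub>t B:tfam A. \<Prod>\<^sub>t C:tfam (\<lfloor>Sigma\<rfloor> \<cdot> A \<cdot> B).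
        (\<Prod>\<^sub>t a:tel A. \<Prod>\<^sub>t b:tel (B \<cdot> a). tel (C \<cdot> (\<lfloor>Pair\<rfloor> \<cdot> A \<cdot> B \<cdot> a \<cdot> b))) \<rightarrow>\<^sub>t
        (\<Prod>\<^sub>t c:tel (\<lfloor>Sigma\<rfloor> \<cdot> A \<cdot> B). tel (C \<cdot> c))),
     (Id, \<Prod>\<^sub>t A:tset. tel A \<rightarrow>\<^sub>t tel A \<rightarrow>\<^sub>t tset),
     (Refl, \<Prod>\<^sub>t A:tset. \<Prod>\<^sub>t a:tel A. tel (\<lfloor>Id\<rfloor> \<cdot> A \<cdot> a \<cdot> a)),
     (Idpeel, \<Prod>\<^sub>t A:tset. \<Prod>\<^sub>t C:(\<Prod>\<^sub>t x:tel A. \<Prod>\<^sub>t y:tel A. tfam (\<lfloor>Id\<rfloor> \<cdot> A \<cdot> x \<cdot> y)).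
        (\<Prod>\<^sub>t x:tel A. tel (C \<cdot> x \<cdot> x \<cdot> (\<lfloor>Refl\<rfloor> \<cdot> A \<cdot> x))) \<rightarrow>\<^sub>t
        (\<Prod>\<^sub>t a:tel A. \<Prod>\<^sub>t b:tel A. \<Prod>\<^sub>t c:tel (\<lfloor>Id\<rfloor> \<cdot> A \<cdot> a \<cdot> b). tel (C \<cdot> a \<cdot> b \<cdot> c))),
     (W, \<Prod>\<^sub>t A:tset. tfam A \<rightarrow>\<^sub>t tset),
     (Sup, \<Prod>\<^sub>t A:tset. \<Prod>\<^sub>t B:tfam A. \<Prod>\<^sub>t a:tel A.
        (tel (B \<cdot> a) \<rightarrow>\<^sub>t tel (\<lfloor>W\<rfloor> \<cdot> A \<cdot> B)) \<rightarrow>\<^sub>t tel (\<lfloor>W\<rfloor> \<cdot> A \<cdot> B)),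
     (Wrec, \<Prod>\<^sub>t A:tset. \<Prod>\<^sub>t B:tfam A. \<Prod>\<^sub>t C:tfam (\<lfloor>W\<rfloor> \<cdot> A \<cdot> B).
        (\<Prod>\<^sub>t a:tel A. \<Prod>\<^sub>t f:(tel (B \<cdot> a) \<rightarrow>\<^sub>t tel (\<lfloor>W\<rfloor> \<cdot> A \<cdot> B)).
           (\<Prod>\<^sub>t x:tel (B \<cdot> a). tel (C \<cdot> (f \<cdot> x))) \<rightarrow>\<^sub>t tel (C \<cdot> (\<lfloor>Sup\<rfloor> \<cdot> A \<cdot> B \<cdot> a \<cdot> f))) \<rightarrow>\<^sub>t
        (\<Prod>\<^sub>t w:tel (\<lfloor>W\<rfloor> \<cdot> A \<cdot> B). tel (C \<cdot> w)))}
   \<union> (\<Union>n.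
    {(Univ n, tset),
     (Dec n, tfam \<lfloor>Univ n\<rfloor>),
     (UN0 n, tel \<lfloor>Univ n\<rfloor>),
     (UN1 n, tel \<lfloor>Univ n\<rfloor>),
     (UNat n, tel \<lfloor>Univ n\<rfloor>),
     (UPlus n, tel \<lfloor>Univ n\<rfloor> \<rightarrow>\<^sub>t tel \<lfloor>Univ n\<rfloor> \<rightarrow>\<^sub>t tel \<lfloor>Univ n\<rfloor>),
     (UPi n, \<Prod>\<^sub>t a:tel \<lfloor>Univ n\<rfloor>. (tel (\<lfloor>Dec n\<rfloor> \<cdot> a) \<rightarrow>\<^sub>t tel \<lfloor>Univ n\<rfloor>) \<rightarrow>\<^sub>t tel \<lfloor>Univ n\<rfloor>),
     (USigma n, \<Prod>\<^sub>t a:tel \<lfloor>Univ n\<rfloor>. (tel (\<lfloor>Dec n\<rfloor> \<cdot> a) \<rightarrow>\<^sub>t tel \<lfloor>Univ n\<rfloor>) \<rightarrow>\<^sub>t tel \<lfloor>Univ n\<rfloor>),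
     (UW n, \<Prod>\<^sub>t a:tel \<lfloor>Univ n\<rfloor>. (tel (\<lfloor>Dec n\<rfloor> \<cdot> a) \<rightarrow>\<^sub>t tel \<lfloor>Univ n\<rfloor>) \<rightarrow>\<^sub>t tel \<lfloor>Univ n\<rfloor>),
     (UId n, \<Prod>\<^sub>t a:tel \<lfloor>Univ n\<rfloor>. tel (\<lfloor>Dec n\<rfloor> \<cdot> a) \<rightarrow>\<^sub>t tel (\<lfloor>Dec n\<rfloor> \<cdot> a) \<rightarrow>\<^sub>t tel \<lfloor>Univ n\<rfloor>),
     (UUniv n, tel \<lfloor>Univ (Suc n)\<rfloor>),
     (ULift n, tel \<lfloor>Univ n\<rfloor> \<rightarrow>\<^sub>t tel \<lfloor>Univ (Suc n)\<rfloor>)})"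

text \<open>
  The computation rules.  Each is stated as an equation \<open>s = t : A\<close> between closed
  abstractions; its instances follow by application and \<open>\<beta>\<close>-conversion.
\<close>

definition ctt_equations :: "(tb \<times> tb \<times> tyb) set" where
  "ctt_equations =
    {(\<lambda>\<^sub>t C c. \<lfloor>N1case\<rfloor> \<cdot> C \<cdot> c \<cdot> \<lfloor>N1elem\<rfloor>,
      \<lambda>\<^sub>t C c. c,
      \<Prod>\<^sub>t C:tfam \<lfloor>N1\<rfloor>. tel (C \<cdot> \<lfloor>N1elem\<rfloor>) \<rightarrow>\<^sub>t tel (C \<cdot> \<lfloor>N1elem\<rfloor>)),
     (\<lambda>\<^sub>t C e f. \<lfloor>Natrec\<rfloor> \<cdot> C \<cdot> e \<cdot> f \<cdot> \<lfloor>Zero\<rfloor>,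
      \<lambda>\<^sub>t C e f. e,
      \<Prod>\<^sub>t C:tfam \<lfloor>Nat\<rfloor>. tel (C \<cdot> \<lfloor>Zero\<rfloor>) \<rightarrow>\<^sub>t
        (\<Prod>\<^sub>t n:tel \<lfloor>Nat\<rfloor>. tel (C \<cdot> n) \<rightarrow>\<^sub>t tel (C \<cdot> (\<lfloor>Succ\<rfloor> \<cdot> n))) \<rightarrow>\<^sub>t
        tel (C \<cdot> \<lfloor>Zero\<rfloor>)),
     (\<lambda>\<^sub>t C e f n. \<lfloor>Natrec\<rfloor> \<cdot> C \<cdot> e \<cdot> f \<cdot> (\<lfloor>Succ\<rfloor> \<cdot> n),
      \<lambda>\<^sub>t C e f n. f \<cdot> n \<cdot> (\<lfloor>Natrec\<rfloor> \<cdot> C \<cdot> e \<cdot> f \<cdot> n),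
      \<Prod>\<^sub>t C:tfam \<lfloor>Nat\<rfloor>. tel (C \<cdot> \<lfloor>Zero\<rfloor>) \<rightarrow>\<^sub>t
        (\<Prod>\<^sub>t n:tel \<lfloor>Nat\<rfloor>. tel (C \<cdot> n) \<rightarrow>\<^sub>t tel (C \<cdot> (\<lfloor>Succ\<rfloor> \<cdot> n))) \<rightarrow>\<^sub>t
        (\<Prod>\<^sub>t n:tel \<lfloor>Nat\<rfloor>. tel (C \<cdot> (\<lfloor>Succ\<rfloor> \<cdot> n)))),
     (\<lambda>\<^sub>t A B C f g a. \<lfloor>When\<rfloor> \<cdot> A \<cdot> B \<cdot> C \<cdot> f \<cdot> g \<cdot> (\<lfloor>Inl\<rfloor> \<cdot> A \<cdot> B \<cdot> a),
      \<lambda>\<^sub>t A B C f g a. f \<cdot> a,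
      \<Prod>\<^sub>t A:tset. \<Prod>\<^sub>t B:tset. \<Prod>\<^sub>t C:tfam (\<lfloor>Plus\<rfloor> \<cdot> A \<cdot> B).
        (\<Prod>\<^sub>t a:tel A. tel (C \<cdot> (\<lfloor>Inl\<rfloor> \<cdot> A \<cdot> B \<cdot> a))) \<rightarrow>\<^sub>t
        (\<Prod>\<^sub>t b:tel B. tel (C \<cdot> (\<lfloor>Inr\<rfloor> \<cdot> A \<cdot> B \<cdot> b))) \<rightarrow>\<^sub>t
        (\<Prod>\<^sub>t a:tel A. tel (C \<cdot> (\<lfloor>Inl\<rfloor> \<cdot> A \<cdot> B \<cdot> a)))),
     (\<lambda>\<^sub>t A B C f g b. \<lfloor>When\<rfloor> \<cdot> A \<cdot> B \<cdot> C \<cdot> f \<cdot> g \<cdot> (\<lfloor>Inr\<rfloor> \<cdot> A \<cdot> B \<cdot> b),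
      \<lambda>\<^sub>t A B C f g b. g \<cdot> b,
      \<Prod>\<^sub>t A:tset. \<Prod>\<^sub>t B:tset. \<Prod>\<^sub>t C:tfam (\<lfloor>Plus\<rfloor> \<cdot> A \<cdot> B).
        (\<Prod>\<^sub>t a:tel A. tel (C \<cdot> (\<lfloor>Inl\<rfloor> \<cdot> A \<cdot> B \<cdot> a))) \<rightarrow>\<^sub>t
        (\<Prod>\<^sub>t b:tel B. tel (C \<cdot> (\<lfloor>Inr\<rfloor> \<cdot> A \<cdot> B \<cdot> b))) \<rightarrow>\<^sub>t
        (\<Prod>\<^sub>t b:tel B. tel (C \<cdot> (\<lfloor>Inr\<rfloor> \<cdot> A \<cdot> B \<cdot> b)))),
     (\<lambda>\<^sub>t A B f a. \<lfloor>Apply\<rfloor> \<cdot> A \<cdot> B \<cdot> (\<lfloor>Lambda\<rfloor> \<cdot> A \<cdot> B \<cdot> f) \<cdot> a,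
      \<lambda>\<^sub>t A B f a. f \<cdot> a,
      \<Prod>\<^sub>t A:tset. \<Prod>\<^sub>t B:tfam A. (\<Prod>\<^sub>t x:tel A. tel (B \<cdot> x)) \<rightarrow>\<^sub>t (\<Prod>\<^sub>t a:tel A. tel (B \<cdot> a))),
     (\<lambda>\<^sub>t A B C f a b. \<lfloor>Split\<rfloor> \<cdot> A \<cdot> B \<cdot> C \<cdot> f \<cdot> (\<lfloor>Pair\<rfloor> \<cdot> A \<cdot> B \<cdot> a \<cdot> b),
      \<lambda>\<^sub>t A B C f a b. f \<cdot> a \<cdot> b,
      \<Prod>\<^sub>t A:tset. \<Prod>\<^sub>t B:tfam A. \<Prod>\<^sub>t C:tfam (\<lfloor>Sigma\<rfloor> \<cdot> A \<cdot> B).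
        (\<Prod>\<^sub>t a:tel A. \<Prod>\<^sub>t b:tel (B \<cdot> a). tel (C \<cdot> (\<lfloor>Pair\<rfloor> \<cdot> A \<cdot> B \<cdot> a \<cdot> b))) \<rightarrow>\<^sub>t
        (\<Prod>\<^sub>t a:tel A. \<Prod>\<^sub>t b:tel (B \<cdot> a). tel (C \<cdot> (\<lfloor>Pair\<rfloor> \<cdot> A \<cdot> B \<cdot> a \<cdot> b)))),
     (\<lambda>\<^sub>t A C f a. \<lfloor>Idpeel\<rfloor> \<cdot> A \<cdot> C \<cdot> f \<cdot> a \<cdot> a \<cdot> (\<lfloor>Refl\<rfloor> \<cdot> A \<cdot> a),
      \<lambda>\<^sub>t A C f a. f \<cdot> a,
      \<Prod>\<^sub>t A:tset. \<Prod>\<^sub>t C:(\<Prod>\<^sub>t x:tel A. \<Prod>\<^sub>t y:tel A. tfam (\<lfloor>Id\<rfloor> \<cdot> A \<cdot> x \<cdot> y)).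
        (\<Prod>\<^sub>t x:tel A. tel (C \<cdot> x \<cdot> x \<cdot> (\<lfloor>Refl\<rfloor> \<cdot> A \<cdot> x))) \<rightarrow>\<^sub>t
        (\<Prod>\<^sub>t a:tel A. tel (C \<cdot> a \<cdot> a \<cdot> (\<lfloor>Refl\<rfloor> \<cdot> A \<cdot> a)))),
     (\<lambda>\<^sub>t A B C g a f. \<lfloor>Wrec\<rfloor> \<cdot> A \<cdot> B \<cdot> C \<cdot> g \<cdot> (\<lfloor>Sup\<rfloor> \<cdot> A \<cdot> B \<cdot> a \<cdot> f),
      \<lambda>\<^sub>t A B C g a f. g \<cdot> a \<cdot> f \<cdot> (\<lambda>\<^sub>t x. \<lfloor>Wrec\<rfloor> \<cdot> A \<cdot> B \<cdot> C \<cdot> g \<cdot> (f \<cdot> x)),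
      \<Prod>\<^sub>t A:tset. \<Prod>\<^sub>t B:tfam A. \<Prod>\<^sub>t C:tfam (\<lfloor>W\<rfloor> \<cdot> A \<cdot> B).
        (\<Prod>\<^sub>t a:tel A. \<Prod>\<^sub>t f:(tel (B \<cdot> a) \<rightarrow>\<^sub>t tel (\<lfloor>W\<rfloor> \<cdot> A \<cdot> B)).
           (\<Prod>\<^sub>t x:tel (B \<cdot> a). tel (C \<cdot> (f \<cdot> x))) \<rightarrow>\<^sub>t tel (C \<cdot> (\<lfloor>Sup\<rfloor> \<cdot> A \<cdot> B \<cdot> a \<cdot> f))) \<rightarrow>\<^sub>t
        (\<Prod>\<^sub>t a:tel A. \<Prod>\<^sub>t f:(tel (B \<cdot> a) \<rightarrow>\<^sub>t tel (\<lfloor>W\<rfloor> \<cdot> A \<cdot> B)).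
           tel (C \<cdot> (\<lfloor>Sup\<rfloor> \<cdot> A \<cdot> B \<cdot> a \<cdot> f))))}
   \<union> (\<Union>n.
    {(\<lfloor>Dec n\<rfloor> \<cdot> \<lfloor>UN0 n\<rfloor>, \<lfloor>N0\<rfloor>, tset),
     (\<lfloor>Dec n\<rfloor> \<cdot> \<lfloor>UN1 n\<rfloor>, \<lfloor>N1\<rfloor>, tset),
     (\<lfloor>Dec n\<rfloor> \<cdot> \<lfloor>UNat n\<rfloor>, \<lfloor>Nat\<rfloor>, tset),
     (\<lambda>\<^sub>t a b. \<lfloor>Dec n\<rfloor> \<cdot> (\<lfloor>UPlus n\<rfloor> \<cdot> a \<cdot> b),
      \<lambda>\<^sub>t a b. \<lfloor>Plus\<rfloor> \<cdot> (\<lfloor>Dec n\<rfloor> \<cdot> a) \<cdot> (\<lfloor>Dec n\<rfloor> \<cdot> b),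
      tel \<lfloor>Univ n\<rfloor> \<rightarrow>\<^sub>t tel \<lfloor>Univ n\<rfloor> \<rightarrow>\<^sub>t tset),
     (\<lambda>\<^sub>t a b. \<lfloor>Dec n\<rfloor> \<cdot> (\<lfloor>UPi n\<rfloor> \<cdot> a \<cdot> b),
      \<lambda>\<^sub>t a b. \<lfloor>Pi\<rfloor> \<cdot> (\<lfloor>Dec n\<rfloor> \<cdot> a) \<cdot> (\<lambda>\<^sub>t x. \<lfloor>Dec n\<rfloor> \<cdot> (b \<cdot> x)),
      \<Prod>\<^sub>t a:tel \<lfloor>Univ n\<rfloor>. (tel (\<lfloor>Dec n\<rfloor> \<cdot> a) \<rightarrow>\<^sub>t tel \<lfloor>Univ n\<rfloor>) \<rightarrow>\<^sub>t tset),
     (\<lambda>\<^sub>t a b. \<lfloor>Dec n\<rfloor> \<cdot> (\<lfloor>USigma n\<rfloor> \<cdot> a \<cdot> b),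
      \<lambda>\<^sub>t a b. \<lfloor>Sigma\<rfloor> \<cdot> (\<lfloor>Dec n\<rfloor> \<cdot> a) \<cdot> (\<lambda>\<^sub>t x. \<lfloor>Dec n\<rfloor> \<cdot> (b \<cdot> x)),
      \<Prod>\<^sub>t a:tel \<lfloor>Univ n\<rfloor>. (tel (\<lfloor>Dec n\<rfloor> \<cdot> a) \<rightarrow>\<^sub>t tel \<lfloor>Univ n\<rfloor>) \<rightarrow>\<^sub>t tset),
     (\<lambda>\<^sub>t a b. \<lfloor>Dec n\<rfloor> \<cdot> (\<lfloor>UW n\<rfloor> \<cdot> a \<cdot> b),
      \<lambda>\<^sub>t a b. \<lfloor>W\<rfloor> \<cdot> (\<lfloor>Dec n\<rfloor> \<cdot> a) \<cdot> (\<lambda>\<^sub>t x. \<lfloor>Dec n\<rfloor> \<cdot> (b \<cdot> x)),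
      \<Prod>\<^sub>t a:tel \<lfloor>Univ n\<rfloor>. (tel (\<lfloor>Dec n\<rfloor> \<cdot> a) \<rightarrow>\<^sub>t tel \<lfloor>Univ n\<rfloor>) \<rightarrow>\<^sub>t tset),
     (\<lambda>\<^sub>t a x y. \<lfloor>Dec n\<rfloor> \<cdot> (\<lfloor>UId n\<rfloor> \<cdot> a \<cdot> x \<cdot> y),
      \<lambda>\<^sub>t a x y. \<lfloor>Id\<rfloor> \<cdot> (\<lfloor>Dec n\<rfloor> \<cdot> a) \<cdot> x \<cdot> y,
      \<Prod>\<^sub>t a:tel \<lfloor>Univ n\<rfloor>. tel (\<lfloor>Dec n\<rfloor> \<cdot> a) \<rightarrow>\<^sub>t tel (\<lfloor>Dec n\<rfloor> \<cdot> a) \<rightarrow>\<^sub>t tset),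
     (\<lfloor>Dec (Suc n)\<rfloor> \<cdot> \<lfloor>UUniv n\<rfloor>, \<lfloor>Univ n\<rfloor>, tset),
     (\<lambda>\<^sub>t a. \<lfloor>Dec (Suc n)\<rfloor> \<cdot> (\<lfloor>ULift n\<rfloor> \<cdot> a),
      \<lambda>\<^sub>t a. \<lfloor>Dec n\<rfloor> \<cdot> a,
      tel \<lfloor>Univ n\<rfloor> \<rightarrow>\<^sub>t tset)})"

definition CTT :: "rule set" where
  "CTT = LF
    \<union> {([Ctx \<Gamma>], HasTy \<Gamma> (Cst c) (A 0)) | \<Gamma> c A. (c, A) \<in> ctt_constants}
    \<union> {([Ctx \<Gamma>], EqTm \<Gamma> (s 0) (t 0) (A 0)) | \<Gamma> s t A. (s, t, A) \<in> ctt_equations}"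

text \<open>
  GUP-CTT: since the conclusion quantifies over all propositions and is not itself a
  proposition, the element of \<open>I\<close> and the verification are two constants.
\<close>

definition GUP_CTT :: "rule set" where
  "GUP_CTT =
    {([Ctx \<Gamma>], HasTy \<Gamma> (Cst GupI)
       ((\<Prod>\<^sub>t I:tset. \<Prod>\<^sub>t R:(tset \<rightarrow>\<^sub>t tfam I). \<Prod>\<^sub>t F:(tset \<rightarrow>\<^sub>t tel I).
          (\<Prod>\<^sub>t P:tset. tel (R \<cdot> P \<cdot> (F \<cdot> P))) \<rightarrow>\<^sub>t tel I) 0)) | \<Gamma>. True}
   \<union> {([Ctx \<Gamma>], HasTy \<Gamma> (Cst GupR)
       ((\<Prod>\<^sub>t I:tset. \<Prod>\<^sub>t R:(tset \<rightarrow>\<^sub>t tfam I). \<Prod>\<^sub>t F:(tset \<rightarrow>\<^sub>t tel I).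
          \<Prod>\<^sub>t r:(\<Prod>\<^sub>t P:tset. tel (R \<cdot> P \<cdot> (F \<cdot> P))).
          \<Prod>\<^sub>t P:tset. tel (R \<cdot> P \<cdot> (\<lfloor>GupI\<rfloor> \<cdot> I \<cdot> R \<cdot> F \<cdot> r))) 0)) | \<Gamma>. True}"

definition tconsistent :: "rule set \<Rightarrow> bool" where
  "tconsistent R \<longleftrightarrow> \<not> (\<exists>t. derives R (HasTy [] t (TEl (Cst N0))))"

definition CTT_star :: "rule set \<Rightarrow> bool" where
  "CTT_star R \<longleftrightarrow> CTT \<subseteq> R \<and> tconsistent (R \<union> GUP_CTT)"

definition tinhabited :: "rule set \<Rightarrow> tyb \<Rightarrow> bool" where
  "tinhabited R A \<longleftrightarrow> (\<exists>t. derives R (HasTy [] t (A 0)))"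

subsection \<open>Formal spaces in CTT\<close>

text \<open>
  A subset of a set \<open>S\<close> is a propositional function on \<open>S\<close>; the cover \<open>C\<close> has type
  \<open>(El S)((El S)Set)Set\<close>.
\<close>

definition tsing :: "tb \<Rightarrow> tb \<Rightarrow> tb" where
  "tsing S u = (\<lambda>\<^sub>t x. \<lfloor>Id\<rfloor> \<cdot> S \<cdot> x \<cdot> u)"

definition tnull :: tb where
  "tnull = (\<lambda>\<^sub>t x. \<lfloor>N0\<rfloor>)"

definition tcup :: "tb \<Rightarrow> tb \<Rightarrow> tb" where
  "tcup U V = (\<lambda>\<^sub>t x. U \<cdot> x \<or>\<^sub>t V \<cdot> x)"

definition tcovers :: "tb \<Rightarrow> tb \<Rightarrow> tb \<Rightarrow> tb \<Rightarrow> tb" where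
  "tcovers S C U V = (\<forall>\<^sub>t u:S. U \<cdot> u \<longrightarrow>\<^sub>t C \<cdot> u \<cdot> V)"

definition tdown :: "tb \<Rightarrow> tb \<Rightarrow> tb \<Rightarrow> tb \<Rightarrow> tb" where
  "tdown S C U V = (\<lambda>\<^sub>t d. (\<exists>\<^sub>t u:S. U \<cdot> u \<and>\<^sub>t C \<cdot> d \<cdot> tsing S u)
                         \<and>\<^sub>t (\<exists>\<^sub>t v:S. V \<cdot> v \<and>\<^sub>t C \<cdot> d \<cdot> tsing S v))"

definition tstar :: "tb \<Rightarrow> tb \<Rightarrow> tb \<Rightarrow> tb" where
  "tstar S C U = (\<lambda>\<^sub>t a. tcovers S C (tdown S C (tsing S a) U) tnull)"

definition tspace_refl :: "tb \<Rightarrow> tb \<Rightarrow> tyb" where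
  "tspace_refl S C = (\<Prod>\<^sub>t a:tel S. \<Prod>\<^sub>t U:tfam S. tel (U \<cdot> a) \<rightarrow>\<^sub>t tel (C \<cdot> a \<cdot> U))"

definition tspace_trans :: "tb \<Rightarrow> tb \<Rightarrow> tyb" where
  "tspace_trans S C = (\<Prod>\<^sub>t a:tel S. \<Prod>\<^sub>t U:tfam S. \<Prod>\<^sub>t V:tfam S.
     tel (C \<cdot> a \<cdot> U) \<rightarrow>\<^sub>t tel (tcovers S C U V) \<rightarrow>\<^sub>t tel (C \<cdot> a \<cdot> V))"

definition tspace_down :: "tb \<Rightarrow> tb \<Rightarrow> tyb" where
  "tspace_down S C = (\<Prod>\<^sub>t a:tel S. \<Prod>\<^sub>t U:tfam S. \<Prod>\<^sub>t V:tfam S.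
     tel (C \<cdot> a \<cdot> U) \<rightarrow>\<^sub>t tel (C \<cdot> a \<cdot> V) \<rightarrow>\<^sub>t tel (C \<cdot> a \<cdot> tdown S C U V))"

definition tBoolean :: "tb \<Rightarrow> tb \<Rightarrow> tyb" where
  "tBoolean S C = (\<Prod>\<^sub>t U:tfam S. tel (\<forall>\<^sub>t a:S. C \<cdot> a \<cdot> tcup U (tstar S C U)))"

definition tDeMorgan :: "tb \<Rightarrow> tb \<Rightarrow> tyb" where
  "tDeMorgan S C =
    (\<Prod>\<^sub>t U:tfam S. tel (\<forall>\<^sub>t a:S. C \<cdot> a \<cdot> tcup (tstar S C (tstar S C U)) (tstar S C U)))"

definition tpoint_inh :: "tb \<Rightarrow> tb \<Rightarrow> tyb" where
  "tpoint_inh S \<alpha> = tel (\<exists>\<^sub>t a:S. \<alpha> \<cdot> a)"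

definition tpoint_dir :: "tb \<Rightarrow> tb \<Rightarrow> tb \<Rightarrow> tyb" where
  "tpoint_dir S C \<alpha> = (\<Prod>\<^sub>t a:tel S. \<Prod>\<^sub>t b:tel S. tel (\<alpha> \<cdot> a) \<rightarrow>\<^sub>t tel (\<alpha> \<cdot> b) \<rightarrow>\<^sub>t
     tel (\<exists>\<^sub>t c:S. \<alpha> \<cdot> c \<and>\<^sub>t tdown S C (tsing S a) (tsing S b) \<cdot> c))"

definition tpoint_split :: "tb \<Rightarrow> tb \<Rightarrow> tb \<Rightarrow> tyb" where
  "tpoint_split S C \<alpha> = (\<Prod>\<^sub>t a:tel S. \<Prod>\<^sub>t U:tfam S. tel (\<alpha> \<cdot> a) \<rightarrow>\<^sub>t tel (C \<cdot> a \<cdot> U) \<rightarrow>\<^sub>t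
     tel (\<exists>\<^sub>t b:S. U \<cdot> b \<and>\<^sub>t \<alpha> \<cdot> b))"

definition tEM :: tyb where
  "tEM = (\<Prod>\<^sub>t P:tset. tel (P \<or>\<^sub>t \<not>\<^sub>t P))"

definition tDML :: tyb where
  "tDML = (\<Prod>\<^sub>t P:tset. tel (\<not>\<^sub>t \<not>\<^sub>t P \<or>\<^sub>t \<not>\<^sub>t P))"

text \<open>
  The type of functions taking a formal space \<open>(S, C)\<close> with property \<open>K\<close>, together with a
  point \<open>\<alpha>\<close>, to an object of type \<open>G\<close>: the internal form of ``if some formal space with
  property \<open>K\<close> has a point, then \<open>G\<close>''.
\<close>

definition tspace_with_point_implies :: "(tb \<Rightarrow> tb \<Rightarrow> tyb) \<Rightarrow> tyb \<Rightarrow> tyb" where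
  "tspace_with_point_implies K G =
    (\<Prod>\<^sub>t S:tset. \<Prod>\<^sub>t C:(tel S \<rightarrow>\<^sub>t tfam S \<rightarrow>\<^sub>t tset).
       tspace_refl S C \<rightarrow>\<^sub>t tspace_trans S C \<rightarrow>\<^sub>t tspace_down S C \<rightarrow>\<^sub>t K S C \<rightarrow>\<^sub>t
       (\<Prod>\<^sub>t \<alpha>:tfam S. tpoint_inh S \<alpha> \<rightarrow>\<^sub>t tpoint_dir S C \<alpha> \<rightarrow>\<^sub>t tpoint_split S C \<alpha> \<rightarrow>\<^sub>t G))"

end

theory Submission
  imports Defs
begin

text \<open>
  Let \<open>\<alpha>\<close> be a point of \<open>S\<close> and \<open>a \<in> \<alpha>\<close>.  Given a proposition \<open>P\<close>, put \<open>U = {x \<in> S. P}\<close>.  In the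
  Boolean case \<open>a \<lhd> U \<union> U\<^sup>*\<close>, so \<open>\<alpha>\<close> contains some \<open>b \<in> U \<union> U\<^sup>*\<close>.  If \<open>b \<in> U\<close> then \<open>P\<close>.  If \<open>b \<in> U\<^sup>*\<close>
  then \<open>\<not> P\<close>: otherwise \<open>U = S\<close>, so any \<open>c \<in> \<alpha>\<close> in \<open>b \<down> b\<close> lies in \<open>b \<down> U\<close> and is covered by the
  empty set, which contradicts \<open>c \<in> \<alpha>\<close>.  In the De Morgan case, \<open>b \<in> U\<^sup>*\<^sup>*\<close> likewise gives \<open>\<not> \<not> P\<close>, since
  \<open>\<not> P\<close> makes \<open>U\<close> empty and hence \<open>U\<^sup>* = S\<close>.  The separation that yields \<open>U\<close> is bounded when \<open>P\<close>
  is \<open>x \<in> p\<close>, which is all that the restricted principles of CZF need.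
\<close>

text \<open>The point meets a cover in some b that depends on earlier choices, but P does not
  mention b; the conclusion therefore survives the elimination of all these witnesses. In each
  system one case lemma captures this for a cover by two subsets, each of which forces a proposition
  fixed in advance as soon as the point meets it. The Boolean and De Morgan cases are instances.

  Directedness enters through the pair (b, b): it gives c in the point below b, and b in U then
  turns nearness of c to {b} into nearness to U.

  The obstacle is that every argument is a derivation in an embedded intuitionistic calculus.
  Witnesses are fresh variables, so hypotheses have to be carried under binders, and renaming and
  weakening must be shown admissible. The calculi differ in how U exists: as a variable obtained
  from separation in set theory, as a comprehension term in higher-order arithmetic, as a constant
  propositional function in type theory, where proof terms have to be managed as well.\<close>

lemma up_simps [simp]: "up f 0 = 0" "up f (Suc n) = Suc (f n)"
  "up f (numeral k) = Suc (f (pred_numeral k))"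
  by (simp_all add: up_def numeral_eq_Suc)

lemma up_comp [simp]: "up f (up g n) = up (\<lambda>n. f (g n)) n"
  by (cases n) simp_all

lemma up_id [simp]: "up (\<lambda>n. n) = (\<lambda>n. n)"
  by (rule ext) (simp add: up_def split: nat.split)

abbreviation plus2 :: "nat \<Rightarrow> nat" where
  "plus2 \<equiv> \<lambda>n. Suc (Suc n)"

abbreviation plus3 :: "nat \<Rightarrow> nat" where
  "plus3 \<equiv> \<lambda>n. Suc (Suc (Suc n))"

section \<open>Set theory\<close>

lemma sren_sren: "sren f (sren g A) = sren (\<lambda>n. f (g n)) A"
  by (induction A arbitrary: f g) simp_all

lemma sren_id [simp]: "sren (\<lambda>n. n) A = A"
  by (induction A) simp_all

lemma sren_sinst: "sren f (sinst t A) = sinst (f t) (sren (up f) A)"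
  unfolding sinst_def sren_sren
  by (rule arg_cong[where f = "\<lambda>g. sren g A"], rule ext) (simp add: up_def split: nat.split)

lemma sprov_mono: "sprov T G A \<Longrightarrow> G \<subseteq> E \<Longrightarrow> sprov T E A"
proof (induction arbitrary: E rule: sprov.induct)
  case (sEqSubst G s t A)
  then show ?case by (meson sprov.sEqSubst)
qed (meson sprov.sAx | meson sprov.intros(2-17) image_mono insert_mono subsetD)+

text \<open>The axiom rule already supplies every renaming of an axiom, so only the binders need
  care: there the induction hypothesis is used for \<open>up f\<close>, which commutes with the
  shift of the hypotheses.\<close>

lemma sprov_sren: "sprov T G A \<Longrightarrow> sprov T (sren f ` G) (sren f A)"
proof (induction arbitrary: f rule: sprov.induct)
  case (sAx A G g)
  then show ?case by (simp add: sren_sren sprov.sAx)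
next
  case (sOrE G A B C)
  then show ?case by (simp add: sprov.sOrE[of T _ "sren f A" "sren f B"])
next
  case (sImpI A G B)
  then show ?case by (simp add: sprov.sImpI)
next
  case (sImpE G A B)
  then show ?case by (simp add: sprov.sImpE[of T _ "sren f A"])
next
  case (sAllI G A)
  from sAllI(2)[of "up f"] show ?case
    by (simp add: image_image sren_sren sprov.sAllI)
next
  case (sAllE G A t)
  then show ?case unfolding sren_sinst sren.simps by (blast intro: sprov.sAllE)
next
  case (sExI G t A)
  then show ?case by (simp add: sren_sinst) (metis sprov.sExI)
next
  case (sExE G A C)
  from sExE(3) sExE(4)[of "up f"] show ?case
    by - (rule sprov.sExE[of T _ "sren (up f) A"], simp_all add: image_image sren_sren)
next
  case (sEqSubst G s t A)
  from sEqSubst(3)[of f] sEqSubst(4)[of f] show ?case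
    unfolding sren_sinst sren.simps by (rule sprov.sEqSubst)
next
  case (sAndE1 G A B)
  then show ?case by (metis sren.simps(4) sprov.sAndE1)
next
  case (sAndE2 G A B)
  then show ?case by (metis sren.simps(4) sprov.sAndE2)
qed (simp_all add: sprov.sHyp sprov.sBotE sprov.sAndI sprov.sOrI1 sprov.sOrI2 sprov.sEqRefl)

lemma sprov_shift: "sprov T G A \<Longrightarrow> sprov T (insert B (sren Suc ` G)) (sren Suc A)"
  by (rule sprov_mono[OF sprov_sren]) auto

text \<open>Parameters at depth \<open>0\<close>, covers and classes, as builders.  A cover is a formula with the holes \<open>0\<close>
  (element) and \<open>1\<close> (subset), a class a formula with the hole \<open>0\<close>; the other variables are parameters, so
  \<open>sren (up (up f)) \<phi>\<close> and \<open>sren (up f) \<kappa>\<close> rename the parameters only.\<close>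

definition par :: "nat \<Rightarrow> vb" where
  "par n = (\<lambda>d. n + d)"

definition cover :: "fm \<Rightarrow> vb \<Rightarrow> vb \<Rightarrow> fb" where
  "cover \<phi> = (\<lambda>a U. sapp \<phi> [a, U])"

definition compr :: "fm \<Rightarrow> cls" where
  "compr \<kappa> = (\<lambda>x. sapp \<kappa> [x])"

text \<open>A named \<open>case_nat\<close>: \<open>scons x (scons y h)\<close> fills the holes 0
  and 1 and treats the parameters by \<open>h\<close>. The name lets simp push renamings through
  such lists without splitting on the index.\<close>

definition scons :: "nat \<Rightarrow> (nat \<Rightarrow> nat) \<Rightarrow> nat \<Rightarrow> nat" where
  "scons x h = case_nat x h"

lemma scons_simps [simp]:
  "scons x h 0 = x" "scons x h (Suc n) = h n"
  "scons x h (up f n) = scons x (\<lambda>n. h (f n)) n"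
  "up f (scons x h n) = scons (up f x) (\<lambda>n. up f (h n)) n"
  "scons x h (scons y k n) = scons (scons x h y) (\<lambda>n. scons x h (k n)) n"
  by (simp_all add: scons_def up_def split: nat.split)

lemma scons_Suc [simp]: "scons 0 (\<lambda>n. Suc (f n)) = up f"
  by (rule ext) (simp add: scons_def up_def split: nat.split)

lemma cover_apply: "cover \<phi> a U d = sren (scons (a d) (scons (U d) (\<lambda>n. n + d))) \<phi>"
  unfolding cover_def sapp_def
  by (rule arg_cong[where f = "\<lambda>g. sren g \<phi>"], rule ext)
    (simp add: nth_Cons scons_def split: nat.split)

lemma compr_apply: "compr \<kappa> x d = sren (scons (x d) (\<lambda>n. n + d)) \<kappa>"
  unfolding compr_def sapp_def
  by (rule arg_cong[where f = "\<lambda>g. sren g \<kappa>"], rule ext)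
    (simp add: nth_Cons scons_def split: nat.split)

lemma sinst_scons: "sinst t A = sren (scons t (\<lambda>n. n)) A"
  by (simp add: sinst_def scons_def)

lemmas sunfold = numeral_eq_Suc smem_def seq_def sbot_def sand_def sor_def simpl_def siff_def snot_def
  sall_def sex_def bvar_def par_def cover_apply compr_apply
  ssubset_def selem_def ssing_def snull_def scup_def sclseq_def scov_def sdown_def sstar_def
  spoint_def sBoolean_def sDeMorgan_def sinst_scons sren_sren

section \<open>Points, covers and pseudocomplements in de Bruijn form\<close>

definition Point :: "fm \<Rightarrow> nat \<Rightarrow> nat \<Rightarrow> fm" where
  "Point \<phi> S \<alpha> = spoint (par S) (cover \<phi>) (par \<alpha>) 0"

definition Cov :: "fm \<Rightarrow> nat \<Rightarrow> fm \<Rightarrow> fm" where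
  "Cov \<phi> a \<kappa> = scov (cover \<phi>) (par a) (compr \<kappa>) 0"

text \<open>\<open>\<kappa> \<down> \<mu>\<close> consists of the elements of \<open>S\<close> near both \<open>\<kappa>\<close> and \<open>\<mu>\<close>.\<close>

definition Near :: "fm \<Rightarrow> fm \<Rightarrow> nat \<Rightarrow> fm" where
  "Near \<phi> \<kappa> d = SEx (SAnd \<kappa> (Cov (sren (up (up Suc)) \<phi>) (Suc d) (SEq 0 (Suc 0))))"

definition Down :: "fm \<Rightarrow> nat \<Rightarrow> fm \<Rightarrow> fm \<Rightarrow> nat \<Rightarrow> fm" where
  "Down \<phi> S \<kappa> \<mu> d = sdown (par S) (cover \<phi>) (compr \<kappa>) (compr \<mu>) (par d) 0"

definition Star :: "fm \<Rightarrow> nat \<Rightarrow> fm \<Rightarrow> nat \<Rightarrow> fm" where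
  "Star \<phi> S \<kappa> a = sstar (par S) (cover \<phi>) (compr \<kappa>) (par a) 0"

lemma sren_Point [simp]: "sren f (Point \<phi> S \<alpha>) = Point (sren (up (up f)) \<phi>) (f S) (f \<alpha>)"
  by (simp add: Point_def sunfold)

lemma sren_Cov [simp]: "sren f (Cov \<phi> a \<kappa>) = Cov (sren (up (up f)) \<phi>) (f a) (sren (up f) \<kappa>)"
  by (simp add: Cov_def sunfold)

lemma sren_Down [simp]: "sren f (Down \<phi> S \<kappa> \<mu> a) =
    Down (sren (up (up f)) \<phi>) (f S) (sren (up f) \<kappa>) (sren (up f) \<mu>) (f a)"
  by (simp add: Down_def sunfold)

lemma sren_Star [simp]: "sren f (Star \<phi> S \<kappa> a) = Star (sren (up (up f)) \<phi>) (f S) (sren (up f) \<kappa>) (f a)"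
  by (simp add: Star_def sunfold)

lemma Down_eq: "Down \<phi> S \<kappa> \<mu> d = SAnd (SMem d S) (SAnd (Near \<phi> \<kappa> d) (Near \<phi> \<mu> d))"
  by (simp add: Down_def Near_def Cov_def sunfold)

lemma Star_eq: "Star \<phi> S \<kappa> a = SAnd (SMem a S)
    (SAll (SImp (Down (sren (up (up Suc)) \<phi>) (Suc S) (SEq 0 (Suc (Suc a))) (sren (up Suc) \<kappa>) 0)
      (Cov (sren (up (up Suc)) \<phi>) 0 SBot)))"
  by (simp add: Star_def Down_def Cov_def sunfold)

text \<open>The bound variable 0 is the set that represents the class \<open>\<kappa>\<close>.
  Accordingly \<open>up Suc\<close> keeps the hole of \<open>\<kappa>\<close> and skips this set,
  and \<open>\<phi>\<close> receives the shifted \<open>a\<close> as element and the set itself as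
  subset.\<close>

lemma Cov_eq: "Cov \<phi> a \<kappa> = SEx (SAnd
    (SAll (SAnd (SImp (SMem 0 (Suc 0)) (sren (up Suc) \<kappa>)) (SImp (sren (up Suc) \<kappa>) (SMem 0 (Suc 0)))))
    (sren (scons (Suc a) (scons 0 Suc)) \<phi>))"
  by (simp add: Cov_def sunfold)

text \<open>In the last two clauses the outer quantifier binds index 1 and the inner one index 0.
  Under the existential quantifier both move up by one, which accounts for the indices 2 and 3, the
  hole of each singleton being 0.\<close>

lemma Point_eq: "Point \<phi> S \<alpha> = SAnd (SAll (SImp (SMem 0 (Suc \<alpha>)) (SMem 0 (Suc S))))
   (SAnd (SEx (SMem 0 (Suc \<alpha>)))
   (SAnd (SAll (SAll (SImp (SMem 1 (Suc (Suc \<alpha>))) (SImp (SMem 0 (Suc (Suc \<alpha>)))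
      (SEx (SAnd (SMem 0 (Suc (Suc (Suc \<alpha>))))
         (Down (sren (up (up plus3)) \<phi>) (Suc (Suc (Suc S)))
           (SEq 0 3) (SEq 0 2) 0)))))))
   (SAll (SAll (SImp (SMem 1 (Suc (Suc \<alpha>)))
      (SImp (SAll (SImp (SMem 0 1) (SMem 0 (Suc (Suc (Suc S))))))
      (SImp (sren (scons 1 (scons 0 plus2)) \<phi>)
      (SEx (SAnd (SMem 0 1) (SMem 0 (Suc (Suc (Suc \<alpha>)))))))))))))"
  by (simp add: Point_def Down_def sunfold)

section \<open>Derived rules of the intuitionistic calculus\<close>

lemma sinst_simps [simp]:
  "sinst t (SMem x y) = SMem (scons t (\<lambda>n. n) x) (scons t (\<lambda>n. n) y)"
  "sinst t (SEq x y) = SEq (scons t (\<lambda>n. n) x) (scons t (\<lambda>n. n) y)"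
  "sinst t SBot = SBot"
  "sinst t (SAnd A B) = SAnd (sinst t A) (sinst t B)"
  "sinst t (SOr A B) = SOr (sinst t A) (sinst t B)"
  "sinst t (SImp A B) = SImp (sinst t A) (sinst t B)"
  by (simp_all add: sinst_scons)

lemma sprov_hyp: "sprov T (insert A G) A"
  by (simp add: sHyp)

lemma sprov_hyp_and:
  "sprov T (insert (SAnd A B) G) A" "sprov T (insert (SAnd A B) G) B"
  by (rule sAndE1[OF sprov_hyp], rule sAndE2[OF sprov_hyp])

lemma sprov_all_imp:
  assumes "sprov T G (SAll (SImp A B))" "sprov T G (sinst t A)"
  shows "sprov T G (sinst t B)"
  using sAllE[OF assms(1), of t] assms(2) by (auto intro: sImpE)

lemma sprov_all2: "sprov T G (SAll (SAll A)) \<Longrightarrow> sren (scons t (scons s (\<lambda>n. n))) A = B \<Longrightarrow> sprov T G B"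
  by (drule sAllE[of _ _ _ s], simp add: sinst_scons, drule sAllE[of _ _ _ t]) (simp add: sinst_scons sren_sren)

lemma sprov_all_impI: "sprov T (insert A (sren Suc ` G)) B \<Longrightarrow> sprov T G (SAll (SImp A B))"
  by (intro sAllI sImpI)

text \<open>The shifted universal statement is instantiated at the fresh variable 0, which undoes
  the shift under its quantifier.\<close>

lemma sprov_all_open: "sprov T G (SAll A) \<Longrightarrow> sprov T (sren Suc ` G) A"
  using sAllE[of T "sren Suc ` G" "sren (up Suc) A" 0] sprov_sren[of T G "SAll A" Suc]
  by (simp add: sinst_scons sren_sren)

lemma sprov_all_elim: "sprov T G (SAll A) \<Longrightarrow> sprov T (insert B (sren Suc ` G)) A"
  by (rule sprov_mono[OF sprov_all_open]) auto

lemma sprov_sub_trans: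
  "sprov T G (SAll (SImp A B)) \<Longrightarrow> sprov T G (SAll (SImp B C)) \<Longrightarrow> sprov T G (SAll (SImp A C))"
  by (rule sprov_all_impI) (rule sImpE[OF sprov_all_elim sImpE[OF sprov_all_elim sprov_hyp]])

lemma sprov_sub_and:
  "sprov T G (SAll (SImp A B)) \<Longrightarrow> sprov T G (SAll (SImp (SAnd A C) (SAnd B C)))"
  by (rule sprov_all_impI)
    (rule sAndI[OF sImpE[OF sprov_all_elim sprov_hyp_and(1)] sprov_hyp_and(2)])

lemma sprov_all_and1: "sprov T G (SAll (SAnd A B)) \<Longrightarrow> sprov T G (SAll A)"
  by (rule sAllI) (rule sAndE1[OF sprov_all_open])

text \<open>The eigenvariable 0 of the given existential statement is also the witness of the new
  one: \<open>B\<close> is the instance at 0 of its own shift.\<close>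

lemma sprov_ex_mono:
  assumes "sprov T G (SEx A)" "sprov T G (SAll (SImp A B))"
  shows "sprov T G (SEx B)"
  using assms(1)
proof (rule sExE)
  have "sprov T (insert A (sren Suc ` G)) B"
    by (rule sImpE[OF sprov_all_elim[OF assms(2)] sprov_hyp])
  then have "sprov T (insert A (sren Suc ` G)) (sinst 0 (sren (up Suc) B))"
    by (simp add: sinst_scons sren_sren)
  from sExI[OF this] show "sprov T (insert A (sren Suc ` G)) (sren Suc (SEx B))"
    by simp
qed

text \<open>Substitution into the formula x = s, which holds at \<open>s\<close> by
  reflexivity.\<close>

lemma sprov_eq_sym: "sprov T G (SEq s t) \<Longrightarrow> sprov T G (SEq t s)"
  using sEqSubst[of T G s t "SEq 0 (Suc s)"] by (simp add: sEqRefl)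

section \<open>Points against covers and pseudocomplements\<close>

lemma Point_subset:
  "sprov T G (Point \<phi> S \<alpha>) \<Longrightarrow> sprov T G (SMem a \<alpha>) \<Longrightarrow> sprov T G (SMem a S)"
  unfolding Point_eq by (drule sAndE1, drule sprov_all_imp[where t = a]) simp_all

lemma Point_inhabited: "sprov T G (Point \<phi> S \<alpha>) \<Longrightarrow> sprov T G (SEx (SMem 0 (Suc \<alpha>)))"
  unfolding Point_eq by (rule sAndE1, rule sAndE2)

lemma Point_directed:
  assumes "sprov T G (Point \<phi> S \<alpha>)" "sprov T G (SMem a \<alpha>)" "sprov T G (SMem b \<alpha>)"
  shows "sprov T G (SEx (SAnd (SMem 0 (Suc \<alpha>))
    (Down (sren (up (up Suc)) \<phi>) (Suc S) (SEq 0 (Suc (Suc a))) (SEq 0 (Suc (Suc b))) 0)))"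
proof -
  have "sprov T G (SImp (SMem a \<alpha>) (SImp (SMem b \<alpha>) (SEx (SAnd (SMem 0 (Suc \<alpha>))
    (Down (sren (up (up Suc)) \<phi>) (Suc S) (SEq 0 (Suc (Suc a))) (SEq 0 (Suc (Suc b))) 0)))))"
    by (rule sprov_all2[OF sAndE1[OF sAndE2[OF sAndE2[OF assms(1)[unfolded Point_eq]]]], of b a])
      (simp add: sren_sren numeral_eq_Suc)
  from sImpE[OF sImpE[OF this assms(2)] assms(3)] show ?thesis .
qed

lemma Point_splits:
  assumes "sprov T G (Point \<phi> S \<alpha>)" "sprov T G (SMem a \<alpha>)"
    and "sprov T G (SAll (SImp (SMem 0 (Suc U)) (SMem 0 (Suc S))))"
    and "sprov T G (sren (scons a (scons U (\<lambda>n. n))) \<phi>)"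
  shows "sprov T G (SEx (SAnd (SMem 0 (Suc U)) (SMem 0 (Suc \<alpha>))))"
proof -
  have "sprov T G (SImp (SMem a \<alpha>) (SImp (SAll (SImp (SMem 0 (Suc U)) (SMem 0 (Suc S))))
      (SImp (sren (scons a (scons U (\<lambda>n. n))) \<phi>) (SEx (SAnd (SMem 0 (Suc U)) (SMem 0 (Suc \<alpha>)))))))"
    by (rule sprov_all2[OF sAndE2[OF sAndE2[OF sAndE2[OF assms(1)[unfolded Point_eq]]]], of U a])
      (simp add: sren_sren numeral_eq_Suc)
  from sImpE[OF sImpE[OF sImpE[OF this assms(2)] assms(3)] assms(4)] show ?thesis .
qed

text \<open>The splitting clause of a point speaks of sets. The class cover is therefore opened to
  the set that represents it; this set lies in \<open>S\<close> because \<open>\<kappa>\<close>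
  does, and the element found in it is returned to \<open>\<kappa>\<close>.\<close>

lemma Cov_splits:
  assumes pt: "sprov T G (Point \<phi> S \<alpha>)" and a: "sprov T G (SMem a \<alpha>)"
    and cov: "sprov T G (Cov \<phi> a \<kappa>)" and sub: "sprov T G (SAll (SImp \<kappa> (SMem 0 (Suc S))))"
  shows "sprov T G (SEx (SAnd \<kappa> (SMem 0 (Suc \<alpha>))))"
proof (rule sExE[OF cov[unfolded Cov_eq]])
  let ?iff = "SAll (SAnd (SImp (SMem 0 (Suc 0)) (sren (up Suc) \<kappa>)) (SImp (sren (up Suc) \<kappa>) (SMem 0 (Suc 0))))"
  let ?\<phi> = "sren (up (up Suc)) \<phi>"
  let ?C = "sren (scons (Suc a) (scons 0 Suc)) \<phi>"
  let ?G = "insert (SAnd ?iff ?C) (sren Suc ` G)"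
  have h: "sprov T ?G ?iff" "sprov T ?G ?C"
    by (rule sprov_hyp_and)+
  have pt': "sprov T ?G (Point ?\<phi> (Suc S) (Suc \<alpha>))"
    and a': "sprov T ?G (SMem (Suc a) (Suc \<alpha>))"
    and sub': "sprov T ?G (SAll (SImp (sren (up Suc) \<kappa>) (SMem 0 (Suc (Suc S)))))"
    using sprov_shift[OF pt] sprov_shift[OF a] sprov_shift[OF sub] by simp_all
  note el = sprov_all_and1[OF h(1)]
  have "sprov T ?G (SEx (SAnd (SMem 0 (Suc 0)) (SMem 0 (Suc (Suc \<alpha>)))))"
    by (rule Point_splits[OF pt' a' sprov_sub_trans[OF el sub']]) (use h(2) in \<open>simp add: sren_sren\<close>)
  from sprov_ex_mono[OF this sprov_sub_and[OF el]]
  show "sprov T ?G (sren Suc (SEx (SAnd \<kappa> (SMem 0 (Suc \<alpha>)))))"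
    by simp
qed

text \<open>A cover of an element of the point must meet the point, which the empty class cannot
  do.\<close>

lemma Cov_empty:
  assumes "sprov T G (Point \<phi> S \<alpha>)" "sprov T G (SMem a \<alpha>)" "sprov T G (Cov \<phi> a SBot)"
  shows "sprov T G SBot"
proof -
  have "sprov T G (SEx (SAnd SBot (SMem 0 (Suc \<alpha>))))"
    by (rule Cov_splits[OF assms]) (rule sprov_all_impI[OF sBotE[OF sprov_hyp]])
  then show ?thesis
    by (rule sExE) (rule sBotE[OF sprov_hyp_and(1)])
qed

lemma Down_I:
  "sprov T G (SMem d S) \<Longrightarrow> sprov T G (Near \<phi> \<kappa> d) \<Longrightarrow> sprov T G (Near \<phi> \<mu> d)
    \<Longrightarrow> sprov T G (Down \<phi> S \<kappa> \<mu> d)"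
  unfolding Down_eq by (intro sAndI)

lemma Down_D1: "sprov T G (Down \<phi> S \<kappa> \<mu> d) \<Longrightarrow> sprov T G (SMem d S)"
  unfolding Down_eq by (rule sAndE1)

lemma Down_D2: "sprov T G (Down \<phi> S \<kappa> \<mu> d) \<Longrightarrow> sprov T G (Near \<phi> \<kappa> d)"
  unfolding Down_eq by (rule sAndE1, rule sAndE2)

lemma Down_D3: "sprov T G (Down \<phi> S \<kappa> \<mu> d) \<Longrightarrow> sprov T G (Near \<phi> \<mu> d)"
  unfolding Down_eq by (rule sAndE2, rule sAndE2)

lemma Near_mono:
  assumes "sprov T G (Near \<phi> \<kappa> d)" "sprov T G (SAll (SImp \<kappa> \<mu>))"
  shows "sprov T G (Near \<phi> \<mu> d)"
  using assms(1) unfolding Near_def by (rule sprov_ex_mono[OF _ sprov_sub_and[OF assms(2)]])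

lemma Star_elim:
  assumes "sprov T G (Star \<phi> S \<kappa> a)" "sprov T G (Down \<phi> S (SEq 0 (Suc a)) \<kappa> d)"
  shows "sprov T G (Cov \<phi> d SBot)"
proof -
  have "sprov T G (sinst d (Cov (sren (up (up Suc)) \<phi>) 0 SBot))"
    by (rule sprov_all_imp[OF sAndE2[OF assms(1)[unfolded Star_eq]]])
      (use assms(2) in \<open>simp add: sinst_scons sren_sren\<close>)
  then show ?thesis
    by (simp add: sinst_scons sren_sren)
qed

text \<open>Both halves of c in b down b say that c is near {b}. Since \<open>b\<close> satisfies
  \<open>\<kappa>\<close>, the class {b} is included in \<open>\<kappa>\<close>, and
  \<open>Near_mono\<close> replaces {b} by \<open>\<kappa>\<close> in the second half only, which
  gives c in b down \<open>\<kappa>\<close>.\<close>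

lemma Star_refute:
  assumes pt: "sprov T G (Point \<phi> S \<alpha>)" and b: "sprov T G (SMem b \<alpha>)"
    and star: "sprov T G (Star \<phi> S \<kappa> b)" and full: "sprov T G (SAll (SImp (SMem 0 (Suc S)) \<kappa>))"
  shows "sprov T G SBot"
proof (rule sExE[OF Point_directed[OF pt b b]])
  let ?\<phi> = "sren (up (up Suc)) \<phi>" and ?\<kappa> = "sren (up Suc) \<kappa>"
  let ?D = "Down ?\<phi> (Suc S) (SEq 0 (Suc (Suc b))) (SEq 0 (Suc (Suc b))) 0"
  let ?G = "insert (SAnd (SMem 0 (Suc \<alpha>)) ?D) (sren Suc ` G)"
  note sh = sprov_shift[where T = T and G = G and B = "SAnd (SMem 0 (Suc \<alpha>)) ?D"]
  have c: "sprov T ?G (SMem 0 (Suc \<alpha>))" and D: "sprov T ?G ?D"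
    by (rule sprov_hyp_and)+
  have k: "sprov T G (sinst b \<kappa>)"
    by (rule sprov_all_imp[OF full]) (simp add: Point_subset[OF pt b])
  have k': "sprov T ?G (SAll (SImp (SEq 0 (Suc (Suc b))) ?\<kappa>))"
  proof (rule sprov_all_impI)
    let ?E = "insert (SEq 0 (Suc (Suc b))) (sren Suc ` ?G)"
    \<comment> \<open>Substitution runs from left to right along an equation, so x = b is reversed
      in order to carry \<open>\<kappa>\<close> from \<open>b\<close> to x.\<close>
    have e: "sprov T ?E (SEq (Suc (Suc b)) 0)"
      by (rule sprov_eq_sym[OF sprov_hyp])
    have "sprov T ?E (sren Suc (sren Suc (sinst b \<kappa>)))"
      by (intro sprov_shift k)
    then have "sprov T ?E (sinst (Suc (Suc b)) (sren (up Suc) (sren (up Suc) \<kappa>)))"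
      by (simp add: sren_sinst)
    from sEqSubst[OF e this] show "sprov T ?E ?\<kappa>"
      by (simp add: sinst_scons sren_sren)
  qed
  have "sprov T ?G (Down ?\<phi> (Suc S) (SEq 0 (Suc (Suc b))) ?\<kappa> 0)"
    by (rule Down_I[OF Down_D1[OF D] Down_D2[OF D] Near_mono[OF Down_D2[OF D] k']])
  then have "sprov T ?G (Cov ?\<phi> 0 SBot)"
    by (rule Star_elim[rotated]) (use sh[OF star] in simp)
  then have "sprov T ?G SBot"
    by (rule Cov_empty[rotated 2]) (use sh[OF pt] c in simp_all)
  then show "sprov T ?G (sren Suc SBot)"
    by simp
qed

text \<open>Nothing is near an empty class, so the elements that the pseudocomplement has to cover
  by the empty class do not exist.\<close>

lemma Star_intro:
  assumes x: "sprov T G (SMem x S)" and emp: "sprov T G (SAll (SImp \<kappa> SBot))"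
  shows "sprov T G (Star \<phi> S \<kappa> x)"
  unfolding Star_eq
proof (intro sAndI x sprov_all_impI)
  let ?\<phi> = "sren (up (up Suc)) \<phi>" and ?\<kappa> = "sren (up Suc) \<kappa>"
  let ?D = "Down ?\<phi> (Suc S) (SEq 0 (Suc (Suc x))) ?\<kappa> 0"
  let ?G = "insert ?D (sren Suc ` G)"
  have "sprov T ?G (Near ?\<phi> ?\<kappa> 0)"
    by (rule Down_D3[OF sprov_hyp])
  moreover have "sprov T ?G (SAll (SImp ?\<kappa> SBot))"
    using sprov_shift[OF emp] by simp
  ultimately have "sprov T ?G (Near ?\<phi> SBot 0)"
    by (rule Near_mono)
  then have "sprov T ?G SBot"
    unfolding Near_def by (rule sExE) (rule sBotE[OF sprov_hyp_and(1)])
  then show "sprov T ?G (Cov ?\<phi> 0 SBot)"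
    by (rule sBotE)
qed

text \<open>Any element a of the point is covered by the union of \<open>\<kappa>\<close> and
  \<open>\<mu>\<close>, so the point contains some b in one of them. As \<open>P\<close> and
  \<open>Q\<close> mention neither a nor b, both witnesses can be discharged. The Boolean case takes
  U and U* for \<open>\<kappa>\<close> and \<open>\<mu>\<close>, the De Morgan case U** and
  U*.\<close>

lemma Point_cases:
  assumes pt: "sprov T G (Point \<phi> S \<alpha>)"
    and cov: "sprov T G (SAll (SImp (SMem 0 (Suc S)) (Cov (sren (up (up Suc)) \<phi>) 0 (sren (up Suc) (SOr \<kappa> \<mu>)))))"
    and sub: "sprov T G (SAll (SImp (SOr \<kappa> \<mu>) (SMem 0 (Suc S))))"
    and P: "sprov T G (SAll (SImp (SMem 0 (Suc \<alpha>)) (SImp \<kappa> (sren Suc P))))"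
    and Q: "sprov T G (SAll (SImp (SMem 0 (Suc \<alpha>)) (SImp \<mu> (sren Suc Q))))"
  shows "sprov T G (SOr P Q)"
proof (rule sExE[OF Point_inhabited[OF pt]])
  let ?\<phi> = "sren (up (up Suc)) \<phi>"
  let ?R = "SOr \<kappa> \<mu>" let ?R' = "sren (up Suc) ?R"
  let ?G = "insert (SMem 0 (Suc \<alpha>)) (sren Suc ` G)"
  note sh = sprov_shift[where T = T and G = G and B = "SMem 0 (Suc \<alpha>)"]
  have pt': "sprov T ?G (Point ?\<phi> (Suc S) (Suc \<alpha>))"
    using sh[OF pt] by simp
  have "sprov T ?G (SMem 0 (Suc S))"
    by (rule Point_subset[OF pt' sprov_hyp])
  then have "sprov T ?G (Cov ?\<phi> 0 ?R')"
    by (rule sImpE[OF sprov_all_elim[OF cov]])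
  then have *: "sprov T ?G (SEx (SAnd ?R' (SMem 0 (Suc (Suc \<alpha>)))))"
    by (rule Cov_splits[OF pt' sprov_hyp]) (use sh[OF sub] in simp)
  show "sprov T ?G (sren Suc (SOr P Q))"
  proof (rule sExE[OF *])
    let ?E = "insert (SAnd ?R' (SMem 0 (Suc (Suc \<alpha>)))) (sren Suc ` ?G)"
    have b: "sprov T ?E (SMem 0 (Suc (Suc \<alpha>)))"
      by (rule sprov_hyp_and)
    \<comment> \<open>The branch hypotheses are opened at b, the newest variable; \<open>P\<close>
      and \<open>Q\<close> carry two shifts, one past a and one past b.\<close>
    have P': "sprov T ?E (SImp (sren (up Suc) \<kappa>) (sren Suc (sren Suc P)))"
      using sImpE[OF sprov_all_elim[OF sh[OF P, unfolded sren.simps up_simps]] b] by (simp add: sren_sren)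
    have Q': "sprov T ?E (SImp (sren (up Suc) \<mu>) (sren Suc (sren Suc Q)))"
      using sImpE[OF sprov_all_elim[OF sh[OF Q, unfolded sren.simps up_simps]] b] by (simp add: sren_sren)
    have "sprov T ?E (SOr (sren Suc (sren Suc P)) (sren Suc (sren Suc Q)))"
    proof (rule sOrE)
      show "sprov T ?E (SOr (sren (up Suc) \<kappa>) (sren (up Suc) \<mu>))"
        using sprov_hyp_and(1)[of T ?R'] by simp
    qed (rule sOrI1[OF sImpE[OF sprov_mono[OF P'] sprov_hyp]], blast,
      rule sOrI2[OF sImpE[OF sprov_mono[OF Q'] sprov_hyp]], blast)
    then show "sprov T ?E (sren Suc (sren Suc (SOr P Q)))"
      by simp
  qed
qed

section \<open>Boolean and De Morgan spaces, and the subset cut out by a proposition\<close>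

definition Bool :: "fm \<Rightarrow> nat \<Rightarrow> fm" where
  "Bool \<phi> S = sBoolean (par S) (cover \<phi>) 0"

definition DeM :: "fm \<Rightarrow> nat \<Rightarrow> fm" where
  "DeM \<phi> S = sDeMorgan (par S) (cover \<phi>) 0"

lemma sren_Bool [simp]: "sren f (Bool \<phi> S) = Bool (sren (up (up f)) \<phi>) (f S)"
  by (simp add: Bool_def sunfold)

lemma sren_DeM [simp]: "sren f (DeM \<phi> S) = DeM (sren (up (up f)) \<phi>) (f S)"
  by (simp add: DeM_def sunfold)

text \<open>\<open>Star\<close> turned into a class formula with hole 0, so that it can be fed back
  into itself to form U**.\<close>

definition Pstar :: "fm \<Rightarrow> nat \<Rightarrow> fm \<Rightarrow> fm" where
  "Pstar \<phi> S \<kappa> = Star (sren (up (up Suc)) \<phi>) (Suc S) (sren (up Suc) \<kappa>) 0"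

lemma sren_Pstar [simp]:
  "sren (up f) (Pstar \<phi> S \<kappa>) = Pstar (sren (up (up f)) \<phi>) (f S) (sren (up f) \<kappa>)"
  by (simp add: Pstar_def sren_sren)

lemma Bool_elim:
  assumes "sprov T G (Bool \<phi> S)" "sprov T G (SAll (SImp (SMem 0 (Suc U)) (SMem 0 (Suc S))))"
  shows "sprov T G (SAll (SImp (SMem 0 (Suc S)) (Cov (sren (up (up Suc)) \<phi>) 0
    (sren (up Suc) (SOr (SMem 0 (Suc U)) (Pstar \<phi> S (SMem 0 (Suc U))))))))"
proof -
  \<comment> \<open>Inside the class of the cover, index 0 is the hole, index 1 the covered element
    and index 2 the subset U.\<close>
  have "Bool \<phi> S = SAll (SImp (SAll (SImp (SMem 0 1) (SMem 0 (Suc (Suc S)))))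
     (SAll (SImp (SMem 0 (Suc (Suc S))) (Cov (sren (up (up plus2)) \<phi>) 0
      (SOr (SMem 0 2) (Pstar (sren (up (up plus2)) \<phi>) (Suc (Suc S)) (SMem 0 2)))))))"
    by (simp add: Bool_def Cov_def Pstar_def Star_def sunfold)
  from sAllE[OF assms(1)[unfolded this], of U] assms(2)
  show ?thesis
    by (simp add: sinst_scons sren_sren Pstar_def numeral_eq_Suc) (rule sImpE)
qed

lemma DeM_elim:
  assumes "sprov T G (DeM \<phi> S)" "sprov T G (SAll (SImp (SMem 0 (Suc U)) (SMem 0 (Suc S))))"
  shows "sprov T G (SAll (SImp (SMem 0 (Suc S)) (Cov (sren (up (up Suc)) \<phi>) 0
    (sren (up Suc) (SOr (Pstar \<phi> S (Pstar \<phi> S (SMem 0 (Suc U)))) (Pstar \<phi> S (SMem 0 (Suc U))))))))"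
proof -
  have "DeM \<phi> S = SAll (SImp (SAll (SImp (SMem 0 1) (SMem 0 (Suc (Suc S)))))
     (SAll (SImp (SMem 0 (Suc (Suc S))) (Cov (sren (up (up plus2)) \<phi>) 0
      (SOr (Pstar (sren (up (up plus2)) \<phi>) (Suc (Suc S)) (Pstar (sren (up (up plus2)) \<phi>) (Suc (Suc S))
        (SMem 0 2)))
         (Pstar (sren (up (up plus2)) \<phi>) (Suc (Suc S)) (SMem 0 2)))))))"
    by (simp add: DeM_def Cov_def Pstar_def Star_def sunfold)
  from sAllE[OF assms(1)[unfolded this], of U] assms(2)
  show ?thesis
    by (simp add: sinst_scons sren_sren Pstar_def numeral_eq_Suc) (rule sImpE)
qed

lemma sprov_or_sub:
  assumes "sprov T G (SAll (SImp A C))" "sprov T G (SAll (SImp B C))"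
  shows "sprov T G (SAll (SImp (SOr A B) C))"
  by (rule sprov_all_impI, rule sOrE[OF sprov_hyp])
    (auto intro: sImpE[OF sprov_mono[OF sprov_all_open[OF assms(1)]] sprov_hyp]
      sImpE[OF sprov_mono[OF sprov_all_open[OF assms(2)]] sprov_hyp])

lemma Pstar_subset: "sprov T G (SAll (SImp (Pstar \<phi> S \<kappa>) (SMem 0 (Suc S))))"
  unfolding Pstar_def Star_eq by (rule sprov_all_impI[OF sprov_hyp_and(1)])

lemma Pstar_intro:
  assumes "sprov T G (SAll (SImp \<kappa> SBot))"
  shows "sprov T G (SAll (SImp (SMem 0 (Suc S)) (Pstar \<phi> S \<kappa>)))"
  unfolding Pstar_def
  by (rule sprov_all_impI, rule Star_intro[OF sprov_hyp])
    (use sprov_shift[OF assms] in simp)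

text \<open>The terms of set theory are variables only, so {x in S. P} is a variable
  \<open>U\<close> known through its elements. \<open>P\<close> does not depend on the element,
  hence the shift.\<close>

definition is_restr :: "nat \<Rightarrow> nat \<Rightarrow> fm \<Rightarrow> fm" where
  "is_restr U S P = SAll (SAnd (SImp (SMem 0 (Suc U)) (SAnd (SMem 0 (Suc S)) (sren Suc P)))
     (SImp (SAnd (SMem 0 (Suc S)) (sren Suc P)) (SMem 0 (Suc U))))"

lemma sren_is_restr [simp]: "sren f (is_restr U S P) = is_restr (f U) (f S) (sren f P)"
  by (simp add: is_restr_def sren_sren)

lemma is_restr_subset:
  "sprov T G (is_restr U S P) \<Longrightarrow> sprov T G (SAll (SImp (SMem 0 (Suc U)) (SMem 0 (Suc S))))"
  unfolding is_restr_def
  by (rule sprov_all_impI, rule sAndE1, rule sImpE[OF sAndE1[OF sprov_all_elim] sprov_hyp])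

lemma is_restr_imp:
  "sprov T G (is_restr U S P) \<Longrightarrow> sprov T G (SAll (SImp (SMem 0 (Suc U)) (sren Suc P)))"
  unfolding is_restr_def
  by (rule sprov_all_impI, rule sAndE2, rule sImpE[OF sAndE1[OF sprov_all_elim] sprov_hyp])

lemma is_restr_full:
  assumes "sprov T G (is_restr U S P)" "sprov T G P"
  shows "sprov T G (SAll (SImp (SMem 0 (Suc S)) (SMem 0 (Suc U))))"
  using assms(1) unfolding is_restr_def
  by (intro sprov_all_impI)
    (rule sImpE[OF sAndE2[OF sprov_all_elim] sAndI[OF sprov_hyp sprov_shift[OF assms(2)]]])

lemma Pstar_imp_not:
  assumes pt: "sprov T G (Point \<phi> S \<alpha>)" and U: "sprov T G (is_restr U S P)"
  shows "sprov T G (SAll (SImp (SMem 0 (Suc \<alpha>)) (SImp (Pstar \<phi> S (SMem 0 (Suc U))) (sren Suc (SImp P SBot)))))"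
proof -
  let ?\<kappa> = "SMem 0 (Suc U)"
  let ?G = "insert (sren Suc P) (insert (Pstar \<phi> S ?\<kappa>) (insert (SMem 0 (Suc \<alpha>)) (sren Suc ` G)))"
  have sh: "sprov T ?G (sren Suc A)" if "sprov T G A" for A
    by (rule sprov_mono[OF sprov_shift[OF that, of "SMem 0 (Suc \<alpha>)"]]) blast
  have "sprov T ?G SBot"
  proof (rule Star_refute)
    show "sprov T ?G (Point (sren (up (up Suc)) \<phi>) (Suc S) (Suc \<alpha>))"
      using sh[OF pt] by simp
    show "sprov T ?G (SMem 0 (Suc \<alpha>))"
      by (simp add: sHyp)
    show "sprov T ?G (Star (sren (up (up Suc)) \<phi>) (Suc S) (SMem 0 (Suc (Suc U))) 0)"
      by (simp add: sHyp Pstar_def)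
    show "sprov T ?G (SAll (SImp (SMem 0 (Suc (Suc S))) (SMem 0 (Suc (Suc U)))))"
      using sh[OF U] by (intro is_restr_full[OF _ sprov_hyp]) simp
  qed
  then show ?thesis
    by (simp add: sprov_all_impI sImpI)
qed

lemma Pstar2_imp_not_not:
  assumes pt: "sprov T G (Point \<phi> S \<alpha>)" and U: "sprov T G (is_restr U S P)"
  shows "sprov T G (SAll (SImp (SMem 0 (Suc \<alpha>)) (SImp (Pstar \<phi> S (Pstar \<phi> S (SMem 0 (Suc U))))
    (sren Suc (SImp (SImp P SBot) SBot)))))"
proof -
  let ?\<kappa> = "Pstar \<phi> S (SMem 0 (Suc U))"
  let ?N = "sren Suc (SImp P SBot)"
  let ?G = "insert ?N (insert (Pstar \<phi> S ?\<kappa>) (insert (SMem 0 (Suc \<alpha>)) (sren Suc ` G)))"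
  have sh: "sprov T ?G (sren Suc A)" if "sprov T G A" for A
    by (rule sprov_mono[OF sprov_shift[OF that, of "SMem 0 (Suc \<alpha>)"]]) blast
  have emp: "sprov T ?G (SAll (SImp (SMem 0 (Suc (Suc U))) SBot))"
  proof (rule sprov_sub_trans)
    show "sprov T ?G (SAll (SImp (SMem 0 (Suc (Suc U))) (sren Suc (sren Suc P))))"
      using is_restr_imp[OF sh[OF U, simplified]] by simp
    show "sprov T ?G (SAll (SImp (sren Suc (sren Suc P)) SBot))"
      by (rule sAllI) (use sHyp[of "sren Suc ?N" "sren Suc ` ?G" T] in simp)
  qed
  have "sprov T ?G SBot"
  proof (rule Star_refute)
    show "sprov T ?G (Point (sren (up (up Suc)) \<phi>) (Suc S) (Suc \<alpha>))"
      using sh[OF pt] by simp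
    show "sprov T ?G (SMem 0 (Suc \<alpha>))"
      by (simp add: sHyp)
    show "sprov T ?G (Star (sren (up (up Suc)) \<phi>) (Suc S) (sren (up Suc) ?\<kappa>) 0)"
      by (rule sHyp) (simp add: Pstar_def sren_sren)
    show "sprov T ?G (SAll (SImp (SMem 0 (Suc (Suc S))) (sren (up Suc) ?\<kappa>)))"
      unfolding sren_Pstar by (rule Pstar_intro) (use emp in simp)
  qed
  then show ?thesis
    by (simp add: sprov_all_impI sImpI)
qed

section \<open>Excluded middle and the De Morgan law from a point\<close>

lemma Boolean_point_EM:
  assumes bool: "sprov T G (Bool \<phi> S)" and pt: "sprov T G (Point \<phi> S \<alpha>)"
    and U: "sprov T G (is_restr U S P)"
  shows "sprov T G (SOr P (SImp P SBot))"
proof (rule Point_cases[OF pt Bool_elim[OF bool is_restr_subset[OF U]]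
      sprov_or_sub[OF is_restr_subset[OF U] Pstar_subset] _ Pstar_imp_not[OF pt U]])
  show "sprov T G (SAll (SImp (SMem 0 (Suc \<alpha>)) (SImp (SMem 0 (Suc U)) (sren Suc P))))"
    by (rule sprov_all_impI, rule sprov_all_elim[OF is_restr_imp[OF U]])
qed

lemma DeMorgan_point_DML:
  assumes dem: "sprov T G (DeM \<phi> S)" and pt: "sprov T G (Point \<phi> S \<alpha>)"
    and U: "sprov T G (is_restr U S P)"
  shows "sprov T G (SOr (SImp (SImp P SBot) SBot) (SImp P SBot))"
  by (rule Point_cases[OF pt DeM_elim[OF dem is_restr_subset[OF U]]
      sprov_or_sub[OF Pstar_subset Pstar_subset] Pstar2_imp_not_not[OF pt U] Pstar_imp_not[OF pt U]])

text \<open>The separating formula \<open>sren Suc P\<close> omits the separated variable, so the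
  axiom at \<open>S\<close> yields {x in S. P}. This set is bound by the existential quantifier,
  hence its index 0 and the shifts of \<open>S\<close> and \<open>P\<close>.\<close>

lemma separation_restr:
  assumes "ax_separation (sren Suc P) 0 \<in> T"
  shows "sprov T G (SEx (is_restr 0 (Suc S) (sren Suc P)))"
proof -
  have "ax_separation (sren Suc P) 0 = SAll (SEx (is_restr 0 1 (sren Suc (sren Suc P))))"
    by (simp add: ax_separation_def is_restr_def sunfold compr_apply[unfolded compr_def])
  with sAx[OF assms, of G "\<lambda>n. n"] have "sprov T G (SAll (SEx (is_restr 0 1 (sren Suc (sren Suc P)))))"
    by simp
  from sAllE[OF this, of S] show ?thesis
    by (simp add: sinst_scons sren_sren)
qed

text \<open>Parametric in the property \<open>K\<close>, so that both properties and both set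
  theories share one elimination argument.\<close>

definition Space_with_point :: "(fm \<Rightarrow> nat \<Rightarrow> fm) \<Rightarrow> fm \<Rightarrow> fm" where
  "Space_with_point K \<phi> = SEx (SAnd (K (sren (up (up Suc)) \<phi>) 0)
     (SEx (Point (sren (up (up plus2)) \<phi>) 1 0)))"

lemma sren_Space_with_point:
  assumes "\<And>f \<phi> S. sren f (K \<phi> S) = K (sren (up (up f)) \<phi>) (f S)"
  shows "sren f (Space_with_point K \<phi>) = Space_with_point K (sren (up (up f)) \<phi>)"
  by (simp add: Space_with_point_def assms sren_sren)

lemmas [simp] =
  sren_Space_with_point[where K = Bool, OF sren_Bool]
  sren_Space_with_point[where K = DeM, OF sren_DeM]

text \<open>The space and the point become two fresh variables, hence \<open>plus2\<close> on
  \<open>X\<close>. The context, the cover and the indices are left arbitrary in the last premise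
  because both eliminations rename all of them.\<close>

lemma Space_with_point_elim:
  assumes ren: "\<And>f \<phi> S. sren f (K \<phi> S) = K (sren (up (up f)) \<phi>) (f S)"
    and sp: "sprov T G (Space_with_point K \<phi>)"
    and X: "\<And>E \<psi> S \<alpha>. sprov T E (K \<psi> S) \<Longrightarrow> sprov T E (Point \<psi> S \<alpha>) \<Longrightarrow> sprov T E (sren plus2 X)"
  shows "sprov T G X"
proof (rule sExE[OF sp[unfolded Space_with_point_def]])
  let ?K = "K (sren (up (up Suc)) \<phi>) 0" and ?P = "Point (sren (up (up plus2)) \<phi>) 1 0"
  let ?G = "insert (SAnd ?K (SEx ?P)) (sren Suc ` G)"
  show "sprov T ?G (sren Suc X)"
  proof (rule sExE[OF sprov_hyp_and(2)])
    have "sprov T (insert ?P (sren Suc ` ?G)) (K (sren (up (up plus2)) \<phi>) 1)"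
      using sprov_shift[OF sprov_hyp_and(1)[of T ?K "SEx ?P" "sren Suc ` G"], of ?P] by (simp add: ren
        sren_sren)
    from X[OF this sprov_hyp] show "sprov T (insert ?P (sren Suc ` ?G)) (sren Suc (sren Suc X))"
      by (simp add: sren_sren)
  qed
qed

text \<open>The subset U is a third fresh variable. Separation is applied below the other two, where
  \<open>P\<close> is already renamed; this is why the axiom is required for every renaming of
  \<open>P\<close>.\<close>

lemma Space_with_point_restr:
  assumes ren: "\<And>f \<phi> S. sren f (K \<phi> S) = K (sren (up (up f)) \<phi>) (f S)"
    and sp: "sprov T G (Space_with_point K \<phi>)"
    and sep: "\<And>f. ax_separation (sren f P) 0 \<in> T"
    and X: "\<And>E \<psi> S \<alpha> U f. sprov T E (K \<psi> S) \<Longrightarrow> sprov T E (Point \<psi> S \<alpha>)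
      \<Longrightarrow> sprov T E (is_restr U S (sren f P)) \<Longrightarrow> sprov T E (sren f X)"
  shows "sprov T G X"
proof (rule Space_with_point_elim[of K, OF ren sp])
  fix E \<psi> S \<alpha>
  let ?P = "sren plus2 P"
  assume h: "sprov T E (K \<psi> S)" "sprov T E (Point \<psi> S \<alpha>)"
  show "sprov T E (sren plus2 X)"
  proof (rule sExE[OF separation_restr[of ?P T E S]])
    show "ax_separation (sren Suc ?P) 0 \<in> T"
      by (simp add: sep sren_sren)
    show "sprov T (insert (is_restr 0 (Suc S) (sren Suc ?P)) (sren Suc ` E)) (sren Suc (sren plus2 X))"
      using X[OF sprov_shift[OF h(1), unfolded ren] sprov_shift[OF h(2), unfolded sren_Point], of _ 0 plus3]
      by (simp add: sren_sren sprov_hyp)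
  qed
qed

lemma Space_with_point_EM:
  assumes "sprov T G (Space_with_point Bool \<phi>)" "\<And>f. ax_separation (sren f P) 0 \<in> T"
  shows "sprov T G (SOr P (SImp P SBot))"
  by (rule Space_with_point_restr[of Bool, OF sren_Bool assms]) (simp add: Boolean_point_EM)

lemma Space_with_point_DML:
  assumes "sprov T G (Space_with_point DeM \<phi>)" "\<And>f. ax_separation (sren f P) 0 \<in> T"
  shows "sprov T G (SOr (SImp (SImp P SBot) SBot) (SImp P SBot))"
  by (rule Space_with_point_restr[of DeM, OF sren_DeM assms]) (simp add: DeMorgan_point_DML)

section \<open>The two principles in CZF and IZF\<close>

lemma CZF_separation_mem: "CZF \<subseteq> T \<Longrightarrow> ax_separation (sren f (SMem x y)) 0 \<in> T"
  unfolding CZF_def by (auto intro: delta0.intros)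

lemma IZF_separation: "ax_separation \<phi> 0 \<in> IZF"
  unfolding IZF_def by blast

lemma sprov_ex_and2: "sprov T G (SEx (SAnd A B)) \<Longrightarrow> sprov T G (SEx B)"
  by (erule sprov_ex_mono) (rule sprov_all_impI[OF sprov_hyp_and(2)])

lemmas with_point_defs = Let_def cover_def[symmetric] Bool_def DeM_def Point_def

lemma IZF_Boolean_with_point:
  "sprov T G (IZF_Boolean_with_point \<phi> 0) \<Longrightarrow> sprov T G (Space_with_point Bool \<phi>)"
  unfolding Space_with_point_def
  by (rule sprov_ex_and2[where A = "sspace (bvar 0) (cover \<phi>) (Suc 0)"])
    (simp add: IZF_Boolean_with_point_def with_point_defs sunfold)

lemma IZF_DeMorgan_with_point:
  "sprov T G (IZF_DeMorgan_with_point \<phi> 0) \<Longrightarrow> sprov T G (Space_with_point DeM \<phi>)"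
  unfolding Space_with_point_def
  by (rule sprov_ex_and2[where A = "sspace (bvar 0) (cover \<phi>) (Suc 0)"])
    (simp add: IZF_DeMorgan_with_point_def with_point_defs sunfold)

lemma CZF_Boolean_with_point:
  "sprov T G (CZF_Boolean_with_point \<phi> 0) \<Longrightarrow> sprov T G (Space_with_point Bool \<phi>)"
  unfolding Space_with_point_def
  by (rule sprov_ex_and2[where A = "ssmall (bvar 0) (cover \<phi>) (Suc 0)"],
      rule sprov_ex_and2[where A = "sspace (bvar 0) (cover \<phi>) (Suc 0)"])
    (simp add: CZF_Boolean_with_point_def with_point_defs sunfold)

lemma CZF_DeMorgan_with_point:
  "sprov T G (CZF_DeMorgan_with_point \<phi> 0) \<Longrightarrow> sprov T G (Space_with_point DeM \<phi>)"
  unfolding Space_with_point_def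
  by (rule sprov_ex_and2[where A = "ssmall (bvar 0) (cover \<phi>) (Suc 0)"],
      rule sprov_ex_and2[where A = "sspace (bvar 0) (cover \<phi>) (Suc 0)"])
    (simp add: CZF_DeMorgan_with_point_def with_point_defs sunfold)

lemma IZF_EM: "sprov IZF {} ((IZF_Boolean_with_point \<phi> \<longrightarrow>\<^sub>s sEM \<psi>) 0)"
proof -
  have "sEM \<psi> 0 = SOr \<psi> (SImp \<psi> SBot)"
    by (simp add: sEM_def sapp_def sunfold)
  then show ?thesis
    by (simp add: simpl_def sImpI Space_with_point_EM[OF IZF_Boolean_with_point[OF sprov_hyp]] IZF_separation)
qed

lemma IZF_DML: "sprov IZF {} ((IZF_DeMorgan_with_point \<phi> \<longrightarrow>\<^sub>s sDML \<psi>) 0)"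
proof -
  have "sDML \<psi> 0 = SOr (SImp (SImp \<psi> SBot) SBot) (SImp \<psi> SBot)"
    by (simp add: sDML_def sapp_def sunfold)
  then show ?thesis
    by (simp add: simpl_def sImpI Space_with_point_DML[OF IZF_DeMorgan_with_point[OF sprov_hyp]] IZF_separation)
qed

lemma sprov_weaken: "sprov T G A \<Longrightarrow> sprov T (insert B G) A"
  by (erule sprov_mono) blast

text \<open>Excluded middle is obtained for the atomic, hence bounded, formula x in p with x and p
  free. The two inclusions of the class equation are then propositional: one uses that p is a subset
  of {\<top>}, the other uses this instance.\<close>

lemma CZF_REM:
  assumes "CZF \<subseteq> T"
  shows "sprov T {} ((CZF_Boolean_with_point \<phi> \<longrightarrow>\<^sub>s REM) 0)"
proof -
  let ?H = "CZF_Boolean_with_point \<phi> 0"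
  \<comment> \<open>With x at index 0 and p at index 1, \<open>?E\<close> says that x is empty, that
    is, x lies in {\<top>}, and \<open>?X\<close> says that x lies in p.\<close>
  let ?E = "SAll (SImp (SMem 0 (Suc 0)) SBot)" and ?X = "SMem 0 (Suc 0)"
  let ?G = "insert (SAll (SImp ?X ?E)) (sren Suc ` {?H})"
  have eq: "REM 0 = SAll (SImp (SAll (SImp ?X ?E)) (SAll (SAnd
      (SImp (SOr ?X (SAnd ?E (SImp ?X SBot))) ?E) (SImp ?E (SOr ?X (SAnd ?E (SImp ?X SBot)))))))"
    by (simp add: REM_def sone_def sempty_def spstar_def sunfold)
  have sub: "sprov T (sren Suc ` ?G) (SImp ?X ?E)"
    by (rule sprov_all_open[OF sprov_hyp])
  have "sprov T {?H} (Space_with_point Bool \<phi>)"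
    by (rule CZF_Boolean_with_point[OF sprov_hyp])
  from sprov_sren[OF sprov_shift[OF this, of "SAll (SImp ?X ?E)"], of Suc]
  have "sprov T (sren Suc ` ?G) (Space_with_point Bool (sren (up (up plus2)) \<phi>))"
    by (simp add: sren_sren)
  from Space_with_point_EM[OF this CZF_separation_mem[OF assms]]
  have em: "sprov T (sren Suc ` ?G) (SOr ?X (SImp ?X SBot))" .
  have "sprov T {?H} (REM 0)"
    unfolding eq
  proof (rule sprov_all_impI, rule sAllI, rule sAndI)
    show "sprov T (sren Suc ` ?G) (SImp (SOr ?X (SAnd ?E (SImp ?X SBot))) ?E)"
      by (rule sImpI, rule sOrE[OF sprov_hyp])
        (rule sImpE[OF sprov_weaken[OF sprov_weaken[OF sub]] sprov_hyp], rule sprov_hyp_and)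
    show "sprov T (sren Suc ` ?G) (SImp ?E (SOr ?X (SAnd ?E (SImp ?X SBot))))"
      by (rule sImpI, rule sOrE[OF sprov_weaken[OF em]])
        (rule sOrI1[OF sprov_hyp], rule sOrI2[OF sAndI[OF sprov_weaken[OF sprov_hyp] sprov_hyp]])
  qed
  then show ?thesis
    by (simp add: simpl_def sImpI)
qed

lemma CZF_RDML:
  assumes "CZF \<subseteq> T"
  shows "sprov T {} ((CZF_DeMorgan_with_point \<phi> \<longrightarrow>\<^sub>s RDML) 0)"
proof -
  let ?H = "CZF_DeMorgan_with_point \<phi> 0"
  let ?E = "SAll (SImp (SMem 0 (Suc 0)) SBot)" and ?X = "SMem 0 (Suc 0)"
  let ?S = "SAnd ?E (SImp ?X SBot)"
  let ?G = "insert (SAll (SImp ?X ?E)) (sren Suc ` {?H})"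
  have eq: "RDML 0 = SAll (SImp (SAll (SImp ?X ?E)) (SAll (SAnd
      (SImp (SOr (SAnd ?E (SImp ?S SBot)) ?S) ?E) (SImp ?E (SOr (SAnd ?E (SImp ?S SBot)) ?S)))))"
    by (simp add: RDML_def sone_def sempty_def spstar_def sunfold)
  have "sprov T {?H} (Space_with_point DeM \<phi>)"
    by (rule CZF_DeMorgan_with_point[OF sprov_hyp])
  from sprov_sren[OF sprov_shift[OF this, of "SAll (SImp ?X ?E)"], of Suc]
  have "sprov T (sren Suc ` ?G) (Space_with_point DeM (sren (up (up plus2)) \<phi>))"
    by (simp add: sren_sren)
  from Space_with_point_DML[OF this CZF_separation_mem[OF assms]]
  have dml: "sprov T (sren Suc ` ?G) (SOr (SImp (SImp ?X SBot) SBot) (SImp ?X SBot))" .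
  \<comment> \<open>Membership in p** is the negation of membership in p*, and the latter contains
    the negation of x in p as its second half; the double negation of x in p refutes that
    half.\<close>
  have nn: "sprov T (insert (SImp (SImp ?X SBot) SBot) E) (SImp ?S SBot)" for E
    by (rule sImpI, rule sImpE[OF sprov_weaken[OF sprov_hyp] sprov_hyp_and(2)])
  have "sprov T {?H} (RDML 0)"
    unfolding eq
  proof (rule sprov_all_impI, rule sAllI, rule sAndI)
    show "sprov T (sren Suc ` ?G) (SImp (SOr (SAnd ?E (SImp ?S SBot)) ?S) ?E)"
      by (rule sImpI, rule sOrE[OF sprov_hyp]) (rule sprov_hyp_and)+
    show "sprov T (sren Suc ` ?G) (SImp ?E (SOr (SAnd ?E (SImp ?S SBot)) ?S))"
      by (rule sImpI, rule sOrE[OF sprov_weaken[OF dml]])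
        (rule sOrI1[OF sAndI[OF sprov_weaken[OF sprov_hyp] nn]],
         rule sOrI2[OF sAndI[OF sprov_weaken[OF sprov_hyp] sprov_hyp]])
  qed
  then show ?thesis
    by (simp add: simpl_def sImpI)
qed

section \<open>Higher-order Heyting arithmetic\<close>

abbreviation hshift :: "htm \<Rightarrow> htm" ("_\<Up>" [1000] 1000) where
  "t\<Up> \<equiv> hren Suc t"

lemma hup_simps [simp]: "hup \<sigma> 0 = HVar 0" "hup \<sigma> (Suc n) = hren Suc (\<sigma> n)"
  "hup \<sigma> (numeral k) = hren Suc (\<sigma> (pred_numeral k))"
  by (simp_all add: hup_def numeral_eq_Suc)

lemma hren_hren: "hren f (hren g t) = hren (\<lambda>n. f (g n)) t"
  by (induction t arbitrary: f g) simp_all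

lemma hren_id [simp]: "hren (\<lambda>n. n) t = t"
  by (induction t) simp_all

lemma hup_var: "hup (\<lambda>n. HVar (f n)) = (\<lambda>n. HVar (up f n))"
  by (rule ext) (simp add: hup_def up_def split: nat.split)

lemma hren_as_hsub: "hren f t = hsub (\<lambda>n. HVar (f n)) t"
  by (induction t arbitrary: f) (simp_all add: hup_var)

lemma hup_up: "hup \<sigma> (up f n) = hup (\<lambda>n. \<sigma> (f n)) n"
  by (cases n) simp_all

lemma hsub_hren: "hsub \<sigma> (hren f t) = hsub (\<lambda>n. \<sigma> (f n)) t"
  by (induction t arbitrary: \<sigma> f) (simp_all add: hup_up)

lemma hren_hup: "hren (up f) (hup \<sigma> n) = hup (\<lambda>n. hren f (\<sigma> n)) n"
  by (cases n) (simp_all add: hren_hren)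

lemma hren_hsub: "hren f (hsub \<sigma> t) = hsub (\<lambda>n. hren f (\<sigma> n)) t"
  by (induction t arbitrary: \<sigma> f) (simp_all add: hren_hup)

text \<open>Under a binder, composing substitutions moves a shift past a substitution. Both mixed
  laws between renaming and substitution are used here, so they precede the composition law.\<close>

lemma hsub_hup: "hsub (hup \<sigma>) (hup \<tau> n) = hup (\<lambda>n. hsub \<sigma> (\<tau> n)) n"
  by (cases n) (simp_all add: hsub_hren hren_hsub)

lemma hsub_hsub: "hsub \<sigma> (hsub \<tau> t) = hsub (\<lambda>n. hsub \<sigma> (\<tau> n)) t"
  by (induction t arbitrary: \<sigma> \<tau>) (simp_all add: hsub_hup)

lemma hsub_var [simp]: "hsub HVar t = t"
  using hren_as_hsub[of "\<lambda>n. n" t] by (simp add: hren_id)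

definition hcons :: "htm \<Rightarrow> (nat \<Rightarrow> htm) \<Rightarrow> nat \<Rightarrow> htm" where
  "hcons t \<sigma> = case_nat t \<sigma>"

lemma hcons_simps [simp]:
  "hcons t \<sigma> 0 = t" "hcons t \<sigma> (Suc n) = \<sigma> n"
  "hcons t \<sigma> (numeral k) = \<sigma> (pred_numeral k)"
  "hcons t \<sigma> (up f n) = hcons t (\<lambda>n. \<sigma> (f n)) n"
  "hsub \<tau> (hcons t \<sigma> n) = hcons (hsub \<tau> t) (\<lambda>n. hsub \<tau> (\<sigma> n)) n"
  "hren f (hcons t \<sigma> n) = hcons (hren f t) (\<lambda>n. hren f (\<sigma> n)) n"
  by (simp_all add: hcons_def numeral_eq_Suc up_def split: nat.split)

lemma hinst_hcons: "hinst t A = hsub (hcons t HVar) A"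
  by (simp add: hinst_def hcons_def)

lemma hcons_var [simp]: "hcons (HVar 0) (\<lambda>n. HVar (Suc (f n))) = (\<lambda>n. HVar (up f n))"
  by (rule ext) (simp add: hcons_def up_def split: nat.split)

lemma hren_hinst: "hren f (hinst t A) = hinst (hren f t) (hren (up f) A)"
  by (simp add: hinst_hcons hren_hsub hsub_hren)

text \<open>Types are unique and computable, so that typing judgements can be left to the simplifier.\<close>

primrec hty_of :: "htm \<Rightarrow> hty list \<Rightarrow> hty option" where
  "hty_of (HVar n) E = (if n < length E then Some (E ! n) else None)"
| "hty_of HStar E = Some HOne"
| "hty_of (HPair s t) E = (case hty_of s E of Some \<sigma> \<Rightarrow> (case hty_of t E of Some \<tau> \<Rightarrow> Some (HProd \<sigma> \<tau>) |
  None \<Rightarrow> None)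
    | None \<Rightarrow> None)"
| "hty_of HZero E = Some HNum"
| "hty_of (HSucc t) E = (if hty_of t E = Some HNum then Some HNum else None)"
| "hty_of (HCompr \<tau> A) E = (if hty_of A (\<tau> # E) = Some HOmega then Some (HPow \<tau>) else None)"
| "hty_of (HMem s t) E = (case hty_of s E of Some \<tau> \<Rightarrow>
    if hty_of t E = Some (HPow \<tau>) then Some HOmega else None | None \<Rightarrow> None)"
| "hty_of (HEq s t) E = (case hty_of s E of Some \<tau> \<Rightarrow>
    if hty_of t E = Some \<tau> then Some HOmega else None | None \<Rightarrow> None)"
| "hty_of HBot E = Some HOmega"
| "hty_of (HAnd A B) E = (if hty_of A E = Some HOmega \<and> hty_of B E = Some HOmega then Some HOmega else None)"
| "hty_of (HOr A B) E = (if hty_of A E = Some HOmega \<and> hty_of B E = Some HOmega then Some HOmega else None)"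
| "hty_of (HImp A B) E = (if hty_of A E = Some HOmega \<and> hty_of B E = Some HOmega then Some HOmega else None)"
| "hty_of (HAll \<tau> A) E = (if hty_of A (\<tau> # E) = Some HOmega then Some HOmega else None)"
| "hty_of (HEx \<tau> A) E = (if hty_of A (\<tau> # E) = Some HOmega then Some HOmega else None)"

abbreviation hform :: "hty list \<Rightarrow> htm \<Rightarrow> bool" where
  "hform E A \<equiv> hty_of A E = Some HOmega"

abbreviation hset :: "hty list \<Rightarrow> hty \<Rightarrow> htm \<Rightarrow> bool" where
  "hset E \<tau> U \<equiv> hty_of U E = Some (HPow \<tau>)"

abbreviation hcov :: "hty list \<Rightarrow> hty \<Rightarrow> htm \<Rightarrow> bool" where
  "hcov E \<tau> R \<equiv> hty_of R E = Some (HPow (HProd \<tau> (HPow \<tau>)))"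

lemma htyp_imp_hty_of: "htyp E t \<tau> \<Longrightarrow> hty_of t E = Some \<tau>"
  by (induction rule: htyp.induct) simp_all

lemma hty_of_imp_htyp: "hty_of t E = Some \<tau> \<Longrightarrow> htyp E t \<tau>"
  by (induction t arbitrary: E \<tau>)
    (auto simp del: hcons_simps intro!: htyp.intros split: if_splits option.splits; metis htyp.intros(7,8))+

lemma htyp_iff [simp]: "htyp E t \<tau> \<longleftrightarrow> hty_of t E = Some \<tau>"
  by (blast intro: htyp_imp_hty_of hty_of_imp_htyp)

text \<open>The \<open>else\<close> clause sends undeclared variables to undeclared ones. Typing is
  thereby preserved as an equation between options, valid for untyped terms too, and simp can use it
  without a typing premise.\<close>

definition hrenames :: "(nat \<Rightarrow> nat) \<Rightarrow> hty list \<Rightarrow> hty list \<Rightarrow> bool" where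
  "hrenames f E E' \<longleftrightarrow> (\<forall>n. if n < length E then f n < length E' \<and> E' ! f n = E ! n else \<not> f n < length E')"

lemma hrenames_up: "hrenames f E E' \<Longrightarrow> hrenames (up f) (\<tau> # E) (\<tau> # E')"
  by (auto simp: hrenames_def up_def split: nat.split)

lemma hty_of_hren: "hrenames f E E' \<Longrightarrow> hty_of (hren f t) E' = hty_of t E"
proof (induction t arbitrary: f E E')
  case (HVar n)
  then show ?case by (auto simp: hrenames_def split: if_splits)
next
  case (HCompr \<tau> A)
  then show ?case using HCompr.IH[OF hrenames_up[OF HCompr.prems]] by simp
next
  case (HAll \<tau> A)
  then show ?case using HAll.IH[OF hrenames_up[OF HAll.prems]] by simp
next
  case (HEx \<tau> A)
  then show ?case using HEx.IH[OF hrenames_up[OF HEx.prems]] by simp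
qed (simp_all cong: option.case_cong)

lemma hrenames_Suc: "hrenames Suc E (\<tau> # E)"
  by (simp add: hrenames_def)

lemma hty_of_shift [simp]:
  "hty_of t\<Up> (\<tau> # E) = hty_of t E"
  "hty_of (hren plus2 t) (\<sigma> # \<tau> # E) = hty_of t E"
  "hty_of (hren plus3 t) (\<rho> # \<sigma> # \<tau> # E) = hty_of t E"
  "hty_of (hren (\<lambda>n. Suc (Suc (Suc (Suc n)))) t) (\<upsilon> # \<rho> # \<sigma> # \<tau> # E) = hty_of t E"
  by (rule hty_of_hren, simp add: hrenames_def)+

lemma hty_of_hup:
  assumes "\<And>n. n < length E \<Longrightarrow> hty_of (\<sigma> n) E' = Some (E ! n)" "n < length (\<rho> # E)"
  shows "hty_of (hup \<sigma> n) (\<rho> # E') = Some ((\<rho> # E) ! n)"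
  using assms by (cases n) simp_all

lemma hty_of_hsub:
  "hty_of t E = Some \<tau> \<Longrightarrow> (\<And>n. n < length E \<Longrightarrow> hty_of (\<sigma> n) E' = Some (E ! n))
    \<Longrightarrow> hty_of (hsub \<sigma> t) E' = Some \<tau>"
proof (induction t arbitrary: E E' \<sigma> \<tau>)
  case (HCompr \<rho> A)
  from HCompr.IH[OF _ hty_of_hup[OF HCompr.prems(2)]] HCompr.prems(1) show ?case
    by (simp split: if_splits)
next
  case (HAll \<rho> A)
  from HAll.IH[OF _ hty_of_hup[OF HAll.prems(2)]] HAll.prems(1) show ?case
    by (simp split: if_splits)
next
  case (HEx \<rho> A)
  from HEx.IH[OF _ hty_of_hup[OF HEx.prems(2)]] HEx.prems(1) show ?case
    by (simp split: if_splits)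
next
  case (HEq s t)
  from HEq.prems(1) obtain \<rho> where "hty_of s E = Some \<rho>" "hty_of t E = Some \<rho>" "\<tau> = HOmega"
    by (auto split: if_splits option.splits)
  with HEq.IH[OF _ HEq.prems(2)] show ?case by simp
next
  case (HMem s t)
  from HMem.prems(1) obtain \<rho> where "hty_of s E = Some \<rho>" "hty_of t E = Some (HPow \<rho>)" "\<tau> = HOmega"
    by (auto split: if_splits option.splits)
  with HMem.IH[OF _ HMem.prems(2)] show ?case by simp
next
  case (HPair s t)
  from HPair.prems(1) obtain \<rho> \<rho>' where "hty_of s E = Some \<rho>" "hty_of t E = Some \<rho>'" "\<tau> = HProd \<rho> \<rho>'"
    by (auto split: if_splits option.splits)
  with HPair.IH[OF _ HPair.prems(2)] show ?case by simp
qed (auto split: if_splits)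

lemma hty_of_hinst:
  "hty_of A (\<tau> # E) = Some \<sigma> \<Longrightarrow> hty_of t E = Some \<tau> \<Longrightarrow> hty_of (hinst t A) E = Some \<sigma>"
  unfolding hinst_hcons by (erule hty_of_hsub) (simp add: hcons_def nth_Cons split: nat.split)

section \<open>Well-typedness, weakening and derived rules in topos logic\<close>

lemmas hunfold = hvar_def hstar_def hpair_def hzero_def hsucc_def hmem_def heq_def hbot_def hand_def
  hor_def himpl_def
  hiff_def hnot_def hall_def hex_def hcompr_def

lemma hha_axioms_closed: "A \<in> hha_axioms \<Longrightarrow> hren f A = A"
  unfolding hha_axioms_def by (auto simp: hunfold numeral_eq_Suc)

lemma hha_axioms_typed: "A \<in> hha_axioms \<Longrightarrow> hty_of A E = Some HOmega"
  unfolding hha_axioms_def by (auto simp: hunfold numeral_eq_Suc)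

text \<open>The rules carry enough typing premises to make every derivable formula well typed; later
  proofs read the typing of a subformula off a derivation.\<close>

lemma hprov_typed: "hprov E G A \<Longrightarrow> hform E A"
proof (induction rule: hprov.induct)
  case (hAx A E G)
  then show ?case by (rule hha_axioms_typed)
qed (auto simp: hty_of_hinst split: if_splits)

lemma hprov_mono: "hprov E G A \<Longrightarrow> G \<subseteq> H \<Longrightarrow> hprov E H A"
proof (induction arbitrary: H rule: hprov.induct)
  case (hEqSubst E s \<tau> t A G)
  then show ?case by (meson hprov.hEqSubst)
qed (meson hprov.intros(1-4) | meson hprov.intros(6-) image_mono insert_mono subsetD)+

text \<open>Typing premises survive renaming by \<open>hty_of_hren\<close>, axioms are closed and
  stay fixed, and binders are handled by \<open>hrenames_up\<close>.\<close>

lemma hprov_hren: "hprov E G A \<Longrightarrow> hrenames f E E' \<Longrightarrow> hprov E' (hren f ` G) (hren f A)"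
proof (induction arbitrary: f E' rule: hprov.induct)
  case (hAx A E G)
  then show ?case by (simp add: hha_axioms_closed hprov.hAx)
next
  case (hComprI E t \<tau> A G)
  then show ?case
    unfolding hren.simps hren_hinst by - (rule hprov.hComprI, simp_all add: hty_of_hren hty_of_hren[OF
      hrenames_up])
next
  case (hComprE E t \<tau> A G)
  then show ?case
    unfolding hren.simps hren_hinst by - (rule hprov.hComprE, simp_all add: hty_of_hren hty_of_hren[OF
      hrenames_up])
next
  case (hEqRefl E t \<tau> G)
  then show ?case
    by (simp add: hprov.hEqRefl hty_of_hren)
next
  case (hEqSubst E s \<tau> t A G)
  show ?case
    unfolding hren_hinst
    by (rule hprov.hEqSubst[OF _ _ _ hEqSubst.IH(1)[OF hEqSubst.prems, unfolded hren.simps]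
          hEqSubst.IH(2)[OF hEqSubst.prems, unfolded hren_hinst]])
      (use hEqSubst in \<open>simp_all add: hty_of_hren hty_of_hren[OF hrenames_up]\<close>)
next
  case (hHyp A G E)
  then show ?case by (simp add: hprov.hHyp hty_of_hren)
next
  case (hBotE E G A)
  then show ?case by (simp add: hprov.hBotE hty_of_hren)
next
  case (hAndI E G A B)
  then show ?case by (simp add: hprov.hAndI)
next
  case (hAndE1 E G A B)
  then show ?case by (metis hren.simps(10) hprov.hAndE1)
next
  case (hAndE2 E G A B)
  then show ?case by (metis hren.simps(10) hprov.hAndE2)
next
  case (hOrI1 E G A B)
  then show ?case by (simp add: hprov.hOrI1 hty_of_hren)
next
  case (hOrI2 E G B A)
  then show ?case by (simp add: hprov.hOrI2 hty_of_hren)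
next
  case (hOrE E G A B C)
  then show ?case by (simp add: hprov.hOrE[of _ _ "hren f A" "hren f B"])
next
  case (hImpI E A G B)
  then show ?case by (simp add: hprov.hImpI hty_of_hren)
next
  case (hImpE E G A B)
  then show ?case by (simp add: hprov.hImpE[of _ _ "hren f A"])
next
  case (hAllI \<tau> E G A)
  from hAllI(2)[OF hrenames_up[OF hAllI(3)]] show ?case
    by (simp add: image_image hren_hren hprov.hAllI)
next
  case (hAllE E G \<tau> A t)
  show ?case
    unfolding hren_hinst
    by (rule hprov.hAllE[OF hAllE.IH[OF hAllE.prems, unfolded hren.simps]])
      (use hAllE in \<open>simp add: hty_of_hren\<close>)
next
  case (hExI E t \<tau> A G)
  show ?case
    unfolding hren.simps
    by (rule hprov.hExI[OF _ _ hExI.IH[OF hExI.prems, unfolded hren_hinst]])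
      (use hExI in \<open>simp_all add: hty_of_hren hty_of_hren[OF hrenames_up]\<close>)
next
  case (hExE E G \<tau> A C)
  from hExE.IH(1)[OF hExE.prems] hExE.IH(2)[OF hrenames_up[OF hExE.prems]] show ?case
    by - (rule hprov.hExE[of _ _ \<tau> "hren (up f) A"],
      use hExE in \<open>simp_all add: image_image hren_hren hty_of_hren\<close>)
qed

lemma hprov_shift: "hprov E G A \<Longrightarrow> hprov (\<tau> # E) (insert B (hren Suc ` G)) A\<Up>"
  by (rule hprov_mono[OF hprov_hren[OF _ hrenames_Suc]]) auto

lemma hprov_hyp: "hform E A \<Longrightarrow> hprov E (insert A G) A"
  by (simp add: hHyp)

lemma hprov_hyp_and:
  assumes "hform E A" "hform E B"
  shows "hprov E (insert (HAnd A B) G) A" "hprov E (insert (HAnd A B) G) B"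
  using hAndE1 hAndE2 hprov_hyp[of "HAnd A B"] assms by (metis hty_of.simps(10))+

lemma hprov_weaken: "hprov E G A \<Longrightarrow> hprov E (insert B G) A"
  by (erule hprov_mono) blast

text \<open>A hypothesis may be used only when it is well typed. Its typing is extracted from the
  existential statement, so that the caller receives a ready derivation of \<open>A\<close>.\<close>

lemma hprov_exE:
  assumes "hprov E G (HEx \<tau> A)" "hform E C"
    and "hprov (\<tau> # E) (insert A (hren Suc ` G)) A
      \<Longrightarrow> hprov (\<tau> # E) (insert A (hren Suc ` G)) C\<Up>"
  shows "hprov E G C"
  using assms hprov_typed[OF assms(1)] by (intro hExE[OF assms(1)]) (auto intro!: hprov_hyp split: if_splits)

lemma hprov_all_imp:
  assumes "hprov E G (HAll \<tau> (HImp A B))" "hty_of t E = Some \<tau>" "hprov E G (hinst t A)"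
  shows "hprov E G (hinst t B)"
  using hAllE[OF assms(1), of t] assms(2,3) by (auto simp: hinst_hcons intro: hImpE)

lemma hprov_all_impI:
  "hform (\<tau> # E) A \<Longrightarrow> hprov (\<tau> # E) (insert A (hren Suc ` G)) B
    \<Longrightarrow> hprov E G (HAll \<tau> (HImp A B))"
  by (intro hAllI hImpI) simp_all

lemma hprov_all_open: "hprov E G (HAll \<tau> A) \<Longrightarrow> hprov (\<tau> # E) (hren Suc ` G) A"
  using hAllE[of "\<tau> # E" "hren Suc ` G" \<tau> "hren (up Suc) A" "HVar 0"] hprov_hren[of E G "HAll \<tau> A" Suc,
    OF _ hrenames_Suc]
  by (simp add: hinst_hcons hsub_hren)

lemma hprov_all_elim: "hprov E G (HAll \<tau> A) \<Longrightarrow> hprov (\<tau> # E) (insert B (hren Suc ` G)) A"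
  by (rule hprov_weaken[OF hprov_all_open])

lemma hprov_sub_typed:
  "hprov E G (HAll \<tau> (HImp A B)) \<Longrightarrow> hform (\<tau> # E) A \<and> hform (\<tau> # E) B"
  by (drule hprov_typed) (simp split: if_splits)

lemma hprov_sub_and:
  assumes "hprov E G (HAll \<tau> (HImp A B))" "hform (\<tau> # E) C"
  shows "hprov E G (HAll \<tau> (HImp (HAnd A C) (HAnd B C)))"
  using hprov_sub_typed[OF assms(1)] assms(2)
  by (intro hprov_all_impI hAndI hImpE[OF hprov_all_elim[OF assms(1)]] hprov_hyp_and) auto

lemma hprov_ex_mono:
  assumes "hprov E G (HEx \<tau> A)" "hprov E G (HAll \<tau> (HImp A B))"
  shows "hprov E G (HEx \<tau> B)"
proof (rule hprov_exE[OF assms(1)])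
  show "hform E (HEx \<tau> B)"
    using hprov_sub_typed[OF assms(2)] by simp
next
  assume h: "hprov (\<tau> # E) (insert A (hren Suc ` G)) A"
  have "hprov (\<tau> # E) (insert A (hren Suc ` G)) B"
    by (rule hImpE[OF hprov_all_elim[OF assms(2)] h])
  then have "hprov (\<tau> # E) (insert A (hren Suc ` G)) (hinst (HVar 0) (hren (up Suc) B))"
    by (simp add: hinst_hcons hsub_hren)
  from hExI[OF _ _ this, of \<tau>] show "hprov (\<tau> # E) (insert A (hren Suc ` G)) (hren Suc (HEx \<tau> B))"
    using hprov_sub_typed[OF assms(2)] by (simp add: hty_of_hren[OF hrenames_up[OF hrenames_Suc]])
qed

section \<open>Formal spaces and points as terms of topos logic\<close>

definition lift :: "htm \<Rightarrow> hb" where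
  "lift t = (\<lambda>d. hren (\<lambda>n. n + d) t)"

definition Sing :: "hty \<Rightarrow> htm \<Rightarrow> htm" where
  "Sing \<tau> a = hsing \<tau> (lift a) 0"

definition Null :: "hty \<Rightarrow> htm" where
  "Null \<tau> = hnull \<tau> 0"

definition HCov :: "htm \<Rightarrow> htm \<Rightarrow> htm \<Rightarrow> htm" where
  "HCov R a U = HMem (HPair a U) R"

definition HNear :: "hty \<Rightarrow> htm \<Rightarrow> htm \<Rightarrow> htm \<Rightarrow> htm" where
  "HNear \<tau> R U d = HEx \<tau> (HAnd (HMem (HVar 0) U\<Up>) (HCov R\<Up> d\<Up> (Sing \<tau> (HVar 0))))"

definition HDown :: "hty \<Rightarrow> htm \<Rightarrow> htm \<Rightarrow> htm \<Rightarrow> htm \<Rightarrow> htm" where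
  "HDown \<tau> S R U V = hdown \<tau> (lift S) (lift R) (lift U) (lift V) 0"

definition HStarSet :: "hty \<Rightarrow> htm \<Rightarrow> htm \<Rightarrow> htm \<Rightarrow> htm" where
  "HStarSet \<tau> S R U = hpstar \<tau> (lift S) (lift R) (lift U) 0"

definition HSub :: "hty \<Rightarrow> htm \<Rightarrow> htm \<Rightarrow> htm" where
  "HSub \<tau> U V = HAll \<tau> (HImp (HMem (HVar 0) U\<Up>) (HMem (HVar 0) V\<Up>))"

definition HPoint :: "hty \<Rightarrow> htm \<Rightarrow> htm \<Rightarrow> htm \<Rightarrow> htm" where
  "HPoint \<tau> S R \<alpha> = hpoint \<tau> (lift S) (lift R) (lift \<alpha>) 0"

lemmas hdefs = hunfold lift_def numeral_eq_Suc hren_hren hsub_hren hren_hsub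
  hsubset_def hsing_def hnull_def hcup_def hcovers_def hdown_def hpstar_def hpoint_def
  hBoolean_def hDeMorgan_def Sing_def Null_def HCov_def HNear_def HSub_def HDown_def HStarSet_def

lemma hsub_Sing [simp]: "hsub \<sigma> (Sing \<tau> a) = Sing \<tau> (hsub \<sigma> a)"
  and hsub_Null [simp]: "hsub \<sigma> (Null \<tau>) = Null \<tau>"
  and hsub_HCov [simp]: "hsub \<sigma> (HCov R a U) = HCov (hsub \<sigma> R) (hsub \<sigma> a) (hsub \<sigma> U)"
  and hsub_HNear [simp]: "hsub \<sigma> (HNear \<tau> R U a) = HNear \<tau> (hsub \<sigma> R) (hsub \<sigma> U) (hsub \<sigma> a)"
  and hsub_HDown [simp]: "hsub \<sigma> (HDown \<tau> S R U V) = HDown \<tau> (hsub \<sigma> S) (hsub \<sigma> R) (hsub \<sigma> U) (hsub \<sigma> V)"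
  and hsub_HStarSet [simp]: "hsub \<sigma> (HStarSet \<tau> S R U) = HStarSet \<tau> (hsub \<sigma> S) (hsub \<sigma> R) (hsub \<sigma> U)"
  and hsub_HSub [simp]: "hsub \<sigma> (HSub \<tau> U V) = HSub \<tau> (hsub \<sigma> U) (hsub \<sigma> V)"
  and hsub_HPoint [simp]: "hsub \<sigma> (HPoint \<tau> S R U) = HPoint \<tau> (hsub \<sigma> S) (hsub \<sigma> R) (hsub \<sigma> U)"
  by (simp_all add: hdefs HPoint_def)

lemma hren_Sing [simp]: "hren f (Sing \<tau> a) = Sing \<tau> (hren f a)"
  and hren_Null [simp]: "hren f (Null \<tau>) = Null \<tau>"
  and hren_HCov [simp]: "hren f (HCov R a U) = HCov (hren f R) (hren f a) (hren f U)"
  and hren_HNear [simp]: "hren f (HNear \<tau> R U a) = HNear \<tau> (hren f R) (hren f U) (hren f a)"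
  and hren_HDown [simp]: "hren f (HDown \<tau> S R U V) = HDown \<tau> (hren f S) (hren f R) (hren f U) (hren f V)"
  and hren_HStarSet [simp]: "hren f (HStarSet \<tau> S R U) = HStarSet \<tau> (hren f S) (hren f R) (hren f U)"
  and hren_HSub [simp]: "hren f (HSub \<tau> U V) = HSub \<tau> (hren f U) (hren f V)"
  and hren_HPoint [simp]: "hren f (HPoint \<tau> S R U) = HPoint \<tau> (hren f S) (hren f R) (hren f U)"
  by (simp_all add: hren_as_hsub)

lemma Sing_eq: "Sing \<tau> a = HCompr \<tau> (HEq (HVar 0) a\<Up>)"
  by (simp add: hdefs)

lemma Null_eq: "Null \<tau> = HCompr \<tau> HBot"
  by (simp add: hdefs)

lemma HDown_eq: "HDown \<tau> S R U V = HCompr \<tau> (HAnd (HMem (HVar 0) S\<Up>)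
    (HAnd (HNear \<tau> R\<Up> U\<Up> (HVar 0)) (HNear \<tau> R\<Up> V\<Up> (HVar 0))))"
  by (simp add: hdefs)

lemma HStarSet_eq: "HStarSet \<tau> S R U = HCompr \<tau> (HAnd (HMem (HVar 0) S\<Up>)
    (HAll \<tau> (HImp (HMem (HVar 0) (HDown \<tau> (hren plus2 S) (hren plus2 R)
        (Sing \<tau> (HVar 1)) (hren plus2 U)))
      (HCov (hren plus2 R) (HVar 0) (Null \<tau>)))))"
  by (simp add: hdefs)

lemma HPoint_eq: "HPoint \<tau> S R \<alpha> = HAnd (HSub \<tau> \<alpha> S)
   (HAnd (HEx \<tau> (HMem (HVar 0) \<alpha>\<Up>))
   (HAnd (HAll \<tau> (HAll \<tau> (HImp (HMem (HVar 1) (hren plus2 \<alpha>)) (HImp (HMem (HVar 0) (hren plus2 \<alpha>))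
      (HEx \<tau> (HAnd (HMem (HVar 0) (hren plus3 \<alpha>))
         (HMem (HVar 0) (HDown \<tau> (hren plus3 S) (hren plus3 R)
            (Sing \<tau> (HVar 2)) (Sing \<tau> (HVar 1))))))))))
   (HAll \<tau> (HAll (HPow \<tau>) (HImp (HMem (HVar 1) (hren plus2 \<alpha>))
      (HImp (HSub \<tau> (HVar 0) (hren plus2 S))
      (HImp (HCov (hren plus2 R) (HVar 1) (HVar 0))
      (HEx \<tau> (HAnd (HMem (HVar 0) (HVar 1)) (HMem (HVar 0) (hren plus3 \<alpha>)))))))))))"
  by (simp add: HPoint_def hdefs)

lemma hty_of_Sing [simp]: "hty_of a E = Some \<tau> \<Longrightarrow> hty_of (Sing \<tau> a) E = Some (HPow \<tau>)"
  and hty_of_Null [simp]: "hty_of (Null \<tau>) E = Some (HPow \<tau>)"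
  and hty_of_HCov [simp]: "hcov E \<tau> R \<Longrightarrow> hty_of a E = Some \<tau>
    \<Longrightarrow> hset E \<tau> U \<Longrightarrow> hform E (HCov R a U)"
  and hty_of_HSub [simp]: "hset E \<tau> U \<Longrightarrow> hset E \<tau> V
    \<Longrightarrow> hform E (HSub \<tau> U V)"
  by (simp_all add: Sing_eq Null_eq HCov_def HSub_def)

lemma hty_of_HNear [simp]: "hcov E \<tau> R \<Longrightarrow> hty_of a E = Some \<tau>
    \<Longrightarrow> hset E \<tau> U \<Longrightarrow> hform E (HNear \<tau> R U a)"
  by (simp add: HNear_def)

lemma hty_of_HDown [simp]: "hset E \<tau> S \<Longrightarrow> hcov E \<tau> R
    \<Longrightarrow> hset E \<tau> U \<Longrightarrow> hset E \<tau> V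
    \<Longrightarrow> hty_of (HDown \<tau> S R U V) E = Some (HPow \<tau>)"
  by (simp add: HDown_eq)

lemma hty_of_HStarSet [simp]: "hset E \<tau> S \<Longrightarrow> hcov E \<tau> R
    \<Longrightarrow> hset E \<tau> U \<Longrightarrow> hty_of (HStarSet \<tau> S R U) E = Some (HPow \<tau>)"
  by (simp add: HStarSet_eq)

lemma hcons_hup [simp]: "hsub (hcons t HVar) (hup \<sigma> n) = hcons t \<sigma> n"
  by (cases n) (simp_all add: hsub_hren)

lemma hprov_all2:
  assumes "hprov E G (HAll \<tau> (HAll \<sigma> A))" "hty_of s E = Some \<tau>" "hty_of t E = Some \<sigma>"
    "hsub (hcons t (hcons s HVar)) A = B"
  shows "hprov E G B"
  using hAllE[OF hAllE[OF assms(1), of s, unfolded hinst_hcons hsub.simps], of t] assms(2-4)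
  by (simp add: hinst_hcons hsub_hsub)

section \<open>Points and pseudocomplements in topos logic\<close>

lemma HSub_elim:
  assumes "hprov E G (HSub \<tau> U V)" "hprov E G (HMem a U)" "hty_of a E = Some \<tau>"
  shows "hprov E G (HMem a V)"
  using hprov_all_imp[OF assms(1)[unfolded HSub_def] assms(3)] assms(2)
  by (simp add: hinst_hcons hsub_hren)

lemma HPoint_subset: "hprov E G (HPoint \<tau> S R \<alpha>) \<Longrightarrow> hprov E G (HSub \<tau> \<alpha> S)"
  unfolding HPoint_eq by (rule hAndE1)

lemma HPoint_inhabited: "hprov E G (HPoint \<tau> S R \<alpha>) \<Longrightarrow> hprov E G (HEx \<tau> (HMem (HVar 0) \<alpha>\<Up>))"
  unfolding HPoint_eq by (rule hAndE1, rule hAndE2)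

lemma HPoint_directed:
  assumes "hprov E G (HPoint \<tau> S R \<alpha>)" "hprov E G (HMem a \<alpha>)" "hprov E G (HMem b \<alpha>)"
    "hty_of a E = Some \<tau>" "hty_of b E = Some \<tau>"
  shows "hprov E G (HEx \<tau> (HAnd (HMem (HVar 0) \<alpha>\<Up>)
    (HMem (HVar 0) (hren Suc (HDown \<tau> S R (Sing \<tau> a) (Sing \<tau> b))))))"
proof -
  have "hprov E G (HImp (HMem a \<alpha>) (HImp (HMem b \<alpha>) (HEx \<tau> (HAnd (HMem (HVar 0) \<alpha>\<Up>)
    (HMem (HVar 0) (hren Suc (HDown \<tau> S R (Sing \<tau> a) (Sing \<tau> b))))))))"
    by (rule hprov_all2[OF hAndE1[OF hAndE2[OF hAndE2[OF assms(1)[unfolded HPoint_eq]]]] assms(4,5)])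
      (simp add: numeral_eq_Suc hren_as_hsub hsub_hsub)
  from hImpE[OF hImpE[OF this assms(2)] assms(3)] show ?thesis .
qed

lemma HPoint_splits:
  assumes "hprov E G (HPoint \<tau> S R \<alpha>)" "hprov E G (HMem a \<alpha>)"
    "hprov E G (HSub \<tau> U S)" "hprov E G (HCov R a U)"
    "hty_of a E = Some \<tau>" "hset E \<tau> U"
  shows "hprov E G (HEx \<tau> (HAnd (HMem (HVar 0) U\<Up>) (HMem (HVar 0) \<alpha>\<Up>)))"
proof -
  have "hprov E G (HImp (HMem a \<alpha>) (HImp (HSub \<tau> U S) (HImp (HCov R a U)
      (HEx \<tau> (HAnd (HMem (HVar 0) U\<Up>) (HMem (HVar 0) \<alpha>\<Up>))))))"
    by (rule hprov_all2[OF hAndE2[OF hAndE2[OF hAndE2[OF assms(1)[unfolded HPoint_eq]]]] assms(5,6)])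
      (simp add: numeral_eq_Suc hren_as_hsub hsub_hsub)
  from hImpE[OF hImpE[OF hImpE[OF this assms(2)] assms(3)] assms(4)] show ?thesis .
qed

lemma HCompr_iff:
  "hty_of t E = Some \<tau> \<Longrightarrow> hform (\<tau> # E) A
    \<Longrightarrow> hprov E G (HMem t (HCompr \<tau> A)) \<longleftrightarrow> hprov E G (hinst t A)"
  using hComprE[of E t \<tau> A G] hComprI[of E t \<tau> A G] by auto

lemma Null_elim:
  assumes "hprov E G (HMem a (Null \<tau>))" "hty_of a E = Some \<tau>"
  shows "hprov E G HBot"
  using hComprE[of E a \<tau> HBot G] assms by (simp add: Null_eq hinst_hcons)

lemma Null_subset:
  assumes "hset E \<tau> S"
  shows "hprov E G (HSub \<tau> (Null \<tau>) S)"
  unfolding HSub_def using assms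
  by (intro hprov_all_impI) (auto intro!: hBotE Null_elim[of _ _ "HVar 0" \<tau>] hprov_hyp)

lemma HCov_Null:
  assumes pt: "hprov E G (HPoint \<tau> S R \<alpha>)" and S: "hset E \<tau> S"
    and a: "hprov E G (HMem a \<alpha>)" "hty_of a E = Some \<tau>" and cov: "hprov E G (HCov R a (Null \<tau>))"
  shows "hprov E G HBot"
proof (rule hprov_exE[OF HPoint_splits[OF pt a(1) Null_subset[OF S] cov a(2)]])
  let ?A = "HAnd (HMem (HVar 0) (hren Suc (Null \<tau>))) (HMem (HVar 0) \<alpha>\<Up>)"
  assume "hprov (\<tau> # E) (insert ?A (hren Suc ` G)) ?A"
  from Null_elim[OF hAndE1[OF this, simplified]]
  show "hprov (\<tau> # E) (insert ?A (hren Suc ` G)) HBot\<Up>"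
    by simp
qed simp_all

lemma HDown_iff:
  assumes "hset E \<tau> S" "hcov E \<tau> R"
    "hset E \<tau> U" "hset E \<tau> V" "hty_of d E = Some \<tau>"
  shows "hprov E G (HMem d (HDown \<tau> S R U V)) \<longleftrightarrow>
    hprov E G (HMem d S) \<and> hprov E G (HNear \<tau> R U d) \<and> hprov E G (HNear \<tau> R V d)"
  using assms unfolding HDown_eq
  by (subst HCompr_iff) (auto simp: hinst_hcons hsub_hren intro: hAndI dest: hAndE1 hAndE2)

lemma HNear_mono:
  assumes "hprov E G (HNear \<tau> R U d)" "hprov E G (HSub \<tau> U V)"
    "hcov E \<tau> R" "hty_of d E = Some \<tau>"
  shows "hprov E G (HNear \<tau> R V d)"
  using assms(1) unfolding HNear_def
  by (rule hprov_ex_mono[OF _ hprov_sub_and[OF assms(2)[unfolded HSub_def]]]) (simp add: assms)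

lemma HStarSet_iff:
  assumes "hset E \<tau> S" "hcov E \<tau> R"
    "hset E \<tau> U" "hty_of a E = Some \<tau>"
  shows "hprov E G (HMem a (HStarSet \<tau> S R U)) \<longleftrightarrow> hprov E G (HMem a S) \<and>
    hprov E G (HAll \<tau> (HImp (HMem (HVar 0) (hren Suc (HDown \<tau> S R (Sing \<tau> a) U))) (HCov R\<Up>
      (HVar 0) (Null \<tau>))))"
  using assms unfolding HStarSet_eq
  by (subst HCompr_iff, simp, simp) (auto simp: hinst_hcons hren_as_hsub hsub_hsub intro: hAndI dest:
    hAndE1 hAndE2)

lemma HStarSet_elim:
  assumes "hset E \<tau> S" "hcov E \<tau> R"
    "hset E \<tau> U" "hty_of a E = Some \<tau>" "hty_of d E = Some \<tau>"
    and "hprov E G (HMem a (HStarSet \<tau> S R U))" "hprov E G (HMem d (HDown \<tau> S R (Sing \<tau> a) U))"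
  shows "hprov E G (HCov R d (Null \<tau>))"
proof -
  have "hprov E G (HAll \<tau> (HImp (HMem (HVar 0) (hren Suc (HDown \<tau> S R (Sing \<tau> a) U))) (HCov R\<Up>
    (HVar 0) (Null \<tau>))))"
    using assms by (simp add: HStarSet_iff)
  from hprov_all_imp[OF this assms(5)] assms(7) show ?thesis
    by (simp add: hinst_hcons hsub_hren)
qed

text \<open>The element \<open>b\<close> lies in \<open>U\<close>, so the singleton of
  \<open>b\<close> is included in \<open>U\<close>. For c in the point and in b down b this changes
  the second nearness condition from the singleton to \<open>U\<close>.\<close>

lemma HStarSet_refute:
  assumes ty [simp]: "hset E \<tau> S" "hcov E \<tau> R"
    "hset E \<tau> U" "hset E \<tau> \<alpha>" "hty_of b E = Some \<tau>"
    and pt: "hprov E G (HPoint \<tau> S R \<alpha>)" and b: "hprov E G (HMem b \<alpha>)"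
    and star: "hprov E G (HMem b (HStarSet \<tau> S R U))" and full: "hprov E G (HSub \<tau> S U)"
  shows "hprov E G HBot"
proof (rule hprov_exE[OF HPoint_directed[OF pt b b ty(5) ty(5)]])
  let ?D = "HMem (HVar 0) (HDown \<tau> S\<Up> R\<Up> (Sing \<tau> b\<Up>) (Sing \<tau> b\<Up>))"
  let ?A = "HAnd (HMem (HVar 0) \<alpha>\<Up>) (HMem (HVar 0) (hren Suc (HDown \<tau> S R (Sing \<tau> b) (Sing \<tau> b))))"
  let ?E = "\<tau> # E" and ?G = "insert ?A (hren Suc ` G)"
  assume A: "hprov ?E ?G ?A"
  note sh = hprov_shift[where E = E and G = G and B = ?A and \<tau> = \<tau>]
  have c: "hprov ?E ?G (HMem (HVar 0) \<alpha>\<Up>)"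
    by (rule hAndE1[OF A])
  have D: "hprov ?E ?G (HMem (HVar 0) S\<Up>)"
    "hprov ?E ?G (HNear \<tau> R\<Up> (Sing \<tau> b\<Up>) (HVar 0))"
    using hAndE2[OF A] by (simp_all add: HDown_iff)
  have bU: "hprov E G (HMem b U)"
    by (rule HSub_elim[OF full HSub_elim[OF HPoint_subset[OF pt] b ty(5)] ty(5)])
  have "hprov E G (HSub \<tau> (Sing \<tau> b) U)"
    unfolding HSub_def
  proof (rule hprov_all_impI)
    let ?G = "insert (HMem (HVar 0) (hren Suc (Sing \<tau> b))) (hren Suc ` G)"
    have "hprov ?E ?G (HMem (HVar 0) (HCompr \<tau> (HEq (HVar 0) (hren plus2 b))))"
      using hprov_hyp[of "HMem (HVar 0) (hren Suc (Sing \<tau> b))" ?E] by (simp add: Sing_eq hren_hren)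
    then have "hprov ?E ?G (hinst (HVar 0) (HEq (HVar 0) (hren plus2 b)))"
      by (rule hComprE[rotated 2]) simp_all
    then have e: "hprov ?E ?G (HEq (HVar 0) b\<Up>)"
      by (simp add: hinst_hcons hsub_hren hren_as_hsub[symmetric])
    \<comment> \<open>Symmetry by substitution into y = x: after the instantiation index 1 is the
      bound variable 0, and the instance at that variable holds by reflexivity.\<close>
    have "hprov ?E ?G (hinst b\<Up> (HEq (HVar 0) (HVar 1)))"
      by (rule hEqSubst[OF _ _ _ e]) (simp_all add: hinst_hcons hEqRefl[of _ _ \<tau>])
    then have e': "hprov ?E ?G (HEq b\<Up> (HVar 0))"
      by (simp add: hinst_hcons)
    have "hprov ?E ?G (hinst (HVar 0) (HMem (HVar 0) (hren plus2 U)))"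
      by (rule hEqSubst[OF _ _ _ e', of \<tau>])
        (use hprov_shift[OF bU] in \<open>simp_all add: hinst_hcons hsub_hren hren_as_hsub[symmetric]\<close>)
    then show "hprov ?E ?G (HMem (HVar 0) U\<Up>)"
      by (simp add: hinst_hcons hsub_hren hren_as_hsub[symmetric])
  qed simp
  from sh[OF this] have "hprov ?E ?G (HSub \<tau> (Sing \<tau> b\<Up>) U\<Up>)"
    by simp
  from HNear_mono[OF D(2) this] have "hprov ?E ?G (HNear \<tau> R\<Up> U\<Up> (HVar 0))"
    by simp
  with D have "hprov ?E ?G (HMem (HVar 0) (HDown \<tau> S\<Up> R\<Up> (Sing \<tau> b\<Up>) (hren
    Suc U)))"
    by (simp add: HDown_iff)
  then have "hprov ?E ?G (HCov R\<Up> (HVar 0) (Null \<tau>))"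
    by (rule HStarSet_elim[rotated 6]) (use sh[OF star] in simp_all)
  then have "hprov ?E ?G HBot"
    by (rule HCov_Null[where S = "S\<Up>" and \<alpha> = "\<alpha>\<Up>", rotated 4]) (use sh[OF pt] c in simp_all)
  then show "hprov ?E ?G HBot\<Up>"
    by simp
qed simp

text \<open>A witness of nearness to \<open>U\<close> would be an element of the empty subset, so no
  element lies in a down \<open>U\<close>.\<close>

lemma HStarSet_intro:
  assumes ty [simp]: "hset E \<tau> S" "hcov E \<tau> R"
    "hset E \<tau> U"
    and emp: "hprov E G (HSub \<tau> U (Null \<tau>))"
  shows "hprov E G (HSub \<tau> S (HStarSet \<tau> S R U))"
  unfolding HSub_def
proof (rule hprov_all_impI)
  let ?E = "\<tau> # E" and ?G = "insert (HMem (HVar 0) S\<Up>) (hren Suc ` G)"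
  let ?S = "S\<Up>" and ?R = "R\<Up>" and ?U = "U\<Up>"
  let ?D = "HMem (HVar 0) (hren Suc (HDown \<tau> ?S ?R (Sing \<tau> (HVar 0)) ?U))"
  have "hprov ?E ?G (HAll \<tau> (HImp ?D (HCov ?R\<Up> (HVar 0) (Null \<tau>))))"
  proof (rule hprov_all_impI)
    let ?G' = "insert ?D (hren Suc ` ?G)"
    have emp': "hprov (\<tau> # ?E) ?G' (hren Suc (hren Suc (HSub \<tau> U (Null \<tau>))))"
      by (intro hprov_shift emp)
    have "hprov (\<tau> # ?E) ?G' (HNear \<tau> ?R\<Up> ?U\<Up> (HVar 0))"
      using hprov_hyp[of ?D "\<tau> # ?E" "hren Suc ` ?G"] by (simp add: HDown_iff hren_hren)
    then have "hprov (\<tau> # ?E) ?G' (HNear \<tau> ?R\<Up> (Null \<tau>) (HVar 0))"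
      by (rule HNear_mono) (use emp' in \<open>simp_all add: hren_hren\<close>)
    then have "hprov (\<tau> # ?E) ?G' HBot"
      unfolding HNear_def
      by (rule hprov_exE) (auto dest!: hAndE1 intro: Null_elim[of _ _ "HVar 0" \<tau>])
    then show "hprov (\<tau> # ?E) ?G' (HCov ?R\<Up> (HVar 0) (Null \<tau>))"
      by (rule hBotE) (simp add: hren_hren)
  qed (simp add: hren_hren)
  then have "hprov ?E ?G (HMem (HVar 0) (HStarSet \<tau> ?S ?R ?U))"
    using hprov_hyp[of "HMem (HVar 0) ?S" ?E "hren Suc ` G"] by (simp add: HStarSet_iff)
  then show "hprov ?E ?G (HMem (HVar 0) (hren Suc (HStarSet \<tau> S R U)))"
    by simp
qed simp

lemma HStarSet_subset:
  assumes ty [simp]: "hset E \<tau> S" "hcov E \<tau> R"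
    "hset E \<tau> U"
  shows "hprov E G (HSub \<tau> (HStarSet \<tau> S R U) S)"
  unfolding HSub_def
proof (rule hprov_all_impI)
  let ?A = "HMem (HVar 0) (hren Suc (HStarSet \<tau> S R U))"
  show "hprov (\<tau> # E) (insert ?A (hren Suc ` G)) (HMem (HVar 0) S\<Up>)"
    using hprov_hyp[of ?A "\<tau> # E" "hren Suc ` G"] by (simp add: HStarSet_iff)
qed simp

section \<open>Covers by the union of two subsets\<close>

definition HCup :: "hty \<Rightarrow> htm \<Rightarrow> htm \<Rightarrow> htm" where
  "HCup \<tau> U V = hcup \<tau> (lift U) (lift V) 0"

lemma HCup_eq: "HCup \<tau> U V = HCompr \<tau> (HOr (HMem (HVar 0) U\<Up>) (HMem (HVar 0) V\<Up>))"
  by (simp add: HCup_def hdefs)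

lemma hsub_HCup [simp]: "hsub \<sigma> (HCup \<tau> U V) = HCup \<tau> (hsub \<sigma> U) (hsub \<sigma> V)"
  by (simp add: HCup_eq hsub_hren hren_hsub)

lemma hren_HCup [simp]: "hren f (HCup \<tau> U V) = HCup \<tau> (hren f U) (hren f V)"
  by (simp add: hren_as_hsub)

lemma hty_of_HCup [simp]: "hset E \<tau> U \<Longrightarrow> hset E \<tau> V
    \<Longrightarrow> hty_of (HCup \<tau> U V) E = Some (HPow \<tau>)"
  by (simp add: HCup_eq)

lemma HCup_elim:
  assumes "hprov E G (HMem a (HCup \<tau> U V))"
    "hset E \<tau> U" "hset E \<tau> V" "hty_of a E = Some \<tau>"
  shows "hprov E G (HOr (HMem a U) (HMem a V))"
  using hComprE[OF _ _ assms(1)[unfolded HCup_eq]] assms(2-4)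
  by (simp add: hinst_hcons hsub_hren)

lemma HCup_subset:
  assumes "hprov E G (HSub \<tau> U S)" "hprov E G (HSub \<tau> V S)"
    and ty: "hset E \<tau> U" "hset E \<tau> V"
  shows "hprov E G (HSub \<tau> (HCup \<tau> U V) S)"
  unfolding HSub_def
proof (rule hprov_all_impI)
  let ?A = "HMem (HVar 0) (hren Suc (HCup \<tau> U V))"
  have "hprov (\<tau> # E) (insert ?A (hren Suc ` G)) (HOr (HMem (HVar 0) U\<Up>) (HMem (HVar 0) (hren
    Suc V)))"
    by (rule HCup_elim) (use hprov_hyp[of ?A "\<tau> # E" "hren Suc ` G"] ty in simp_all)
  then show "hprov (\<tau> # E) (insert ?A (hren Suc ` G)) (HMem (HVar 0) S\<Up>)"
  proof (rule hOrE)
    show "hprov (\<tau> # E) (insert (HMem (HVar 0) U\<Up>) (insert ?A (hren Suc ` G))) (HMem (HVar 0)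
      S\<Up>)"
      by (rule HSub_elim[where U = "U\<Up>"])
        (use hprov_weaken[OF hprov_shift[OF assms(1)]] ty in \<open>simp_all add: hprov_hyp\<close>)
    show "hprov (\<tau> # E) (insert (HMem (HVar 0) V\<Up>) (insert ?A (hren Suc ` G))) (HMem (HVar 0)
      S\<Up>)"
      by (rule HSub_elim[where U = "V\<Up>"])
        (use hprov_weaken[OF hprov_shift[OF assms(2)]] ty in \<open>simp_all add: hprov_hyp\<close>)
  qed
qed (use ty in simp)

text \<open>The two parts of the cover are terms here. Their union is a comprehension term, which is
  opened at the element b that the point shares with it.\<close>

lemma HPoint_cases:
  assumes ty [simp]: "hset E \<tau> S" "hcov E \<tau> R"
    "hset E \<tau> U" "hset E \<tau> V" "hset E \<tau> \<alpha>"
    "hform E P" "hform E Q"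
    and pt: "hprov E G (HPoint \<tau> S R \<alpha>)"
    and cov: "hprov E G (HAll \<tau> (HImp (HMem (HVar 0) S\<Up>) (HCov R\<Up> (HVar 0) (hren Suc
      (HCup \<tau> U V)))))"
    and sub: "hprov E G (HSub \<tau> U S)" "hprov E G (HSub \<tau> V S)"
    and P: "hprov E G (HAll \<tau> (HImp (HMem (HVar 0) \<alpha>\<Up>) (HImp (HMem (HVar 0) U\<Up>) (hren
      Suc P))))"
    and Q: "hprov E G (HAll \<tau> (HImp (HMem (HVar 0) \<alpha>\<Up>) (HImp (HMem (HVar 0) V\<Up>) (hren
      Suc Q))))"
  shows "hprov E G (HOr P Q)"
proof (rule hprov_exE[OF HPoint_inhabited[OF pt]])
  let ?E = "\<tau> # E" and ?G = "insert (HMem (HVar 0) \<alpha>\<Up>) (hren Suc ` G)"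
  let ?W = "HCup \<tau> U\<Up> V\<Up>"
  assume a: "hprov ?E ?G (HMem (HVar 0) \<alpha>\<Up>)"
  note sh = hprov_shift[where E = E and G = G and \<tau> = \<tau> and B = "HMem (HVar 0) \<alpha>\<Up>"]
  have pt': "hprov ?E ?G (HPoint \<tau> S\<Up> R\<Up> \<alpha>\<Up>)"
    using sh[OF pt] by simp
  have "hprov ?E ?G (HMem (HVar 0) S\<Up>)"
    by (rule HSub_elim[OF HPoint_subset[OF pt'] a]) simp
  then have c: "hprov ?E ?G (HCov R\<Up> (HVar 0) ?W)"
    using hImpE[OF hprov_all_elim[OF cov]] by simp
  have s: "hprov ?E ?G (HSub \<tau> ?W S\<Up>)"
    using sh[OF HCup_subset[OF sub ty(3,4)]] by simp
  show "hprov ?E ?G (hren Suc (HOr P Q))"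
  proof (rule hprov_exE[OF HPoint_splits[OF pt' a s c]])
    let ?A = "HAnd (HMem (HVar 0) ?W\<Up>) (HMem (HVar 0) \<alpha>\<Up>\<Up>)"
    let ?G' = "insert ?A (hren Suc ` ?G)"
    assume A: "hprov (\<tau> # ?E) ?G' ?A"
    have P': "hprov (\<tau> # ?E) ?G' (HImp (HMem (HVar 0) U\<Up>\<Up>) P\<Up>\<Up>)"
      using hImpE[OF hprov_all_elim[OF sh[OF P, unfolded hren.simps]]] hAndE2[OF A] by (simp add: hren_hren)
    have Q': "hprov (\<tau> # ?E) ?G' (HImp (HMem (HVar 0) V\<Up>\<Up>) Q\<Up>\<Up>)"
      using hImpE[OF hprov_all_elim[OF sh[OF Q, unfolded hren.simps]]] hAndE2[OF A] by (simp add: hren_hren)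
    have "hprov (\<tau> # ?E) ?G' (HOr (HMem (HVar 0) U\<Up>\<Up>) (HMem (HVar 0) (hren Suc (hren
      Suc V))))"
      by (rule HCup_elim) (use hAndE1[OF A] in \<open>simp_all add: hren_hren\<close>)
    then have "hprov (\<tau> # ?E) ?G' (HOr P\<Up>\<Up> Q\<Up>\<Up>)"
    proof (rule hOrE)
      show "hprov (\<tau> # ?E) (insert (HMem (HVar 0) U\<Up>\<Up>) ?G') (HOr (hren Suc (hren Suc
        P)) Q\<Up>\<Up>)"
        by (rule hOrI1[OF hImpE[OF hprov_weaken[OF P'] hprov_hyp]]) (simp_all add: hren_hren)
      show "hprov (\<tau> # ?E) (insert (HMem (HVar 0) V\<Up>\<Up>) ?G') (HOr (hren Suc (hren Suc
        P)) Q\<Up>\<Up>)"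
        by (rule hOrI2[OF hImpE[OF hprov_weaken[OF Q'] hprov_hyp]]) (simp_all add: hren_hren)
    qed
    then show "hprov (\<tau> # ?E) ?G' (hren Suc (hren Suc (HOr P Q)))"
      by simp
  qed simp_all
qed simp

text \<open>Comprehension is a term former, so {x in S. P} is available for every formula
  \<open>P\<close> without introducing an existential witness.\<close>

definition HRestr :: "hty \<Rightarrow> htm \<Rightarrow> htm \<Rightarrow> htm" where
  "HRestr \<tau> S P = HCompr \<tau> (HAnd (HMem (HVar 0) S\<Up>) P\<Up>)"

lemma hren_HRestr [simp]: "hren f (HRestr \<tau> S P) = HRestr \<tau> (hren f S) (hren f P)"
  by (simp add: HRestr_def hren_hren)

lemma hty_of_HRestr [simp]: "hset E \<tau> S \<Longrightarrow> hform E P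
    \<Longrightarrow> hty_of (HRestr \<tau> S P) E = Some (HPow \<tau>)"
  by (simp add: HRestr_def)

lemma HRestr_iff:
  assumes "hset E \<tau> S" "hform E P" "hty_of a E = Some \<tau>"
  shows "hprov E G (HMem a (HRestr \<tau> S P)) \<longleftrightarrow> hprov E G (HMem a S) \<and> hprov E G P"
  using assms unfolding HRestr_def
  by (subst HCompr_iff) (auto simp: hinst_hcons hsub_hren intro: hAndI dest: hAndE1 hAndE2)

lemma HStarSet_imp_not:
  assumes ty [simp]: "hset E \<tau> S" "hcov E \<tau> R"
    "hset E \<tau> \<alpha>" "hform E P"
    and pt: "hprov E G (HPoint \<tau> S R \<alpha>)"
  shows "hprov E G (HAll \<tau> (HImp (HMem (HVar 0) \<alpha>\<Up>)
    (HImp (HMem (HVar 0) (hren Suc (HStarSet \<tau> S R (HRestr \<tau> S P)))) (hren Suc (HImp P HBot)))))"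
proof -
  let ?U = "HStarSet \<tau> S R (HRestr \<tau> S P)"
  let ?E = "\<tau> # E"
  let ?G = "insert P\<Up> (insert (HMem (HVar 0) ?U\<Up>) (insert (HMem (HVar 0) (hren Suc
    \<alpha>)) (hren Suc ` G)))"
  have "hprov ?E ?G (hren Suc (HPoint \<tau> S R \<alpha>))"
    by (intro hprov_weaken hprov_shift pt)
  then have pt': "hprov ?E ?G (HPoint \<tau> S\<Up> R\<Up> \<alpha>\<Up>)"
    by simp
  have "hprov ?E ?G (HSub \<tau> S\<Up> (HRestr \<tau> S\<Up> P\<Up>))"
    unfolding HSub_def
  proof (rule hprov_all_impI)
    let ?G' = "insert (HMem (HVar 0) S\<Up>\<Up>) (hren Suc ` ?G)"
    have "hprov (\<tau> # ?E) ?G' P\<Up>\<Up>"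
      by (intro hprov_shift hprov_hyp) simp
    moreover have "hprov (\<tau> # ?E) ?G' (HMem (HVar 0) S\<Up>\<Up>)"
      by (rule hprov_hyp) (simp add: hren_hren)
    ultimately show "hprov (\<tau> # ?E) ?G' (HMem (HVar 0) (hren Suc (HRestr \<tau> S\<Up> P\<Up>)))"
      by (simp add: HRestr_iff hren_hren)
  qed (simp add: hren_hren)
  moreover have "hprov ?E ?G (HMem (HVar 0) \<alpha>\<Up>)"
    "hprov ?E ?G (HMem (HVar 0) (HStarSet \<tau> S\<Up> R\<Up> (HRestr \<tau> S\<Up> P\<Up>)))"
    by (simp_all add: hHyp)
  ultimately have "hprov ?E ?G HBot"
    by (intro HStarSet_refute[OF _ _ _ _ _ pt', of "HRestr \<tau> S\<Up> P\<Up>" "HVar 0"]) simp_all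
  then show ?thesis
    by (simp add: hprov_all_impI hImpI)
qed

lemma HStarSet2_imp_not_not:
  assumes ty [simp]: "hset E \<tau> S" "hcov E \<tau> R"
    "hset E \<tau> \<alpha>" "hform E P"
    and pt: "hprov E G (HPoint \<tau> S R \<alpha>)"
  shows "hprov E G (HAll \<tau> (HImp (HMem (HVar 0) \<alpha>\<Up>)
    (HImp (HMem (HVar 0) (hren Suc (HStarSet \<tau> S R (HStarSet \<tau> S R (HRestr \<tau> S P)))))
      (hren Suc (HImp (HImp P HBot) HBot)))))"
proof -
  let ?U = "HStarSet \<tau> S R (HStarSet \<tau> S R (HRestr \<tau> S P))"
  let ?E = "\<tau> # E"
  let ?N = "HImp P\<Up> HBot"
  let ?G = "insert ?N (insert (HMem (HVar 0) ?U\<Up>) (insert (HMem (HVar 0) \<alpha>\<Up>) (hren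
    Suc ` G)))"
  let ?V = "HStarSet \<tau> S\<Up> R\<Up> (HRestr \<tau> S\<Up> P\<Up>)"
  have "hprov ?E ?G (hren Suc (HPoint \<tau> S R \<alpha>))"
    by (intro hprov_weaken hprov_shift pt)
  then have pt': "hprov ?E ?G (HPoint \<tau> S\<Up> R\<Up> \<alpha>\<Up>)"
    by simp
  have "hprov ?E ?G (HSub \<tau> (HRestr \<tau> S\<Up> P\<Up>) (Null \<tau>))"
    unfolding HSub_def
  proof (rule hprov_all_impI)
    let ?A = "HMem (HVar 0) (hren Suc (HRestr \<tau> S\<Up> P\<Up>))"
    let ?G' = "insert ?A (hren Suc ` ?G)"
    have "hprov (\<tau> # ?E) ?G' ?N\<Up>"
      by (intro hprov_shift hprov_hyp) simp
    moreover have "hprov (\<tau> # ?E) ?G' ?A"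
      by (rule hprov_hyp) (simp add: hren_hren)
    ultimately have "hprov (\<tau> # ?E) ?G' HBot"
      by (auto simp: HRestr_iff hren_hren intro: hImpE)
    then show "hprov (\<tau> # ?E) ?G' (HMem (HVar 0) (hren Suc (Null \<tau>)))"
      by (rule hBotE) simp
  qed (simp add: hren_hren)
  then have "hprov ?E ?G (HSub \<tau> S\<Up> ?V)"
    by (rule HStarSet_intro[rotated 3]) simp_all
  moreover have "hprov ?E ?G (HMem (HVar 0) \<alpha>\<Up>)"
    "hprov ?E ?G (HMem (HVar 0) (HStarSet \<tau> S\<Up> R\<Up> ?V))"
    by (simp_all add: hHyp)
  ultimately have "hprov ?E ?G HBot"
    by (intro HStarSet_refute[OF _ _ _ _ _ pt', of ?V "HVar 0"]) simp_all
  then show ?thesis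
    by (simp add: hprov_all_impI hImpI)
qed

lemma HRestr_imp:
  assumes ty [simp]: "hset E \<tau> S" "hform E P"
  shows "hprov E G (HSub \<tau> (HRestr \<tau> S P) S)"
    and "hprov E G (HAll \<tau> (HImp (HMem (HVar 0) (hren Suc (HRestr \<tau> S P))) P\<Up>))"
proof -
  let ?A = "HMem (HVar 0) (hren Suc (HRestr \<tau> S P))"
  have "hprov (\<tau> # E) (insert ?A (hren Suc ` G)) ?A"
    by (rule hprov_hyp) simp
  then have "hprov (\<tau> # E) (insert ?A (hren Suc ` G)) (HMem (HVar 0) S\<Up>)"
    "hprov (\<tau> # E) (insert ?A (hren Suc ` G)) P\<Up>"
    by (simp_all add: HRestr_iff)
  then show "hprov E G (HSub \<tau> (HRestr \<tau> S P) S)"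
    "hprov E G (HAll \<tau> (HImp (HMem (HVar 0) (hren Suc (HRestr \<tau> S P))) P\<Up>))"
    unfolding HSub_def by (auto intro!: hprov_all_impI)
qed

section \<open>Boolean and De Morgan spaces with a point in topos logic\<close>

definition HBool :: "hty \<Rightarrow> htm \<Rightarrow> htm \<Rightarrow> htm" where
  "HBool \<tau> S R = hBoolean \<tau> (lift S) (lift R) 0"

definition HDeM :: "hty \<Rightarrow> htm \<Rightarrow> htm \<Rightarrow> htm" where
  "HDeM \<tau> S R = hDeMorgan \<tau> (lift S) (lift R) 0"

lemma hren_HBool [simp]: "hren f (HBool \<tau> S R) = HBool \<tau> (hren f S) (hren f R)"
  by (simp add: HBool_def hdefs)

lemma hren_HDeM [simp]: "hren f (HDeM \<tau> S R) = HDeM \<tau> (hren f S) (hren f R)"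
  by (simp add: HDeM_def hdefs)

lemma HBool_elim:
  assumes "hprov E G (HBool \<tau> S R)" "hprov E G (HSub \<tau> U S)" "hset E \<tau> U"
  shows "hprov E G (HAll \<tau> (HImp (HMem (HVar 0) S\<Up>)
    (HCov R\<Up> (HVar 0) (hren Suc (HCup \<tau> U (HStarSet \<tau> S R U))))))"
proof -
  have "HBool \<tau> S R = HAll (HPow \<tau>) (HImp (HSub \<tau> (HVar 0) S\<Up>)
    (HAll \<tau> (HImp (HMem (HVar 0) (hren plus2 S)) (HCov (hren plus2 R) (HVar 0)
      (HCup \<tau> (HVar 1) (HStarSet \<tau> (hren plus2 S) (hren plus2 R) (HVar 1)))))))"
    by (simp add: HBool_def HCup_def hdefs)
  from hprov_all_imp[OF assms(1)[unfolded this] assms(3)] assms(2) show ?thesis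
    by (simp add: hinst_hcons hren_as_hsub hsub_hsub)
qed

lemma HDeM_elim:
  assumes "hprov E G (HDeM \<tau> S R)" "hprov E G (HSub \<tau> U S)" "hset E \<tau> U"
  shows "hprov E G (HAll \<tau> (HImp (HMem (HVar 0) S\<Up>)
    (HCov R\<Up> (HVar 0) (hren Suc (HCup \<tau> (HStarSet \<tau> S R (HStarSet \<tau> S R U)) (HStarSet \<tau> S R U))))))"
proof -
  have "HDeM \<tau> S R = HAll (HPow \<tau>) (HImp (HSub \<tau> (HVar 0) S\<Up>)
    (HAll \<tau> (HImp (HMem (HVar 0) (hren plus2 S)) (HCov (hren plus2 R) (HVar 0)
      (HCup \<tau> (HStarSet \<tau> (hren plus2 S) (hren plus2 R) (HStarSet \<tau> (hren plus2 S) (hren plus2 R) (HVar 1)))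
        (HStarSet \<tau> (hren plus2 S) (hren plus2 R) (HVar 1)))))))"
    by (simp add: HDeM_def HCup_def hdefs)
  from hprov_all_imp[OF assms(1)[unfolded this] assms(3)] assms(2) show ?thesis
    by (simp add: hinst_hcons hren_as_hsub hsub_hsub)
qed

lemma HBool_point_EM:
  assumes ty [simp]: "hset E \<tau> S" "hcov E \<tau> R"
    "hset E \<tau> \<alpha>" "hform E P"
    and bool: "hprov E G (HBool \<tau> S R)" and pt: "hprov E G (HPoint \<tau> S R \<alpha>)"
  shows "hprov E G (HOr P (HImp P HBot))"
proof (rule HPoint_cases[where U = "HRestr \<tau> S P" and V = "HStarSet \<tau> S R (HRestr \<tau> S P)" and \<alpha> = \<alpha> and S
  = S and R = R])
  show "hprov E G (HAll \<tau> (HImp (HMem (HVar 0) \<alpha>\<Up>)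
      (HImp (HMem (HVar 0) (hren Suc (HRestr \<tau> S P))) P\<Up>)))"
    by (rule hprov_all_impI[OF _ hprov_all_elim[OF HRestr_imp(2)]]) simp_all
  show "hprov E G (HAll \<tau> (HImp (HMem (HVar 0) S\<Up>)
      (HCov R\<Up> (HVar 0) (hren Suc (HCup \<tau> (HRestr \<tau> S P) (HStarSet \<tau> S R (HRestr \<tau> S P)))))))"
    by (rule HBool_elim[OF bool HRestr_imp(1)]) simp_all
qed (rule HStarSet_imp_not pt HRestr_imp HStarSet_subset | simp)+

lemma HDeM_point_DML:
  assumes ty [simp]: "hset E \<tau> S" "hcov E \<tau> R"
    "hset E \<tau> \<alpha>" "hform E P"
    and dem: "hprov E G (HDeM \<tau> S R)" and pt: "hprov E G (HPoint \<tau> S R \<alpha>)"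
  shows "hprov E G (HOr (HImp (HImp P HBot) HBot) (HImp P HBot))"
proof (rule HPoint_cases[where U = "HStarSet \<tau> S R (HStarSet \<tau> S R (HRestr \<tau> S P))" and V = "HStarSet \<tau> S
  R (HRestr \<tau> S P)" and \<alpha> = \<alpha> and S = S and R = R])
  show "hprov E G (HAll \<tau> (HImp (HMem (HVar 0) S\<Up>)
      (HCov R\<Up> (HVar 0) (hren Suc (HCup \<tau> (HStarSet \<tau> S R (HStarSet \<tau> S R (HRestr \<tau> S P)))
        (HStarSet \<tau> S R (HRestr \<tau> S P)))))))"
    by (rule HDeM_elim[OF dem HRestr_imp(1)]) simp_all
qed (rule HStarSet_imp_not HStarSet2_imp_not_not pt HRestr_imp HStarSet_subset | simp)+

text \<open>The space axioms stay in builder form at depth 2. Builders count levels from outside, so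
  \<open>hvar 0\<close> and \<open>hvar 1\<close> are the carrier and the cover, whose indices are 1
  and 0.\<close>

definition HSpace_with_point :: "(hty \<Rightarrow> htm \<Rightarrow> htm \<Rightarrow> htm) \<Rightarrow> hty \<Rightarrow> htm" where
  "HSpace_with_point K \<tau> = HEx (HPow \<tau>) (HEx (HPow (HProd \<tau> (HPow \<tau>)))
     (HAnd (hspace \<tau> (hvar 0) (hvar 1) 2) (HAnd (K \<tau> (HVar 1) (HVar 0)) (HEx (HPow \<tau>) (HPoint \<tau> (HVar 2)
       (HVar 1) (HVar 0))))))"

text \<open>The cover is an object of the theory here, not a formula, so three witnesses are
  eliminated, the carrier, the cover and the point, and \<open>X\<close> crosses three
  binders.\<close>

lemma HSpace_with_point_elim:
  assumes ren: "\<And>f S R. hren f (K \<tau> S R) = K \<tau> (hren f S) (hren f R)"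
    and sp: "hprov E G (HSpace_with_point K \<tau>)" and ty: "hform E X"
    and X: "\<And>E' G' S R \<alpha>. hset E' \<tau> S \<Longrightarrow> hcov E' \<tau> R
      \<Longrightarrow> hset E' \<tau> \<alpha> \<Longrightarrow> hform E' (hren plus3 X)
      \<Longrightarrow> hprov E' G' (K \<tau> S R) \<Longrightarrow> hprov E' G' (HPoint \<tau> S R \<alpha>)
      \<Longrightarrow> hprov E' G' (hren plus3 X)"
  shows "hprov E G X"
proof (rule hprov_exE[OF sp[unfolded HSpace_with_point_def] ty])
  let ?\<sigma> = "HPow (HProd \<tau> (HPow \<tau>))"
  let ?P = "HPoint \<tau> (HVar 2) (HVar 1) (HVar 0)" and ?K = "K \<tau> (HVar 1) (HVar 0)"
  let ?A = "HAnd (hspace \<tau> (hvar 0) (hvar 1) 2) (HAnd ?K (HEx (HPow \<tau>) ?P))"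
  let ?E = "HPow \<tau> # E" and ?G = "insert (HEx ?\<sigma> ?A) (hren Suc ` G)"
  assume 1: "hprov ?E ?G (HEx ?\<sigma> ?A)"
  show "hprov ?E ?G X\<Up>"
  proof (rule hprov_exE[OF 1])
    let ?E' = "?\<sigma> # ?E" and ?G' = "insert ?A (hren Suc ` ?G)"
    assume A: "hprov ?E' ?G' ?A"
    have K: "hprov ?E' ?G' ?K" and ex: "hprov ?E' ?G' (HEx (HPow \<tau>) ?P)"
      by (rule hAndE1[OF hAndE2[OF A]], rule hAndE2[OF hAndE2[OF A]])
    show "hprov ?E' ?G' X\<Up>\<Up>"
    proof (rule hprov_exE[OF ex])
      assume P: "hprov (HPow \<tau> # ?E') (insert ?P (hren Suc ` ?G')) ?P"
      have "hprov (HPow \<tau> # ?E') (insert ?P (hren Suc ` ?G')) (K \<tau> (HVar 2) (HVar 1))"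
        using hprov_shift[OF K, of "HPow \<tau>" ?P] by (simp add: ren numeral_eq_Suc)
      from X[OF _ _ _ _ this P] show "hprov (HPow \<tau> # ?E') (insert ?P (hren Suc ` ?G')) (hren Suc (hren
        Suc X\<Up>))"
        by (simp add: hren_hren ty numeral_eq_Suc)
    qed (simp add: ty hren_hren)
  qed (simp add: ty)
qed

lemmas hspace_unfold = hdefs hspace_def HBool_def HDeM_def HPoint_def HSpace_with_point_def

lemma HHA_Boolean_with_point_eq: "HHA_Boolean_with_point \<tau> 0 = HSpace_with_point HBool \<tau>"
  by (simp add: HHA_Boolean_with_point_def hspace_unfold)

lemma HHA_DeMorgan_with_point_eq: "HHA_DeMorgan_with_point \<tau> 0 = HSpace_with_point HDeM \<tau>"
  by (simp add: HHA_DeMorgan_with_point_def hspace_unfold)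

text \<open>The proposition is a variable of type \<open>HOmega\<close>. Since the existence
  statement is closed, it is unaffected by that variable, and the derived formula can be generalised
  over it.\<close>

lemma HHA_with_point_implies:
  assumes ren: "\<And>f S R. hren f (K \<tau> S R) = K \<tau> (hren f S) (hren f R)"
    and K: "A 0 = HSpace_with_point K \<tau>" "\<And>E. hform E (A 0)" "\<And>f. hren f (A 0) = A 0"
    and B: "B 0 = HAll HOmega C" "hform [HOmega] C"
    and C: "\<And>E G S R \<alpha>. hset E \<tau> S \<Longrightarrow> hcov E \<tau> R \<Longrightarrow> hset E \<tau> \<alpha> \<Longrightarrow> hform E (hren plus3 C)
      \<Longrightarrow> hprov E G (K \<tau> S R) \<Longrightarrow> hprov E G (HPoint \<tau> S R \<alpha>) \<Longrightarrow> hprov E G (hren plus3 C)"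
  shows "hprov [] {} ((A \<longrightarrow>\<^sub>h B) 0)"
proof -
  have "hprov [HOmega] {A 0} (HSpace_with_point K \<tau>)"
    using hprov_hyp[OF K(2), of "[HOmega]" "{}"] by (simp add: K(1))
  then have "hprov [HOmega] {A 0} C"
    by (rule HSpace_with_point_elim[of K, OF ren _ B(2) C])
  then have "hprov [HOmega] (hren Suc ` {A 0}) C"
    by (simp add: K(3))
  then have "hprov [] {A 0} (B 0)"
    unfolding B(1) by (rule hAllI)
  then show ?thesis
    unfolding himpl_def by (intro hImpI) (simp_all add: K(2))
qed

lemma HHA_EM: "hprov [] {} ((HHA_Boolean_with_point \<tau> \<longrightarrow>\<^sub>h hEM) 0)"
  by (rule HHA_with_point_implies[of HBool \<tau> "HHA_Boolean_with_point \<tau>" hEM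
        "HOr (HVar 0) (HImp (HVar 0) HBot)", OF hren_HBool HHA_Boolean_with_point_eq])
    (simp_all add: HBool_point_EM HHA_Boolean_with_point_def hspace_unfold hEM_def split: if_splits)

lemma HHA_DML: "hprov [] {} ((HHA_DeMorgan_with_point \<tau> \<longrightarrow>\<^sub>h hDML) 0)"
  by (rule HHA_with_point_implies[of HDeM \<tau> "HHA_DeMorgan_with_point \<tau>" hDML
        "HOr (HImp (HImp (HVar 0) HBot) HBot) (HImp (HVar 0) HBot)", OF hren_HDeM HHA_DeMorgan_with_point_eq])
    (simp_all add: HDeM_point_DML HHA_DeMorgan_with_point_def hspace_unfold hDML_def split: if_splits)

section \<open>Constructive type theory\<close>

lemma tup_simps [simp]: "tup \<sigma> 0 = Var 0" "tup \<sigma> (Suc n) = tren Suc (\<sigma> n)"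
  "tup \<sigma> (numeral k) = tren Suc (\<sigma> (pred_numeral k))"
  by (simp_all add: tup_def numeral_eq_Suc)

lemma tren_tren: "tren f (tren g t) = tren (\<lambda>n. f (g n)) t"
  by (induction t arbitrary: f g) simp_all

lemma tren_id [simp]: "tren (\<lambda>n. n) t = t"
  by (induction t) simp_all

lemma tup_var: "tup (\<lambda>n. Var (f n)) = (\<lambda>n. Var (up f n))"
  by (rule ext) (simp add: tup_def up_def split: nat.split)

lemma tren_as_tsub: "tren f t = tsub (\<lambda>n. Var (f n)) t"
  by (induction t arbitrary: f) (simp_all add: tup_var)

lemma tup_up: "tup \<sigma> (up f n) = tup (\<lambda>n. \<sigma> (f n)) n"
  by (cases n) simp_all

lemma tsub_tren: "tsub \<sigma> (tren f t) = tsub (\<lambda>n. \<sigma> (f n)) t"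
  by (induction t arbitrary: \<sigma> f) (simp_all add: tup_up)

lemma tren_tup: "tren (up f) (tup \<sigma> n) = tup (\<lambda>n. tren f (\<sigma> n)) n"
  by (cases n) (simp_all add: tren_tren)

lemma tren_tsub: "tren f (tsub \<sigma> t) = tsub (\<lambda>n. tren f (\<sigma> n)) t"
  by (induction t arbitrary: \<sigma> f) (simp_all add: tren_tup)

lemma tsub_tup: "tsub (tup \<sigma>) (tup \<tau> n) = tup (\<lambda>n. tsub \<sigma> (\<tau> n)) n"
  by (cases n) (simp_all add: tsub_tren tren_tsub)

lemma tsub_tsub: "tsub \<sigma> (tsub \<tau> t) = tsub (\<lambda>n. tsub \<sigma> (\<tau> n)) t"
  by (induction t arbitrary: \<sigma> \<tau>) (simp_all add: tsub_tup)

lemma tsub_var [simp]: "tsub Var t = t"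
  using tren_as_tsub[of "\<lambda>n. n" t] by simp

lemma tyren_tyren: "tyren f (tyren g A) = tyren (\<lambda>n. f (g n)) A"
  by (induction A arbitrary: f g) (simp_all add: tren_tren)

lemma tysub_tyren: "tysub \<sigma> (tyren f A) = tysub (\<lambda>n. \<sigma> (f n)) A"
  by (induction A arbitrary: \<sigma> f) (simp_all add: tsub_tren tup_up)

lemma tyren_tysub: "tyren f (tysub \<sigma> A) = tysub (\<lambda>n. tren f (\<sigma> n)) A"
  by (induction A arbitrary: \<sigma> f) (simp_all add: tren_tsub tren_tup)

definition tcons :: "ttm \<Rightarrow> (nat \<Rightarrow> ttm) \<Rightarrow> nat \<Rightarrow> ttm" where
  "tcons t \<sigma> = case_nat t \<sigma>"

lemma tcons_simps [simp]:
  "tcons t \<sigma> 0 = t" "tcons t \<sigma> (Suc n) = \<sigma> n"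
  "tcons t \<sigma> (numeral k) = \<sigma> (pred_numeral k)"
  "tcons t \<sigma> (up f n) = tcons t (\<lambda>n. \<sigma> (f n)) n"
  "tsub \<tau> (tcons t \<sigma> n) = tcons (tsub \<tau> t) (\<lambda>n. tsub \<tau> (\<sigma> n)) n"
  "tren f (tcons t \<sigma> n) = tcons (tren f t) (\<lambda>n. tren f (\<sigma> n)) n"
  by (simp_all add: tcons_def numeral_eq_Suc up_def split: nat.split)

lemma tinst_tcons: "tinst t b = tsub (tcons t Var) b"
  by (simp add: tinst_def tcons_def)

lemma tyinst_tcons: "tyinst t B = tysub (tcons t Var) B"
  by (simp add: tyinst_def tcons_def)

lemma tcons_var [simp]: "tcons (Var 0) (\<lambda>n. Var (Suc (f n))) = (\<lambda>n. Var (up f n))"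
  by (rule ext) (simp add: tcons_def up_def split: nat.split)

text \<open>Serves the elimination of dependent sums, where the first component is variable 1 under
  two declarations.\<close>

lemma tcons_var1 [simp]: "tcons (Var (Suc 0)) (\<lambda>n. Var (Suc (Suc (f n)))) = (\<lambda>n. Var (Suc (up f n)))"
  by (rule ext) (simp add: tcons_def up_def split: nat.split)

lemma tren_tinst: "tren f (tinst t b) = tinst (tren f t) (tren (up f) b)"
  by (simp add: tinst_tcons tren_tsub tsub_tren)

lemma tyren_tyinst: "tyren f (tyinst t B) = tyinst (tren f t) (tyren (up f) B)"
  by (simp add: tyinst_tcons tyren_tysub tysub_tyren)

lemma tinst_tren_Suc [simp]: "tinst t (tren Suc b) = b"
  by (simp add: tinst_tcons tsub_tren)

section \<open>Derivability in CTT and the admissibility of renaming\<close>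

lemma derives_mono: "derives R J \<Longrightarrow> R \<subseteq> R' \<Longrightarrow> derives R' J"
  by (induction rule: derives.induct) (meson derives.intros subsetD)

abbreviation der :: "judg \<Rightarrow> bool" where
  "der \<equiv> derives CTT"

lemma der_LF: "(Js, J) \<in> LF \<Longrightarrow> \<forall>J' \<in> set Js. der J' \<Longrightarrow> der J"
  by (rule derives.intros[of Js]) (auto simp: CTT_def)

lemmas CtxCons' = der_LF[OF CtxCons, simplified, OF conjI]
  and TyRefl' = der_LF[OF TyRefl, simplified]
  and TySym' = der_LF[OF TySym, simplified]
  and TyTrans' = der_LF[OF TyTrans, simplified]
  and TmRefl' = der_LF[OF TmRefl, simplified]
  and TmSym' = der_LF[OF TmSym, simplified]
  and TmTrans' = der_LF[OF TmTrans, simplified]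
  and TmConv' = der_LF[OF TmConv, simplified, OF conjI]
  and EqConv' = der_LF[OF EqConv, simplified, OF conjI]
  and Assm' = der_LF[OF Assm, simplified]
  and SetF' = der_LF[OF SetF, simplified]
  and ElF' = der_LF[OF ElF, simplified]
  and ElEq' = der_LF[OF ElEq, simplified]
  and FunF' = der_LF[OF FunF, simplified, OF conjI]
  and FunEq' = der_LF[OF FunEq, simplified, OF conjI]
  and LamI' = der_LF[OF LamI, simplified, OF conjI]
  and LamEq' = der_LF[OF LamEq, simplified, OF conjI]
  and AppE' = der_LF[OF AppE, simplified, OF conjI]
  and AppEq' = der_LF[OF AppEq, simplified, OF conjI]
  and Beta' = der_LF[OF Beta, simplified, OF conjI]
  and Eta' = der_LF[OF Eta, simplified]

lemma CtxNil': "der (Ctx [])"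
  by (rule der_LF[OF CtxNil]) simp

lemmas tunfold = tvar_def tcst_def tapp_def tlam_def tset_def tel_def tfun_def tarrow_def tall_def tex_def
  tand_def tor_def timpl_def tnot_def tfam_def numeral_eq_Suc

lemma ctt_constants_closed: "(c, A) \<in> ctt_constants \<Longrightarrow> tyren f (A 0) = A 0"
  unfolding ctt_constants_def by (auto simp: tunfold)

lemma ctt_equations_closed:
  "(s, t, A) \<in> ctt_equations \<Longrightarrow> tren f (s 0) = s 0 \<and> tren f (t 0) = t 0 \<and> tyren f (A 0) = A 0"
  unfolding ctt_equations_def by (auto simp: tunfold)

primrec jctx :: "judg \<Rightarrow> tty list" where
  "jctx (Ctx G) = G"
| "jctx (IsTy G A) = G"
| "jctx (EqTy G A B) = G"
| "jctx (HasTy G a A) = G"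
| "jctx (EqTm G a b A) = G"

primrec jren :: "(nat \<Rightarrow> nat) \<Rightarrow> tty list \<Rightarrow> judg \<Rightarrow> judg" where
  "jren f E (Ctx G) = Ctx E"
| "jren f E (IsTy G A) = IsTy E (tyren f A)"
| "jren f E (EqTy G A B) = EqTy E (tyren f A) (tyren f B)"
| "jren f E (HasTy G a A) = HasTy E (tren f a) (tyren f A)"
| "jren f E (EqTm G a b A) = EqTm E (tren f a) (tren f b) (tyren f A)"

text \<open>A declared type may mention earlier variables. Both types are therefore compared after
  being brought to their full contexts, as in the rule \<open>Assm\<close>.\<close>

definition trenames :: "(nat \<Rightarrow> nat) \<Rightarrow> tty list \<Rightarrow> tty list \<Rightarrow> bool" where
  "trenames f G E \<longleftrightarrow> (\<forall>n < length G. f n < length E \<and>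
     tyren (\<lambda>m. m + Suc (f n)) (E ! f n) = tyren (\<lambda>m. f (m + Suc n)) (G ! n))"

lemma trenames_up:
  assumes "trenames f G E"
  shows "trenames (up f) (A # G) (tyren f A # E)"
  unfolding trenames_def
proof (intro allI impI)
  fix n
  assume n: "n < length (A # G)"
  show "up f n < length (tyren f A # E) \<and>
     tyren (\<lambda>m. m + Suc (up f n)) ((tyren f A # E) ! up f n) = tyren (\<lambda>m. up f (m + Suc n)) ((A # G) ! n)"
  proof (cases n)
    case 0
    then show ?thesis by (simp add: tyren_tyren)
  next
    case (Suc k)
    with n assms have "f k < length E"
      "tyren (\<lambda>m. m + Suc (f k)) (E ! f k) = tyren (\<lambda>m. f (m + Suc k)) (G ! k)"
      by (auto simp: trenames_def)
    from this(1) arg_cong[OF this(2), of "tyren Suc"] show ?thesis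
      by (simp add: Suc tyren_tyren)
  qed
qed

text \<open>Renaming is admissible in \<open>CTT\<close>.  The two extra invariants supply the well-formedness of the
  extended contexts in the rules whose premises do not mention it, such as \<open>FunEq\<close> and \<open>Beta\<close>.\<close>

definition rename_ok :: "judg \<Rightarrow> bool" where
  "rename_ok J \<longleftrightarrow> (\<forall>f E. trenames f (jctx J) E \<longrightarrow> der (Ctx E) \<longrightarrow> der (jren f E J))"

definition ctx_ok :: "tty list \<Rightarrow> bool" where
  "ctx_ok G \<longleftrightarrow> der (Ctx G) \<and> (\<forall>A G' f E. G = A # G' \<longrightarrow> trenames f G' E \<longrightarrow> der (Ctx E) \<longrightarrow> der (IsTy E (tyren f A)))"

lemma rename_okD: "rename_ok J \<Longrightarrow> trenames f (jctx J) E \<Longrightarrow> der (Ctx E) \<Longrightarrow> der (jren f E J)"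
  by (auto simp: rename_ok_def)

text \<open>Going under a binder requires the renamed context to be well formed when extended by the
  renamed domain; \<open>ctx_ok\<close> of the premise supplies the formation of that
  domain.\<close>

lemma rename_ok_under:
  assumes "rename_ok J" "jctx J = A # G" "ctx_ok (A # G)" "trenames f G E" "der (Ctx E)"
  shows "der (jren (up f) (tyren f A # E) J)"
  using assms trenames_up[OF assms(4), of A] CtxCons'[of E "tyren f A"]
  by (auto simp: rename_ok_def ctx_ok_def)

lemma rename_LF:
  assumes "(Js, J) \<in> LF" "\<forall>J' \<in> set Js. der J' \<and> rename_ok J' \<and> ctx_ok (jctx J')"
  shows "rename_ok J \<and> ctx_ok (jctx J)"
  using assms
proof (induction Js J rule: LF.induct)
  case CtxNil
  then show ?case by (auto simp: rename_ok_def ctx_ok_def CtxNil')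
next
  case (CtxCons G A)
  then show ?case
    by (auto simp: rename_ok_def ctx_ok_def intro: CtxCons')
next
  case (Assm n G)
  then show ?case
    using Assm'[of "f n" E for f E]
    by (auto simp: rename_ok_def trenames_def tyren_tyren) (metis Assm')
next
  case (FunF G A B)
  then have "der (IsTy E (tyren f (TFun A B)))" if "trenames f G E" "der (Ctx E)" for f E
    using that rename_ok_under[of "IsTy (A # G) B" A G f E] by (auto dest: rename_okD intro!: FunF')
  with FunF show ?case by (simp add: rename_ok_def)
next
  case (FunEq G A A' B B')
  then have "der (EqTy E (tyren f (TFun A B)) (tyren f (TFun A' B')))" if "trenames f G E" "der (Ctx E)" for f E
    using that rename_ok_under[of "EqTy (A # G) B B'" A G f E] by (auto dest: rename_okD intro!: FunEq')
  with FunEq show ?case by (simp add: rename_ok_def)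
next
  case (LamI G A b B)
  then have "der (HasTy E (tren f (Lam b)) (tyren f (TFun A B)))" if "trenames f G E" "der (Ctx E)" for f E
    using that rename_ok_under[of "HasTy (A # G) b B" A G f E] by (auto dest: rename_okD intro!: LamI')
  with LamI show ?case by (simp add: rename_ok_def)
next
  case (LamEq G A b b' B)
  then have "der (EqTm E (tren f (Lam b)) (tren f (Lam b')) (tyren f (TFun A B)))" if "trenames f G E"
    "der (Ctx E)" for f E
    using that rename_ok_under[of "EqTm (A # G) b b' B" A G f E] by (auto dest: rename_okD intro!: LamEq')
  with LamEq show ?case by (simp add: rename_ok_def)
next
  case (Beta A G b B a)
  then have "der (jren f E (EqTm G (App (Lam b) a) (tinst a b) (tyinst a B)))" if "trenames f G E" "der
    (Ctx E)" for f E
    using that rename_ok_under[of "HasTy (A # G) b B" A G f E] rename_okD[of "HasTy G a A" f E]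
      Beta'[of "tyren f A" E "tren (up f) b" "tyren (up f) B" "tren f a"]
    by (simp add: tren_tinst tyren_tyinst)
  with Beta show ?case by (simp add: rename_ok_def)
next
  case (Eta G g A B)
  then have "der (jren f E (EqTm G (Lam (App (tren Suc g) (Var 0))) g (TFun A B)))" if "trenames f G E"
    "der (Ctx E)" for f E
    using that Eta'[of E "tren f g" "tyren f A" "tyren (up f) B"]
      rename_okD[of "HasTy G g (TFun A B)" f E] by (simp add: tren_tren)
  with Eta show ?case by (simp add: rename_ok_def)
next
  case (AppE G g A B a)
  then have "der (jren f E (HasTy G (App g a) (tyinst a B)))" if "trenames f G E" "der (Ctx E)" for f E
    using that AppE'[of E "tren f g" "tyren f A" "tyren (up f) B" "tren f a"]
      rename_okD[of "HasTy G g (TFun A B)" f E] rename_okD[of "HasTy G a A" f E] by (simp add: tyren_tyinst)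
  with AppE show ?case by (simp add: rename_ok_def)
next
  case (AppEq G g g' A B a a')
  then have "der (jren f E (EqTm G (App g a) (App g' a') (tyinst a B)))" if "trenames f G E" "der (Ctx
    E)" for f E
    using that AppEq'[of E "tren f g" "tren f g'" "tyren f A" "tyren (up f) B" "tren f a" "tren f a'"]
      rename_okD[of "EqTm G g g' (TFun A B)" f E] rename_okD[of "EqTm G a a' A" f E] by (simp add: tyren_tyinst)
  with AppEq show ?case by (simp add: rename_ok_def)
next
  case (TyTrans G A B C)
  then show ?case by (auto simp: rename_ok_def) (meson TyTrans')
next
  case (TmTrans G a b A c)
  then show ?case by (auto simp: rename_ok_def) (meson TmTrans')
next
  case (TmConv G a A B)
  then show ?case by (auto simp: rename_ok_def) (meson TmConv')
next
  case (EqConv G a b A B)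
  then show ?case by (auto simp: rename_ok_def) (meson EqConv')
qed (simp_all add: rename_ok_def TyRefl' TySym' TmRefl' TmSym' SetF' ElF' ElEq')

lemma rename_CTT: "der J \<Longrightarrow> rename_ok J \<and> ctx_ok (jctx J)"
proof (induction rule: derives.induct)
  case (1 Js J)
  then consider "(Js, J) \<in> LF"
    | G c A where "Js = [Ctx G]" "J = HasTy G (Cst c) (A 0)" "(c, A) \<in> ctt_constants"
    | G s t A where "Js = [Ctx G]" "J = EqTm G (s 0) (t 0) (A 0)" "(s, t, A) \<in> ctt_equations"
    unfolding CTT_def by auto
  then show ?case
  proof cases
    case 1
    with "1.IH" show ?thesis by (intro rename_LF) auto
  next
    case 2
    \<comment> \<open>Constants have closed types, so the renamed judgement is the same rule in the
      target context; the computation rules behave likewise.\<close>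
    have "der (HasTy E (Cst c) (A 0))" if "der (Ctx E)" for E
      by (rule derives.intros[of "[Ctx E]"]) (use 2 that in \<open>auto simp: CTT_def\<close>)
    with 2 "1.IH" show ?thesis
      by (simp add: rename_ok_def ctt_constants_closed)
  next
    case 3
    have "der (EqTm E (s 0) (t 0) (A 0))" if "der (Ctx E)" for E
      by (rule derives.intros[of "[Ctx E]"]) (use 3 that in \<open>auto simp: CTT_def\<close>)
    with 3 "1.IH" show ?thesis
      by (simp add: rename_ok_def ctt_equations_closed)
  qed
qed

text \<open>Well-formedness of the context is the first half of \<open>ctx_ok\<close>, which the
  renaming induction establishes along the way.\<close>

lemma der_Ctx: "der J \<Longrightarrow> der (Ctx (jctx J))"
  by (simp add: rename_CTT ctx_ok_def[of "jctx J"] conjunct1[OF iffD1[OF ctx_ok_def conjunct2[OF rename_CTT]]])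

lemma der_shift:
  assumes "der J" "der (Ctx (A # jctx J))"
  shows "der (jren Suc (A # jctx J) J)"
proof -
  have "trenames Suc (jctx J) (A # jctx J)"
    by (simp add: trenames_def)
  with assms rename_CTT[OF assms(1)] show ?thesis
    by (simp add: rename_ok_def)
qed

section \<open>Sets as propositions, with proof terms hidden\<close>

lemma HasTy_shift: "der (HasTy G t B) \<Longrightarrow> der (Ctx (A # G)) \<Longrightarrow> der (HasTy (A # G) (tren Suc t) (tyren Suc B))"
  using der_shift[of "HasTy G t B"] by simp

lemma HasTy_Var0: "der (Ctx (A # G)) \<Longrightarrow> der (HasTy (A # G) (Var 0) (tyren Suc A))"
  using Assm'[of 0 "A # G"] by simp

lemma HasTy_App:
  "der (HasTy G f (TFun A B)) \<Longrightarrow> der (HasTy G a A) \<Longrightarrow> tyinst a B = C \<Longrightarrow> der (HasTy G (App f a) C)"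
  using AppE' by blast

lemma der_const: "(c, B) \<in> (\<lambda>(c, A). (c, A 0)) ` ctt_constants \<Longrightarrow> der (Ctx G) \<Longrightarrow> der (HasTy G (Cst c) B)"
  by (rule derives.intros[of "[Ctx G]"]) (auto simp: CTT_def)

text \<open>The family is kept as an open term \<open>b\<close>. Its instances are then computed by
  \<open>tinst\<close>, and redexes \<open>App (Lam b) a\<close> occur only where a constant of the
  theory demands them.\<close>

definition TSg :: "ttm \<Rightarrow> ttm \<Rightarrow> ttm" where
  "TSg A b = App (App (Cst Sigma) A) (Lam b)"

definition TPi :: "ttm \<Rightarrow> ttm \<Rightarrow> ttm" where
  "TPi A b = App (App (Cst Pi) A) (Lam b)"

definition TOr :: "ttm \<Rightarrow> ttm \<Rightarrow> ttm" where
  "TOr A B = App (App (Cst Plus) A) B"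

abbreviation TAnd :: "ttm \<Rightarrow> ttm \<Rightarrow> ttm" where
  "TAnd A B \<equiv> TSg A (tren Suc B)"

abbreviation TImp :: "ttm \<Rightarrow> ttm \<Rightarrow> ttm" where
  "TImp A B \<equiv> TPi A (tren Suc B)"

abbreviation TNot :: "ttm \<Rightarrow> ttm" where
  "TNot A \<equiv> TImp A (Cst N0)"

definition wt :: "tty list \<Rightarrow> ttm \<Rightarrow> bool" where
  "wt G A \<longleftrightarrow> der (HasTy G A TSet)"

definition el :: "tty list \<Rightarrow> ttm \<Rightarrow> ttm \<Rightarrow> bool" where
  "el G A a \<longleftrightarrow> der (HasTy G a (TEl A))"

text \<open>Propositions are sets, so hiding the proof term turns \<open>CTT\<close> into a deductive system like the
  previous two.\<close>

definition tprov :: "tty list \<Rightarrow> ttm \<Rightarrow> bool" where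
  "tprov G P \<longleftrightarrow> (\<exists>t. el G P t)"

lemma tren_TSg [simp]: "tren f (TSg A b) = TSg (tren f A) (tren (up f) b)"
  and tren_TPi [simp]: "tren f (TPi A b) = TPi (tren f A) (tren (up f) b)"
  and tren_TOr [simp]: "tren f (TOr A B) = TOr (tren f A) (tren f B)"
  and tsub_TSg [simp]: "tsub \<sigma> (TSg A b) = TSg (tsub \<sigma> A) (tsub (tup \<sigma>) b)"
  and tsub_TPi [simp]: "tsub \<sigma> (TPi A b) = TPi (tsub \<sigma> A) (tsub (tup \<sigma>) b)"
  and tsub_TOr [simp]: "tsub \<sigma> (TOr A B) = TOr (tsub \<sigma> A) (tsub \<sigma> B)"
  by (simp_all add: TSg_def TPi_def TOr_def)

lemma Ctx_El: "wt G A \<Longrightarrow> der (Ctx (TEl A # G))"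
  unfolding wt_def using der_Ctx[of "HasTy G A TSet"] by (auto intro!: CtxCons' ElF')

lemma wt_Ctx: "wt G A \<Longrightarrow> der (Ctx G)"
  unfolding wt_def using der_Ctx[of "HasTy G A TSet"] by simp

lemma wt_shift: "wt G P \<Longrightarrow> der (Ctx (A # G)) \<Longrightarrow> wt (A # G) (tren Suc P)"
  unfolding wt_def using HasTy_shift[of G P TSet] by simp

lemma el_shift: "el G P t \<Longrightarrow> der (Ctx (A # G)) \<Longrightarrow> el (A # G) (tren Suc P) (tren Suc t)"
  unfolding el_def using HasTy_shift[of G t "TEl P"] by simp

lemma tprov_shift: "tprov G P \<Longrightarrow> der (Ctx (A # G)) \<Longrightarrow> tprov (A # G) (tren Suc P)"
  unfolding tprov_def using el_shift by blast

lemma el_Var0: "wt G A \<Longrightarrow> el (TEl A # G) (tren Suc A) (Var 0)"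
  unfolding el_def using HasTy_Var0[OF Ctx_El] by simp

lemma tprov_hyp: "wt G A \<Longrightarrow> tprov (TEl A # G) (tren Suc A)"
  unfolding tprov_def using el_Var0 by blast

lemma wt_shift_under:
  assumes "wt (B # G) b" "der (Ctx (A # G))"
  shows "wt (tyren Suc B # A # G) (tren (up Suc) b)"
proof -
  have "trenames Suc G (A # G)"
    by (simp add: trenames_def)
  with rename_ok_under[of "HasTy (B # G) b TSet" B G Suc "A # G"] assms rename_CTT[of "HasTy (B # G) b TSet"]
  show ?thesis by (simp add: wt_def)
qed

lemma fam_Lam: "wt G A \<Longrightarrow> wt (TEl A # G) b \<Longrightarrow> der (HasTy G (Lam b) (TFun (TEl A) TSet))"
  unfolding wt_def by (intro LamI' ElF')

lemma beta_EqTm: "wt (TEl A # G) b \<Longrightarrow> el G A a \<Longrightarrow> der (EqTm G (App (Lam b) a) (tinst a b) TSet)"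
  unfolding wt_def el_def using Beta'[of "TEl A" G b TSet a] by (simp add: tyinst_tcons)

text \<open>Equal sets have the same elements, so a proof term can be moved across a beta step in
  both directions unchanged.\<close>

lemma el_beta: "wt (TEl A # G) b \<Longrightarrow> el G A a \<Longrightarrow> el G (App (Lam b) a) t \<longleftrightarrow> el G (tinst a b) t"
  using beta_EqTm[of A G b a] unfolding el_def by (meson TmConv' ElEq' TmSym')

lemma tprov_beta: "wt (TEl A # G) b \<Longrightarrow> el G A a \<Longrightarrow> tprov G (App (Lam b) a) \<longleftrightarrow> tprov G (tinst a b)"
  unfolding tprov_def using el_beta by blast

text \<open>The case of a constant family. The motives of the eliminators below have this form,
  since a conclusion never depends on the eliminated element.\<close>

lemma el_beta_const: "wt G A \<Longrightarrow> wt G D \<Longrightarrow> el G A a \<Longrightarrow> el G (App (Lam (tren Suc D)) a) t \<longleftrightarrow> el G D t"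
  using el_beta[of A G "tren Suc D" a t] wt_shift[OF _ Ctx_El] by simp

lemma wt_TSg: "wt G A \<Longrightarrow> wt (TEl A # G) b \<Longrightarrow> wt G (TSg A b)"
  unfolding TSg_def wt_def
  by (rule HasTy_App[OF HasTy_App[OF der_const[of Sigma "TFun TSet (TFun (TFun (TEl (Var 0)) TSet)
    TSet)"]] fam_Lam])
    (auto simp: ctt_constants_def tunfold tyinst_tcons wt_def dest: wt_Ctx[unfolded wt_def])

lemma wt_TPi: "wt G A \<Longrightarrow> wt (TEl A # G) b \<Longrightarrow> wt G (TPi A b)"
  unfolding TPi_def wt_def
  by (rule HasTy_App[OF HasTy_App[OF der_const[of Pi "TFun TSet (TFun (TFun (TEl (Var 0)) TSet) TSet)"]]
    fam_Lam])
    (auto simp: ctt_constants_def tunfold tyinst_tcons wt_def dest: wt_Ctx[unfolded wt_def])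

lemma wt_TOr: "wt G A \<Longrightarrow> wt G B \<Longrightarrow> wt G (TOr A B)"
  unfolding TOr_def wt_def
  by (rule HasTy_App[OF HasTy_App[OF der_const[of Plus "TFun TSet (TFun TSet TSet)"]]])
    (auto simp: ctt_constants_def tunfold tyinst_tcons wt_def dest: wt_Ctx[unfolded wt_def])

lemma wt_N0: "der (Ctx G) \<Longrightarrow> wt G (Cst N0)"
  unfolding wt_def by (rule der_const) (simp_all add: ctt_constants_def tunfold)

lemma wt_TAnd: "wt G A \<Longrightarrow> wt G B \<Longrightarrow> wt G (TAnd A B)"
  by (intro wt_TSg wt_shift Ctx_El)

lemma wt_TImp: "wt G A \<Longrightarrow> wt G B \<Longrightarrow> wt G (TImp A B)"
  by (intro wt_TPi wt_shift Ctx_El)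

text \<open>Renamings are turned into substitutions, so that the types arising from repeated
  application reach a common normal form.\<close>

lemmas tinst_simps = tyinst_tcons tinst_tcons tren_as_tsub tsub_tsub numeral_eq_Suc
  tcons_simps tup_simps up_simps tsub.simps tysub.simps tcons_var tcons_var1 tsub_var pred_numeral_simps
  Num.BitM.simps One_nat_def tup_var up_comp up_id tup_up tsub_tup

text \<open>The constant is applied to one argument at a time, and the resulting type is normalised
  after each; the other introduction and elimination rules follow the same pattern. The proof of the
  instance of \<open>b\<close> is converted because the constant expects a redex.\<close>

lemma el_Pair:
  assumes A: "wt G A" and b: "wt (TEl A # G) b" and a: "el G A a" and p: "el G (tinst a b) p"
  shows "el G (TSg A b) (App (App (App (App (Cst Pair) A) (Lam b)) a) p)"
proof -
  have p': "der (HasTy G p (TEl (App (Lam b) a)))"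
    using el_beta[OF b a] p by (simp add: el_def)
  have c: "der (HasTy G (Cst Pair) (TFun TSet (TFun (TFun (TEl (Var 0)) TSet) (TFun (TEl (Var 1))
     (TFun (TEl (App (Var 1) (Var 0))) (TEl (App (App (Cst Sigma) (Var 3)) (Var 2))))))))"
    by (rule der_const) (simp_all add: ctt_constants_def tunfold wt_Ctx[OF A])
  note 1 = AppE'[OF c A[unfolded wt_def], simplified tinst_simps]
  note 2 = AppE'[OF 1 fam_Lam[OF A b], simplified tinst_simps]
  note 3 = AppE'[OF 2 a[unfolded el_def], simplified tinst_simps]
  note 4 = AppE'[OF 3 p', simplified tinst_simps]
  show ?thesis
    using 4 by (simp add: el_def TSg_def tinst_simps)
qed

lemma tprov_exI: "wt G A \<Longrightarrow> wt (TEl A # G) b \<Longrightarrow> el G A a \<Longrightarrow> tprov G (tinst a b) \<Longrightarrow> tprov G (TSg A b)"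
  unfolding tprov_def using el_Pair by blast

lemma el_Lambda:
  assumes A: "wt G A" and b: "wt (TEl A # G) b" and t: "el (TEl A # G) b t"
  shows "el G (TPi A b) (App (App (App (Cst Lambda) A) (Lam b)) (Lam t))"
proof -
  note ctx = Ctx_El[OF A]
  \<comment> \<open>\<open>Lambda\<close> expects the body over the family applied to the new
    variable, so \<open>t\<close> is converted to that redex before it is abstracted.\<close>
  have "el (TEl A # G) (App (Lam (tren (up Suc) b)) (Var 0)) t"
    using el_beta[OF wt_shift_under[OF b ctx, simplified] el_Var0[OF A]] t by (simp add: tinst_simps)
  then have t': "der (HasTy G (Lam t) (TFun (TEl A) (TEl (App (Lam (tren (up Suc) b)) (Var 0)))))"
    using A by (intro LamI') (simp_all add: wt_def el_def ElF')
  have c: "der (HasTy G (Cst Lambda) (TFun TSet (TFun (TFun (TEl (Var 0)) TSet) (TFun (TFun (TEl (Var 1))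
    (TEl (App (Var 1) (Var 0))))
     (TEl (App (App (Cst Pi) (Var 2)) (Var 1)))))))"
    by (rule der_const) (simp_all add: ctt_constants_def tunfold wt_Ctx[OF A])
  note 1 = AppE'[OF c A[unfolded wt_def], simplified tinst_simps]
  note 2 = AppE'[OF 1 fam_Lam[OF A b], simplified tinst_simps]
  note 3 = AppE'[OF 2 t'[simplified tinst_simps], simplified tinst_simps]
  show ?thesis
    using 3 by (simp add: el_def TPi_def tinst_simps)
qed

lemma tprov_allI: "wt G A \<Longrightarrow> wt (TEl A # G) b \<Longrightarrow> tprov (TEl A # G) b \<Longrightarrow> tprov G (TPi A b)"
  unfolding tprov_def using el_Lambda by blast

lemma tprov_allE:
  assumes A: "wt G A" and b: "wt (TEl A # G) b" and p: "tprov G (TPi A b)" and a: "el G A a"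
  shows "tprov G (tinst a b)"
proof -
  from p obtain t where t: "der (HasTy G t (TEl (TPi A b)))"
    by (auto simp: tprov_def el_def)
  have c: "der (HasTy G (Cst Apply) (TFun TSet (TFun (TFun (TEl (Var 0)) TSet) (TFun (TEl (App (App (Cst
    Pi) (Var 1)) (Var 0)))
     (TFun (TEl (Var 2)) (TEl (App (Var 2) (Var 0))))))))"
    by (rule der_const) (simp_all add: ctt_constants_def tunfold wt_Ctx[OF A])
  note 1 = AppE'[OF c A[unfolded wt_def], simplified tinst_simps]
  note 2 = AppE'[OF 1 fam_Lam[OF A b], simplified tinst_simps]
  note 3 = AppE'[OF 2 t[unfolded TPi_def], simplified tinst_simps]
  note 4 = AppE'[OF 3 a[unfolded el_def], simplified tinst_simps]
  have "tprov G (App (Lam b) a)"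
    using 4 by (auto simp: tprov_def el_def tinst_simps)
  then show ?thesis
    by (simp add: tprov_beta[OF b a])
qed

text \<open>\<open>Split\<close> is used with the constant motive \<open>D\<close>. Its branch has
  to take an element of the redex \<open>App (Lam b) a\<close> and land in the motive applied to the
  pair, so the domain and the codomain of the branch are both converted by beta.\<close>

lemma tprov_exE:
  assumes A: "wt G A" and b: "wt (TEl A # G) b" and D: "wt G D"
    and p: "tprov G (TSg A b)" and e: "tprov (TEl b # TEl A # G) (tren Suc (tren Suc D))"
  shows "tprov G D"
proof -
  let ?G1 = "TEl A # G" and ?G2 = "TEl b # TEl A # G"
  let ?S = "TSg A b"
  note c1 = Ctx_El[OF A] and c2 = Ctx_El[OF b]
  from p obtain t where t: "der (HasTy G t (TEl ?S))"
    by (auto simp: tprov_def el_def)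
  from e obtain u where u: "el ?G2 (tren Suc (tren Suc D)) u"
    by (auto simp: tprov_def)
  have S: "wt G ?S"
    by (rule wt_TSg[OF A b])
  have b1: "wt (TEl (tren Suc A) # ?G1) (tren (up Suc) b)"
    using wt_shift_under[OF b c1] by simp
  have b2: "wt (TEl (tren Suc (tren Suc A)) # ?G2) (tren (up Suc) (tren (up Suc) b))"
    using wt_shift_under[OF b1 c2] by simp
  have A1: "wt ?G1 (tren Suc A)" and A2: "wt ?G2 (tren Suc (tren Suc A))"
    by (intro wt_shift A c1 c2)+
  have D2: "wt ?G2 (tren Suc (tren Suc D))" and S2: "wt ?G2 (tren Suc (tren Suc ?S))"
    by (intro wt_shift S D c1 c2)+
  \<comment> \<open>The generic pair: variable 1 is the element of \<open>A\<close>, variable 0 the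
    element of the family at it.\<close>
  let ?p = "App (App (App (App (Cst Pair) (tren Suc (tren Suc A))) (tren Suc (tren Suc (Lam b)))) (Var
    1)) (Var 0)"
  have v1: "el ?G2 (tren Suc (tren Suc A)) (Var 1)"
    using el_shift[OF el_Var0[OF A] c2] by simp
  have v0: "el ?G2 (tinst (Var 1) (tren (up Suc) (tren (up Suc) b))) (Var 0)"
    using el_Var0[OF b] by (simp add: tinst_simps)
  have pr: "el ?G2 (tren Suc (tren Suc ?S)) ?p"
    using el_Pair[OF A2 b2 v1 v0] by simp
  have "el ?G2 (App (Lam (tren Suc (tren Suc (tren Suc D)))) ?p) u"
    using el_beta_const[OF S2 D2 pr] u by simp
  then have "der (HasTy ?G1 (Lam u) (TFun (TEl b) (TEl (App (Lam (tren Suc (tren Suc (tren Suc D)))) ?p))))"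
    using b by (intro LamI') (simp_all add: wt_def el_def ElF')
  \<comment> \<open>Only the domain changes: \<open>b\<close> is equal to its own abstraction
    applied to the variable over which it is a family.\<close>
  moreover have "der (EqTy ?G1 (TFun (TEl b) (TEl (App (Lam (tren Suc (tren Suc (tren Suc D)))) ?p)))
      (TFun (TEl (App (tren Suc (Lam b)) (Var 0))) (TEl (App (Lam (tren Suc (tren Suc (tren Suc D)))) ?p))))"
  proof (rule FunEq')
    have "der (EqTm ?G1 (App (Lam (tren (up Suc) b)) (Var 0)) b TSet)"
      using beta_EqTm[OF b1 el_Var0[OF A]] by (simp add: tinst_simps)
    then show "der (EqTy ?G1 (TEl b) (TEl (App (tren Suc (Lam b)) (Var 0))))"
      by (auto intro: ElEq' TmSym')
    have "der (HasTy ?G2 (App (Lam (tren Suc (tren Suc (tren Suc D)))) ?p) TSet)"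
      by (rule HasTy_App[OF fam_Lam[OF S2 wt_shift[OF D2 Ctx_El[OF S2]]] pr[unfolded el_def]])
        (simp add: tinst_simps)
    then show "der (EqTy ?G2 (TEl (App (Lam (tren Suc (tren Suc (tren Suc D)))) ?p)) (TEl (App (Lam (tren
      Suc (tren Suc (tren Suc D)))) ?p)))"
      by (intro TyRefl' ElF')
  qed
  ultimately have "der (HasTy ?G1 (Lam u) (TFun (TEl (App (tren Suc (Lam b)) (Var 0))) (TEl (App (Lam
    (tren Suc (tren Suc (tren Suc D)))) ?p))))"
    by (rule TmConv')
  then have f: "der (HasTy G (Lam (Lam u)) (TFun (TEl A) (TFun (TEl (App (tren Suc (Lam b)) (Var 0)))
    (TEl (App (Lam (tren Suc (tren Suc (tren Suc D)))) ?p)))))"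
    by (rule LamI'[rotated]) (use A in \<open>simp_all add: wt_def ElF'\<close>)
  have c: "der (HasTy G (Cst Split) (TFun TSet (TFun (TFun (TEl (Var 0)) TSet) (TFun (TFun (TEl (App (App
    (Cst Sigma) (Var 1)) (Var 0))) TSet)
     (TFun (TFun (TEl (Var 2)) (TFun (TEl (App (Var 2) (Var 0))) (TEl (App (Var 2) (App (App (App (App
       (Cst Pair) (Var 4)) (Var 3)) (Var 1)) (Var 0))))))
     (TFun (TEl (App (App (Cst Sigma) (Var 3)) (Var 2))) (TEl (App (Var 2) (Var 0)))))))))"
    by (rule der_const) (simp_all add: ctt_constants_def tunfold wt_Ctx[OF A])
  note 1 = AppE'[OF c A[unfolded wt_def], simplified tinst_simps]
  note 2 = AppE'[OF 1 fam_Lam[OF A b], simplified tinst_simps]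
  note 3 = AppE'[OF 2 fam_Lam[OF S wt_shift[OF D Ctx_El[OF S]], unfolded TSg_def, simplified
    tinst_simps], simplified tinst_simps]
  note 4 = AppE'[OF 3 f[simplified tinst_simps tren.simps], simplified tinst_simps]
  note 5 = AppE'[OF 4 t[unfolded TSg_def, simplified tinst_simps], simplified tinst_simps]
  have "tprov G (App (Lam (tren Suc D)) t)"
    using 5 by (auto simp: tprov_def el_def tinst_simps)
  then show ?thesis
    using el_beta_const[OF S D, of t] t by (auto simp: tprov_def el_def)
qed

lemma el_Inl:
  assumes A: "wt G A" and B: "wt G B" and a: "el G A a"
  shows "el G (TOr A B) (App (App (App (Cst Inl) A) B) a)"
proof -
  have c: "der (HasTy G (Cst Inl) (TFun TSet (TFun TSet (TFun (TEl (Var 1)) (TEl (App (App (Cst Plus)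
    (Var 2)) (Var 1)))))))"
    by (rule der_const) (simp_all add: ctt_constants_def tunfold wt_Ctx[OF A])
  note 1 = AppE'[OF c A[unfolded wt_def], simplified tinst_simps]
  note 2 = AppE'[OF 1 B[unfolded wt_def], simplified tinst_simps]
  show ?thesis
    using AppE'[OF 2 a[unfolded el_def]] by (simp add: el_def TOr_def tinst_simps)
qed

lemma el_Inr:
  assumes A: "wt G A" and B: "wt G B" and b: "el G B b"
  shows "el G (TOr A B) (App (App (App (Cst Inr) A) B) b)"
proof -
  have c: "der (HasTy G (Cst Inr) (TFun TSet (TFun TSet (TFun (TEl (Var 0)) (TEl (App (App (Cst Plus)
    (Var 2)) (Var 1)))))))"
    by (rule der_const) (simp_all add: ctt_constants_def tunfold wt_Ctx[OF A])
  note 1 = AppE'[OF c A[unfolded wt_def], simplified tinst_simps]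
  note 2 = AppE'[OF 1 B[unfolded wt_def], simplified tinst_simps]
  show ?thesis
    using AppE'[OF 2 b[unfolded el_def]] by (simp add: el_def TOr_def tinst_simps)
qed

lemma tprov_orI: "wt G A \<Longrightarrow> wt G B \<Longrightarrow> tprov G A \<Longrightarrow> tprov G (TOr A B)"
    "wt G A \<Longrightarrow> wt G B \<Longrightarrow> tprov G B \<Longrightarrow> tprov G (TOr A B)"
  unfolding tprov_def using el_Inl el_Inr by blast+

text \<open>The eliminator of a disjoint union asks for a branch in the motive applied to the
  injection; for a constant motive this redex is convertible to \<open>D\<close>.\<close>

lemma when_branch:
  assumes A: "wt G A" and S: "wt G S" and D: "wt G D"
    and i: "el (TEl A # G) (tren Suc S) i" and u: "el (TEl A # G) (tren Suc D) u"
  shows "der (HasTy G (Lam u) (TFun (TEl A) (TEl (App (Lam (tren Suc (tren Suc D))) i))))"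
proof -
  note c = Ctx_El[OF A]
  have "el (TEl A # G) (App (Lam (tren Suc (tren Suc D))) i) u"
    using el_beta_const[OF wt_shift[OF S c] wt_shift[OF D c] i] u by simp
  then show ?thesis
    by (intro LamI') (use A in \<open>simp_all add: wt_def el_def ElF'\<close>)
qed

lemma tprov_orE:
  assumes A: "wt G A" and B: "wt G B" and D: "wt G D" and p: "tprov G (TOr A B)"
    and e: "tprov (TEl A # G) (tren Suc D)" "tprov (TEl B # G) (tren Suc D)"
  shows "tprov G D"
proof -
  note ctx = Ctx_El[OF A] Ctx_El[OF B]
  note S = wt_TOr[OF A B]
  note l = el_Inl[OF wt_shift[OF A ctx(1)] wt_shift[OF B ctx(1)] el_Var0[OF A]]
  note r = el_Inr[OF wt_shift[OF A ctx(2)] wt_shift[OF B ctx(2)] el_Var0[OF B]]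
  from p obtain t where t: "der (HasTy G t (TEl (TOr A B)))"
    by (auto simp: tprov_def el_def)
  from e obtain u v where u: "el (TEl A # G) (tren Suc D) u" and v: "el (TEl B # G) (tren Suc D) v"
    by (auto simp: tprov_def)
  have c: "der (HasTy G (Cst When) (TFun TSet (TFun TSet (TFun (TFun (TEl (App (App (Cst Plus) (Var 1))
    (Var 0))) TSet)
     (TFun (TFun (TEl (Var 2)) (TEl (App (Var 1) (App (App (App (Cst Inl) (Var 3)) (Var 2)) (Var 0)))))
     (TFun (TFun (TEl (Var 2)) (TEl (App (Var 2) (App (App (App (Cst Inr) (Var 4)) (Var 3)) (Var 0)))))
     (TFun (TEl (App (App (Cst Plus) (Var 4)) (Var 3))) (TEl (App (Var 3) (Var 0))))))))))"
    by (rule der_const) (simp_all add: ctt_constants_def tunfold wt_Ctx[OF A])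
  note 1 = AppE'[OF c A[unfolded wt_def], simplified tinst_simps]
  note 2 = AppE'[OF 1 B[unfolded wt_def], simplified tinst_simps]
  note 3 = AppE'[OF 2 fam_Lam[OF S wt_shift[OF D Ctx_El[OF S]], unfolded TOr_def, simplified
    tinst_simps], simplified tinst_simps]
  note 4 = AppE'[OF 3 when_branch[OF A S D l[folded tren_TOr] u, simplified tinst_simps], simplified
    tinst_simps]
  note 5 = AppE'[OF 4 when_branch[OF B S D r[folded tren_TOr] v, simplified tinst_simps], simplified
    tinst_simps]
  note 6 = AppE'[OF 5 t[unfolded TOr_def, simplified tinst_simps], simplified tinst_simps]
  have "tprov G (App (Lam (tren Suc D)) t)"
    using 6 by (auto simp: tprov_def el_def tinst_simps)
  then show ?thesis
    using el_beta_const[OF S D, of t] t by (auto simp: tprov_def el_def)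
qed

lemma tprov_N0E:
  assumes p: "tprov G (Cst N0)" and D: "wt G D"
  shows "tprov G D"
proof -
  from p obtain t where t: "der (HasTy G t (TEl (Cst N0)))"
    by (auto simp: tprov_def el_def)
  note N = wt_N0[OF wt_Ctx[OF D]]
  have c: "der (HasTy G (Cst N0case) (TFun (TFun (TEl (Cst N0)) TSet) (TFun (TEl (Cst N0)) (TEl (App (Var
    1) (Var 0))))))"
    by (rule der_const) (simp_all add: ctt_constants_def tunfold wt_Ctx[OF D])
  note 1 = AppE'[OF c fam_Lam[OF N wt_shift[OF D Ctx_El[OF N]], simplified tinst_simps], simplified tinst_simps]
  note 2 = AppE'[OF 1 t, simplified tinst_simps]
  have "tprov G (App (Lam (tren Suc D)) t)"
    using 2 by (auto simp: tprov_def el_def tinst_simps)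
  then show ?thesis
    using el_beta_const[OF N D, of t] t by (auto simp: tprov_def el_def)
qed

lemma tprov_andI:
  assumes "wt G A" "wt G B" "tprov G A" "tprov G B"
  shows "tprov G (TAnd A B)"
proof -
  from assms(3) obtain a where "el G A a"
    by (auto simp: tprov_def)
  from tprov_exI[OF assms(1) wt_shift[OF assms(2) Ctx_El[OF assms(1)]] this] assms(4) show ?thesis
    by simp
qed

lemma tprov_andE:
  assumes A: "wt G A" and B: "wt G B" and p: "tprov G (TAnd A B)"
  shows "tprov G A" "tprov G B"
proof -
  note B1 = wt_shift[OF B Ctx_El[OF A]]
  show "tprov G A"
    by (rule tprov_exE[OF A B1 A p]) (intro tprov_shift tprov_hyp A Ctx_El B1)
  show "tprov G B"
    by (rule tprov_exE[OF A B1 B p]) (rule tprov_hyp[OF B1])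
qed

lemma tprov_impI: "wt G A \<Longrightarrow> wt G B \<Longrightarrow> tprov (TEl A # G) (tren Suc B) \<Longrightarrow> tprov G (TImp A B)"
  by (intro tprov_allI wt_shift Ctx_El)

lemma tprov_impE:
  assumes "wt G A" "wt G B" "tprov G (TImp A B)" "tprov G A"
  shows "tprov G B"
proof -
  from assms(4) obtain a where "el G A a"
    by (auto simp: tprov_def)
  from tprov_allE[OF assms(1) wt_shift[OF assms(2) Ctx_El[OF assms(1)]] assms(3) this] show ?thesis
    by simp
qed

section \<open>Subsets, covers and pseudocomplements in type theory\<close>

abbreviation tshift :: "ttm \<Rightarrow> ttm" ("_\<up>" [1000] 1000) where
  "t\<up> \<equiv> tren Suc t"

definition CSing :: "ttm \<Rightarrow> ttm \<Rightarrow> ttm" where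
  "CSing S u = Lam (App (App (App (Cst Id) S\<up>) (Var 0)) u\<up>)"

definition CNull :: ttm where
  "CNull = Lam (Cst N0)"

definition CCup :: "ttm \<Rightarrow> ttm \<Rightarrow> ttm" where
  "CCup U V = Lam (TOr (App U\<up> (Var 0)) (App V\<up> (Var 0)))"

definition CNear :: "ttm \<Rightarrow> ttm \<Rightarrow> ttm \<Rightarrow> ttm \<Rightarrow> ttm" where
  "CNear S C U d = TSg S (TAnd (App U\<up> (Var 0)) (App (App C\<up> d\<up>) (CSing S\<up> (Var 0))))"

definition CDown :: "ttm \<Rightarrow> ttm \<Rightarrow> ttm \<Rightarrow> ttm \<Rightarrow> ttm" where
  "CDown S C U V = Lam (TAnd (CNear S\<up> C\<up> U\<up> (Var 0)) (CNear S\<up> C\<up> V\<up> (Var 0)))"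

definition CCovers :: "ttm \<Rightarrow> ttm \<Rightarrow> ttm \<Rightarrow> ttm \<Rightarrow> ttm" where
  "CCovers S C U V = TPi S (TImp (App U\<up> (Var 0)) (App (App C\<up> (Var 0)) V\<up>))"

definition CStar :: "ttm \<Rightarrow> ttm \<Rightarrow> ttm \<Rightarrow> ttm" where
  "CStar S C U = Lam (CCovers S\<up> C\<up> (CDown S\<up> C\<up> (CSing S\<up> (Var 0)) U\<up>) CNull)"

lemmas cdefs = CSing_def CNull_def CCup_def CNear_def CDown_def CCovers_def CStar_def

lemma tsub_C [simp]:
  "tsub \<sigma> (CSing S u) = CSing (tsub \<sigma> S) (tsub \<sigma> u)"
  "tsub \<sigma> CNull = CNull"
  "tsub \<sigma> (CCup U V) = CCup (tsub \<sigma> U) (tsub \<sigma> V)"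
  "tsub \<sigma> (CNear S C U u) = CNear (tsub \<sigma> S) (tsub \<sigma> C) (tsub \<sigma> U) (tsub \<sigma> u)"
  "tsub \<sigma> (CDown S C U V) = CDown (tsub \<sigma> S) (tsub \<sigma> C) (tsub \<sigma> U) (tsub \<sigma> V)"
  "tsub \<sigma> (CCovers S C U V) = CCovers (tsub \<sigma> S) (tsub \<sigma> C) (tsub \<sigma> U) (tsub \<sigma> V)"
  "tsub \<sigma> (CStar S C U) = CStar (tsub \<sigma> S) (tsub \<sigma> C) (tsub \<sigma> U)"
  by (simp_all add: cdefs tinst_simps)

lemma tren_C [simp]:
  "tren f (CSing S u) = CSing (tren f S) (tren f u)"
  "tren f CNull = CNull"
  "tren f (CCup U V) = CCup (tren f U) (tren f V)"
  "tren f (CNear S C U u) = CNear (tren f S) (tren f C) (tren f U) (tren f u)"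
  "tren f (CDown S C U V) = CDown (tren f S) (tren f C) (tren f U) (tren f V)"
  "tren f (CCovers S C U V) = CCovers (tren f S) (tren f C) (tren f U) (tren f V)"
  "tren f (CStar S C U) = CStar (tren f S) (tren f C) (tren f U)"
  by (simp_all add: tren_as_tsub)

definition fam :: "tty list \<Rightarrow> ttm \<Rightarrow> ttm \<Rightarrow> bool" where
  "fam G S U \<longleftrightarrow> der (HasTy G U (TFun (TEl S) TSet))"

definition sp :: "tty list \<Rightarrow> ttm \<Rightarrow> ttm \<Rightarrow> bool" where
  "sp G S C \<longleftrightarrow> wt G S \<and> der (HasTy G C (TFun (TEl S) (TFun (TFun (TEl S\<up>) TSet) TSet)))"

lemma fam_shift: "fam G S U \<Longrightarrow> der (Ctx (A # G)) \<Longrightarrow> fam (A # G) S\<up> U\<up>"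
  unfolding fam_def using HasTy_shift[of G U "TFun (TEl S) TSet"] by simp

lemma sp_shift: "sp G S C \<Longrightarrow> der (Ctx (A # G)) \<Longrightarrow> sp (A # G) S\<up> C\<up>"
  unfolding sp_def using HasTy_shift[of G C "TFun (TEl S) (TFun (TFun (TEl S\<up>) TSet) TSet)"]
  by (simp add: wt_shift tren_tren)

lemma sp_wt: "sp G S C \<Longrightarrow> wt G S"
  by (simp add: sp_def)

lemma fam_LamI: "wt G S \<Longrightarrow> wt (TEl S # G) b \<Longrightarrow> fam G S (Lam b)"
  unfolding fam_def by (rule fam_Lam)

lemma wt_App: "fam G S U \<Longrightarrow> el G S a \<Longrightarrow> wt G (App U a)"
  unfolding fam_def el_def wt_def by (erule HasTy_App) (simp_all add: tinst_simps)

lemma wt_App0: "wt G S \<Longrightarrow> fam G S U \<Longrightarrow> wt (TEl S # G) (App U\<up> (Var 0))"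
  by (intro wt_App[OF fam_shift el_Var0] Ctx_El)

lemma wt_cov: "sp G S C \<Longrightarrow> el G S a \<Longrightarrow> fam G S U \<Longrightarrow> wt G (App (App C a) U)"
  unfolding fam_def el_def wt_def sp_def
  by (rule HasTy_App[OF HasTy_App, of _ _ "TEl S" "TFun (TFun (TEl S\<up>) TSet) TSet" _ "TFun (TEl S) TSet" TSet])
    (simp_all add: tinst_simps)

lemma fam_CNull: "wt G S \<Longrightarrow> fam G S CNull"
  unfolding CNull_def by (intro fam_LamI wt_N0 Ctx_El)

lemma fam_CSing:
  assumes S: "wt G S" and u: "el G S u"
  shows "fam G S (CSing S u)"
  unfolding CSing_def
proof (rule fam_LamI[OF S])
  note ctx = Ctx_El[OF S]
  have c: "der (HasTy (TEl S # G) (Cst Id) (TFun TSet (TFun (TEl (Var 0)) (TFun (TEl (Var 1)) TSet))))"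
    by (rule der_const[OF _ ctx]) (simp_all add: ctt_constants_def tunfold)
  note 1 = AppE'[OF c wt_shift[OF S ctx, unfolded wt_def], simplified tinst_simps]
  note 2 = AppE'[OF 1 el_Var0[OF S, unfolded el_def, simplified tinst_simps], simplified tinst_simps]
  note 3 = AppE'[OF 2 el_shift[OF u ctx, unfolded el_def, simplified tinst_simps], simplified tinst_simps]
  show "wt (TEl S # G) (App (App (App (Cst Id) S\<up>) (Var 0)) u\<up>)"
    using 3 by (simp add: wt_def tinst_simps)
qed

lemma fam_CCup: "wt G S \<Longrightarrow> fam G S U \<Longrightarrow> fam G S V \<Longrightarrow> fam G S (CCup U V)"
  unfolding CCup_def by (intro fam_LamI wt_TOr wt_App0)

lemma wt_near_body:
  assumes "sp G S C" "el G S d"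
  shows "wt (TEl S # G) (App (App C\<up> d\<up>) (CSing S\<up> (Var 0)))"
proof -
  note S = sp_wt[OF assms(1)]
  note c = Ctx_El[OF S]
  show ?thesis
    by (rule wt_cov[OF sp_shift[OF assms(1) c] el_shift[OF assms(2) c] fam_CSing[OF wt_shift[OF S c]
      el_Var0[OF S]]])
qed

lemma wt_CNear: "sp G S C \<Longrightarrow> fam G S U \<Longrightarrow> el G S d \<Longrightarrow> wt G (CNear S C U d)"
  unfolding CNear_def by (intro wt_TSg wt_TAnd wt_near_body wt_App0 sp_wt)

lemma wt_CNear0: "sp G S C \<Longrightarrow> fam G S U \<Longrightarrow> wt (TEl S # G) (CNear S\<up> C\<up> U\<up> (Var 0))"
  by (intro wt_CNear sp_shift fam_shift el_Var0 Ctx_El sp_wt)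

lemma fam_CDown: "sp G S C \<Longrightarrow> fam G S U \<Longrightarrow> fam G S V \<Longrightarrow> fam G S (CDown S C U V)"
  unfolding CDown_def by (intro fam_LamI wt_TAnd wt_CNear0 sp_wt)

lemma wt_cov0:
  assumes "sp G S C" "fam G S V"
  shows "wt (TEl S # G) (App (App C\<up> (Var 0)) V\<up>)"
  using wt_cov[OF sp_shift[OF assms(1)] el_Var0[OF sp_wt[OF assms(1)]] fam_shift[OF assms(2)]]
    Ctx_El[OF sp_wt[OF assms(1)]] by simp

lemma wt_CCovers: "sp G S C \<Longrightarrow> fam G S U \<Longrightarrow> fam G S V \<Longrightarrow> wt G (CCovers S C U V)"
  unfolding CCovers_def by (intro wt_TPi wt_TImp wt_App0 wt_cov0 sp_wt)

lemma wt_star_body: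
  assumes "sp G S C" "fam G S U"
  shows "wt (TEl S # G) (CCovers S\<up> C\<up> (CDown S\<up> C\<up> (CSing S\<up> (Var 0)) U\<up>) CNull)"
proof -
  note S = sp_wt[OF assms(1)]
  note c = Ctx_El[OF S]
  show ?thesis
    by (intro wt_CCovers fam_CDown fam_CSing fam_CNull sp_shift fam_shift wt_shift el_Var0 assms S c)
qed

lemma fam_CStar: "sp G S C \<Longrightarrow> fam G S U \<Longrightarrow> fam G S (CStar S C U)"
  unfolding CStar_def by (intro fam_LamI wt_star_body sp_wt)

lemma CNull_iff: "wt G S \<Longrightarrow> el G S a \<Longrightarrow> tprov G (App CNull a) \<longleftrightarrow> tprov G (Cst N0)"
  unfolding CNull_def by (simp add: tprov_beta[OF wt_N0[OF Ctx_El]] tinst_simps)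

lemma CCup_iff:
  assumes "wt G S" "fam G S U" "fam G S V" "el G S a"
  shows "tprov G (App (CCup U V) a) \<longleftrightarrow> tprov G (TOr (App U a) (App V a))"
  unfolding CCup_def
  using tprov_beta[OF wt_TOr[OF wt_App0[OF assms(1,2)] wt_App0[OF assms(1,3)]] assms(4)]
  by (simp add: tinst_simps)

lemma CDown_iff:
  assumes "sp G S C" "fam G S U" "fam G S V" "el G S d"
  shows "tprov G (App (CDown S C U V) d) \<longleftrightarrow> tprov G (CNear S C U d) \<and> tprov G (CNear S C V d)"
proof -
  have "tprov G (App (CDown S C U V) d) \<longleftrightarrow> tprov G (TAnd (CNear S C U d) (CNear S C V d))"
    unfolding CDown_def
    using tprov_beta[OF wt_TAnd[OF wt_CNear0[OF assms(1,2)] wt_CNear0[OF assms(1,3)]] assms(4)]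
    by (simp add: tinst_simps)
  also have "\<dots> \<longleftrightarrow> tprov G (CNear S C U d) \<and> tprov G (CNear S C V d)"
    using assms by (blast intro: tprov_andI dest: tprov_andE[rotated 2] intro: wt_CNear)
  finally show ?thesis .
qed

lemma CStar_iff:
  assumes "sp G S C" "fam G S U" "el G S a"
  shows "tprov G (App (CStar S C U) a) \<longleftrightarrow> tprov G (CCovers S C (CDown S C (CSing S a) U) CNull)"
  unfolding CStar_def
  using tprov_beta[OF wt_star_body[OF assms(1,2)] assms(3)] by (simp add: tinst_simps)

lemma CNear_intro:
  assumes "sp G S C" "fam G S U" "el G S d" "el G S u"
    and "tprov G (App U u)" "tprov G (App (App C d) (CSing S u))"
  shows "tprov G (CNear S C U d)"
  unfolding CNear_def
proof (rule tprov_exI[OF sp_wt[OF assms(1)] _ assms(4)])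
  note S = sp_wt[OF assms(1)]
  show "wt (TEl S # G) (TAnd (App U\<up> (Var 0)) (App (App C\<up> d\<up>) (CSing S\<up> (Var 0))))"
    by (intro wt_TAnd wt_near_body wt_App0 S assms)
  have "tprov G (TAnd (App U u) (App (App C d) (CSing S u)))"
    by (intro tprov_andI wt_App[OF assms(2,4)] wt_cov[OF assms(1,3)] fam_CSing S assms)
  then show "tprov G (tinst u (TAnd (App U\<up> (Var 0)) (App (App C\<up> d\<up>) (CSing S\<up> (Var 0)))))"
    by (simp add: tinst_simps)
qed

text \<open>With contexts as Kripke worlds, \<open>ext f G E\<close> says that \<open>E\<close> is later than \<open>G\<close>.\<close>

definition ext :: "(nat \<Rightarrow> nat) \<Rightarrow> tty list \<Rightarrow> tty list \<Rightarrow> bool" where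
  "ext f G E \<longleftrightarrow> trenames f G E \<and> der (Ctx E)"

section \<open>Introduction and elimination rules over later contexts\<close>

lemma ext_trans:
  assumes "ext f G E" "ext g E E1"
  shows "ext (\<lambda>n. g (f n)) G E1"
proof -
  have "tyren (\<lambda>m. m + Suc (g (f n))) (E1 ! g (f n)) = tyren (\<lambda>m. g (f (m + Suc n))) (G ! n)"
    if n: "n < length G" for n
  proof -
    have f: "f n < length E" "tyren (\<lambda>m. m + Suc (f n)) (E ! f n) = tyren (\<lambda>m. f (m + Suc n)) (G ! n)"
      using assms(1) n by (auto simp: ext_def trenames_def)
    then have "tyren (\<lambda>m. m + Suc (g (f n))) (E1 ! g (f n)) = tyren (\<lambda>m. g (m + Suc (f n))) (E ! f n)"
      using assms(2) by (auto simp: ext_def trenames_def)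
    also have "\<dots> = tyren g (tyren (\<lambda>m. m + Suc (f n)) (E ! f n))"
      by (simp add: tyren_tyren)
    also have "\<dots> = tyren (\<lambda>m. g (f (m + Suc n))) (G ! n)"
      by (simp only: f(2) tyren_tyren)
    finally show ?thesis .
  qed
  with assms show ?thesis
    by (auto simp: ext_def trenames_def)
qed

lemma ext_Suc: "der (Ctx (A # G)) \<Longrightarrow> ext Suc G (A # G)"
  by (simp add: ext_def trenames_def)

lemma HasTy_ext: "der (HasTy G t B) \<Longrightarrow> ext f G E \<Longrightarrow> der (HasTy E (tren f t) (tyren f B))"
  using rename_okD[of "HasTy G t B" f E] rename_CTT[of "HasTy G t B"] by (simp add: ext_def)

lemma wt_ext: "wt G P \<Longrightarrow> ext f G E \<Longrightarrow> wt E (tren f P)"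
  unfolding wt_def using HasTy_ext[of G P TSet] by simp

lemma el_ext: "el G A a \<Longrightarrow> ext f G E \<Longrightarrow> el E (tren f A) (tren f a)"
  unfolding el_def using HasTy_ext[of G a "TEl A"] by simp

lemma tprov_ext: "tprov G P \<Longrightarrow> ext f G E \<Longrightarrow> tprov E (tren f P)"
  unfolding tprov_def using el_ext by blast

lemma fam_ext: "fam G A a \<Longrightarrow> ext f G E \<Longrightarrow> fam E (tren f A) (tren f a)"
  unfolding fam_def using HasTy_ext[of G a "TFun (TEl A) TSet"] by simp

lemma sp_ext: "sp G S C \<Longrightarrow> ext f G E \<Longrightarrow> sp E (tren f S) (tren f C)"
  unfolding sp_def using HasTy_ext[of G C "TFun (TEl S) (TFun (TFun (TEl S\<up>) TSet) TSet)" f E]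
  by (auto simp: tren_tren intro: wt_ext)

text \<open>Only the generic instance is used, the context extended by one variable taken as the
  element. Asking for all later contexts and elements lets the subsequent proofs name elements
  instead of counting indices; the three rules below work in the same way.\<close>

lemma tprov_all_intro:
  assumes "wt G A" "wt (TEl A # G) b"
    and "\<And>E f a. ext f G E \<Longrightarrow> el E (tren f A) a \<Longrightarrow> tprov E (tinst a (tren (up f) b))"
  shows "tprov G (TPi A b)"
  using assms(3)[OF ext_Suc[OF Ctx_El[OF assms(1)]] el_Var0[OF assms(1)]]
  by (intro tprov_allI[OF assms(1,2)]) (simp add: tinst_simps)

lemma tprov_imp_intro:
  assumes "wt G A" "wt G B" "\<And>E f. ext f G E \<Longrightarrow> tprov E (tren f A) \<Longrightarrow> tprov E (tren f B)"
  shows "tprov G (TImp A B)"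
  by (intro tprov_impI assms ext_Suc tprov_hyp Ctx_El)

lemma tprov_or_elim:
  assumes "wt G A" "wt G B" "wt G D" "tprov G (TOr A B)"
    and "\<And>E f. ext f G E \<Longrightarrow> tprov E (tren f A) \<Longrightarrow> tprov E (tren f D)"
    and "\<And>E f. ext f G E \<Longrightarrow> tprov E (tren f B) \<Longrightarrow> tprov E (tren f D)"
  shows "tprov G D"
  by (rule tprov_orE[OF assms(1-4)]) (intro assms ext_Suc tprov_hyp Ctx_El)+

lemma tprov_ex_elim:
  assumes A: "wt G A" and b: "wt (TEl A # G) b" and "wt G D" "tprov G (TSg A b)"
    and e: "\<And>E f a. ext f G E \<Longrightarrow> el E (tren f A) a \<Longrightarrow> tprov E (tinst a (tren (up f) b)) \<Longrightarrow> tprov E (tren f D)"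
  shows "tprov G D"
proof (rule tprov_exE[OF assms(1-4)])
  let ?E = "TEl b # TEl A # G"
  note c = Ctx_El[OF A] Ctx_El[OF b]
  have ext: "ext plus2 G ?E"
    by (rule ext_trans[OF ext_Suc ext_Suc]) (rule c)+
  have "el ?E (tren plus2 A) (Var 1)"
    using el_shift[OF el_Var0[OF A] c(2)] by (simp add: tren_tren)
  moreover have "tprov ?E (tinst (Var 1) (tren (up plus2) b))"
    using tprov_hyp[OF b] by (simp add: tinst_simps)
  ultimately show "tprov ?E D\<up>\<up>"
    using e[OF ext] by (simp add: tren_tren)
qed

lemma CNear_elim:
  assumes sp: "sp G S C" and U: "fam G S U" and d: "el G S d" and D: "wt G D"
    and p: "tprov G (CNear S C U d)"
    and e: "\<And>E f u. ext f G E \<Longrightarrow> el E (tren f S) u \<Longrightarrow> tprov E (App (tren f U) u)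
      \<Longrightarrow> tprov E (App (App (tren f C) (tren f d)) (CSing (tren f S) u)) \<Longrightarrow> tprov E (tren f D)"
  shows "tprov G D"
proof (rule tprov_ex_elim[OF sp_wt[OF sp] wt_TAnd[OF wt_App0[OF sp_wt[OF sp] U] wt_near_body[OF sp d]] D
  p[unfolded CNear_def]])
  fix E f u
  assume ext: "ext f G E" and u: "el E (tren f S) u"
    and h: "tprov E (tinst u (tren (up f) (TAnd (App U\<up> (Var 0)) (App (App C\<up> d\<up>) (CSing S\<up> (Var 0))))))"
  from h have h: "tprov E (TAnd (App (tren f U) u) (App (App (tren f C) (tren f d)) (CSing (tren f S) u)))"
    by (simp add: tinst_simps)
  note sp' = sp_ext[OF sp ext]
  have "wt E (App (tren f U) u)" "wt E (App (App (tren f C) (tren f d)) (CSing (tren f S) u))"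
    by (rule wt_App[OF fam_ext[OF U ext] u], rule wt_cov[OF sp' el_ext[OF d ext] fam_CSing[OF sp_wt[OF sp'] u]])
  from e[OF ext u tprov_andE[OF this h]] show "tprov E (tren f D)" .
qed

lemma CCovers_elim:
  assumes "sp G S C" "fam G S U" "fam G S V" "tprov G (CCovers S C U V)" "el G S a" "tprov G (App U a)"
  shows "tprov G (App (App C a) V)"
proof -
  note S = sp_wt[OF assms(1)]
  have "tprov G (TImp (App U a) (App (App C a) V))"
    using tprov_allE[OF S wt_TImp[OF wt_App0[OF S assms(2)] wt_cov0[OF assms(1,3)]] assms(4)[unfolded
      CCovers_def] assms(5)]
    by (simp add: tinst_simps)
  from tprov_impE[OF wt_App[OF assms(2,5)] wt_cov[OF assms(1,5,3)] this assms(6)] show ?thesis .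
qed

text \<open>The element and the proof of membership arrive in two successive later contexts, which
  \<open>ext_trans\<close> merges into one.\<close>

lemma CCovers_intro:
  assumes sp: "sp G S C" and U: "fam G S U" and V: "fam G S V"
    and "\<And>E f a. ext f G E \<Longrightarrow> el E (tren f S) a \<Longrightarrow> tprov E (App (tren f U) a) \<Longrightarrow> tprov E (App (App (tren f
      C) a) (tren f V))"
  shows "tprov G (CCovers S C U V)"
  unfolding CCovers_def
proof (rule tprov_all_intro)
  note S = sp_wt[OF sp]
  show "wt G S" "wt (TEl S # G) (TImp (App U\<up> (Var 0)) (App (App C\<up> (Var 0)) V\<up>))"
    by (intro wt_TImp wt_App0 wt_cov0 S sp U V)+
  fix E f a
  assume ext: "ext f G E" and a: "el E (tren f S) a"
  have "tprov E (TImp (App (tren f U) a) (App (App (tren f C) a) (tren f V)))"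
  proof (rule tprov_imp_intro)
    show "wt E (App (tren f U) a)" "wt E (App (App (tren f C) a) (tren f V))"
      by (rule wt_App[OF fam_ext[OF U ext] a], rule wt_cov[OF sp_ext[OF sp ext] a fam_ext[OF V ext]])
    fix E1 g
    assume g: "ext g E E1" and h: "tprov E1 (tren g (App (tren f U) a))"
    from assms(4)[OF ext_trans[OF ext g], of "tren g a"] el_ext[OF a g] h
    show "tprov E1 (tren g (App (App (tren f C) a) (tren f V)))"
      by (simp add: tren_tren)
  qed
  then show "tprov E (tinst a (tren (up f) (TImp (App U\<up> (Var 0)) (App (App C\<up> (Var 0)) V\<up>))))"
    by (simp add: tinst_simps)
qed

section \<open>Points in type theory\<close>

definition tlift :: "ttm \<Rightarrow> tb" where
  "tlift t = (\<lambda>d. tren (\<lambda>n. n + d) t)"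

definition PDir :: "ttm \<Rightarrow> ttm \<Rightarrow> ttm \<Rightarrow> tty" where
  "PDir S C \<alpha> = tpoint_dir (tlift S) (tlift C) (tlift \<alpha>) 0"

definition PSplit :: "ttm \<Rightarrow> ttm \<Rightarrow> ttm \<Rightarrow> tty" where
  "PSplit S C \<alpha> = tpoint_split (tlift S) (tlift C) (tlift \<alpha>) 0"

lemmas tdefs = tunfold tlift_def tsing_def tnull_def tcup_def tcovers_def tdown_def tstar_def
  tspace_refl_def tspace_trans_def tspace_down_def tBoolean_def tDeMorgan_def
  tpoint_inh_def tpoint_dir_def tpoint_split_def

lemma tyren_PDir [simp]: "tyren f (PDir S C \<alpha>) = PDir (tren f S) (tren f C) (tren f \<alpha>)"
  by (simp add: PDir_def tdefs tren_tren)

lemma tyren_PSplit [simp]: "tyren f (PSplit S C \<alpha>) = PSplit (tren f S) (tren f C) (tren f \<alpha>)"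
  by (simp add: PSplit_def tdefs tren_tren)

abbreviation tarr :: "ttm \<Rightarrow> tty \<Rightarrow> tty" where
  "tarr X B \<equiv> TFun (TEl X) (tyren Suc B)"

abbreviation tyfam :: "ttm \<Rightarrow> tty" where
  "tyfam S \<equiv> TFun (TEl S) TSet"

lemma PDir_eq: "PDir S C \<alpha> = TFun (TEl S) (TFun (TEl S\<up>) (tarr (App \<alpha>\<up>\<up> (Var 1)) (tarr (App \<alpha>\<up>\<up> (Var 0))
    (TEl (TSg S\<up>\<up> (TAnd (App \<alpha>\<up>\<up>\<up> (Var 0)) (App (CDown S\<up>\<up> C\<up>\<up> (CSing S\<up>\<up> (Var 1)) (CSing S\<up>\<up> (Var 0)))\<up>
      (Var 0))))))))"
  by (simp add: PDir_def tdefs cdefs TSg_def TPi_def tren_tren)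

lemma PSplit_eq: "PSplit S C \<alpha> = TFun (TEl S) (TFun (tyfam S\<up>) (tarr (App \<alpha>\<up>\<up> (Var 1)) (tarr (App (App
  C\<up>\<up> (Var 1)) (Var 0))
    (TEl (TSg S\<up>\<up> (TAnd (App (Var 1) (Var 0)) (App \<alpha>\<up>\<up>\<up> (Var 0))))))))"
  by (simp add: PSplit_def tdefs cdefs TSg_def TPi_def tren_tren)

lemma PDir_elim:
  assumes "der (HasTy G p (PDir S C \<alpha>))" "el G S a" "el G S b" "tprov G (App \<alpha> a)" "tprov G (App \<alpha> b)"
  shows "tprov G (TSg S (TAnd (App \<alpha>\<up> (Var 0)) (App (CDown S C (CSing S a) (CSing S b))\<up> (Var 0))))"
proof -
  from assms(4,5) obtain x y where x: "der (HasTy G x (TEl (App \<alpha> a)))" and y: "der (HasTy G y (TEl (App \<alpha> b)))"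
    by (auto simp: tprov_def el_def)
  note 1 = AppE'[OF assms(1)[unfolded PDir_eq] assms(2)[unfolded el_def], simplified tinst_simps
    tyren.simps tsub_C tsub_TSg]
  note 2 = AppE'[OF 1 assms(3)[unfolded el_def], simplified tinst_simps tyren.simps tsub_C tsub_TSg]
  note 3 = AppE'[OF 2 x, simplified tinst_simps tyren.simps tsub_C tsub_TSg]
  note 4 = AppE'[OF 3 y, simplified tinst_simps tyren.simps tsub_C tsub_TSg]
  then show ?thesis
    by (auto simp: tprov_def el_def tinst_simps)
qed

lemma PSplit_elim:
  assumes "der (HasTy G p (PSplit S C \<alpha>))" "el G S a" "fam G S U" "tprov G (App \<alpha> a)" "tprov G (App (App
    C a) U)"
  shows "tprov G (TSg S (TAnd (App U\<up> (Var 0)) (App \<alpha>\<up> (Var 0))))"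
proof -
  from assms(4,5) obtain x y where x: "der (HasTy G x (TEl (App \<alpha> a)))" and y: "der (HasTy G y (TEl (App
    (App C a) U)))"
    by (auto simp: tprov_def el_def)
  note 1 = AppE'[OF assms(1)[unfolded PSplit_eq] assms(2)[unfolded el_def], simplified tinst_simps
    tyren.simps tsub_C tsub_TSg]
  note 2 = AppE'[OF 1 assms(3)[unfolded fam_def], simplified tinst_simps tyren.simps tsub_C tsub_TSg]
  note 3 = AppE'[OF 2 x, simplified tinst_simps tyren.simps tsub_C tsub_TSg]
  note 4 = AppE'[OF 3 y, simplified tinst_simps tyren.simps tsub_C tsub_TSg]
  then show ?thesis
    by (auto simp: tprov_def el_def tinst_simps)
qed

text \<open>Inhabitation of the point is kept apart: it is consumed once, at the start of
  \<open>pt_cases\<close>, whereas the refutations start from an element that is already at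
  hand.\<close>

definition pt :: "tty list \<Rightarrow> ttm \<Rightarrow> ttm \<Rightarrow> ttm \<Rightarrow> bool" where
  "pt G S C \<alpha> \<longleftrightarrow> sp G S C \<and> fam G S \<alpha> \<and> (\<exists>p. der (HasTy G p (PDir S C \<alpha>))) \<and> (\<exists>p. der (HasTy G p (PSplit S
    C \<alpha>)))"

lemma pt_ext:
  assumes "pt G S C \<alpha>" "ext f G E"
  shows "pt E (tren f S) (tren f C) (tren f \<alpha>)"
proof -
  from assms(1) obtain p q where "der (HasTy G p (PDir S C \<alpha>))" "der (HasTy G q (PSplit S C \<alpha>))"
    by (auto simp: pt_def)
  from HasTy_ext[OF this(1) assms(2)] HasTy_ext[OF this(2) assms(2)] assms show ?thesis
    by (auto simp: pt_def intro: sp_ext fam_ext)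
qed

lemma pt_split:
  assumes pt: "pt G S C \<alpha>" and a: "el G S a" and U: "fam G S U" and D: "wt G D"
    and "tprov G (App \<alpha> a)" "tprov G (App (App C a) U)"
    and e: "\<And>E f b. ext f G E \<Longrightarrow> el E (tren f S) b \<Longrightarrow> tprov E (App (tren f U) b) \<Longrightarrow> tprov E (App (tren f \<alpha>) b)
      \<Longrightarrow> tprov E (tren f D)"
  shows "tprov G D"
proof -
  from pt obtain p where p: "der (HasTy G p (PSplit S C \<alpha>))" and S: "wt G S" and \<alpha>: "fam G S \<alpha>"
    by (auto simp: pt_def sp_def)
  show ?thesis
  proof (rule tprov_ex_elim[OF S _ D PSplit_elim[OF p a U assms(5,6)]])
    show "wt (TEl S # G) (TAnd (App U\<up> (Var 0)) (App \<alpha>\<up> (Var 0)))"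
      by (intro wt_TAnd wt_App0 S U \<alpha>)
    fix E f b
    assume ext: "ext f G E" and b: "el E (tren f S) b"
      and "tprov E (tinst b (tren (up f) (TAnd (App U\<up> (Var 0)) (App \<alpha>\<up> (Var 0)))))"
    then have h: "tprov E (TAnd (App (tren f U) b) (App (tren f \<alpha>) b))"
      by (simp add: tinst_simps)
    have "wt E (App (tren f U) b)" "wt E (App (tren f \<alpha>) b)"
      by (rule wt_App[OF fam_ext[OF U ext] b], rule wt_App[OF fam_ext[OF \<alpha> ext] b])
    from e[OF ext b tprov_andE[OF this h]] show "tprov E (tren f D)" .
  qed
qed

text \<open>Directedness is taken at the pair (b, b). Both halves of b down b then state the same
  nearness to the singleton of \<open>b\<close>, and one copy is handed on.\<close>

lemma pt_dir:
  assumes pt: "pt G S C \<alpha>" and b: "el G S b" and D: "wt G D" and h: "tprov G (App \<alpha> b)"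
    and e: "\<And>E f c. ext f G E \<Longrightarrow> el E (tren f S) c \<Longrightarrow> tprov E (App (tren f \<alpha>) c)
      \<Longrightarrow> tprov E (CNear (tren f S) (tren f C) (CSing (tren f S) (tren f b)) c) \<Longrightarrow> tprov E (tren f D)"
  shows "tprov G D"
proof -
  from pt obtain p where p: "der (HasTy G p (PDir S C \<alpha>))" and sp: "sp G S C" and \<alpha>: "fam G S \<alpha>"
    by (auto simp: pt_def)
  note S = sp_wt[OF sp]
  let ?D = "CDown S C (CSing S b) (CSing S b)"
  have down: "fam G S ?D"
    by (intro fam_CDown fam_CSing sp S b)
  show ?thesis
  proof (rule tprov_ex_elim[OF S _ D PDir_elim[OF p b b h h]])
    show "wt (TEl S # G) (TAnd (App \<alpha>\<up> (Var 0)) (App ?D\<up> (Var 0)))"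
      by (intro wt_TAnd wt_App0 S \<alpha> down)
    fix E f c
    assume ext: "ext f G E" and c: "el E (tren f S) c"
      and "tprov E (tinst c (tren (up f) (TAnd (App \<alpha>\<up> (Var 0)) (App ?D\<up> (Var 0)))))"
    then have h: "tprov E (TAnd (App (tren f \<alpha>) c) (App (tren f ?D) c))"
      by (simp add: tinst_simps)
    have w: "wt E (App (tren f \<alpha>) c)" "wt E (App (tren f ?D) c)"
      by (rule wt_App[OF fam_ext[OF \<alpha> ext] c], rule wt_App[OF fam_ext[OF down ext] c])
    note sp' = sp_ext[OF sp ext]
    note b' = fam_CSing[OF sp_wt[OF sp'] el_ext[OF b ext]]
    from tprov_andE(2)[OF w h] have "tprov E (CNear (tren f S) (tren f C) (CSing (tren f S) (tren f b)) c)"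
      using CDown_iff[OF sp' b' b' c] by simp
    from e[OF ext c tprov_andE(1)[OF w h] this] show "tprov E (tren f D)" .
  qed
qed

lemma cov_null:
  assumes pt: "pt G S C \<alpha>" and c: "el G S c" "tprov G (App \<alpha> c)" and cov: "tprov G (App (App C c) CNull)"
  shows "tprov G (Cst N0)"
proof -
  have S: "wt G S"
    using pt by (simp add: pt_def sp_def)
  show ?thesis
  proof (rule pt_split[OF pt c(1) fam_CNull[OF S] _ c(2) cov])
    fix E f b
    assume "ext f G E" "el E (tren f S) b" "tprov E (App (tren f CNull) b)"
    then show "tprov E (tren f (Cst N0))"
      using CNull_iff[OF wt_ext[OF S]] by simp
  qed (rule wt_N0[OF wt_Ctx[OF S]])
qed

text \<open>The element u that witnesses nearness of c to {b} belongs to \<open>U\<close>, as every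
  element does, so it also witnesses nearness to \<open>U\<close>. In this way no transport along
  the identity between u and \<open>b\<close> is carried out.\<close>

lemma CStar_refute:
  assumes pt: "pt G S C \<alpha>" and U: "fam G S U" and b: "el G S b" "tprov G (App \<alpha> b)"
    and star: "tprov G (App (CStar S C U) b)"
    and full: "\<And>E f u. ext f G E \<Longrightarrow> el E (tren f S) u \<Longrightarrow> tprov E (App (tren f U) u)"
  shows "tprov G (Cst N0)"
proof -
  have sp: "sp G S C"
    using pt by (simp add: pt_def)
  note S = sp_wt[OF sp]
  have cov: "tprov G (CCovers S C (CDown S C (CSing S b) U) CNull)"
    using star by (simp add: CStar_iff[OF sp U b(1)])
  show ?thesis
  proof (rule pt_dir[OF pt b(1) _ b(2)])
    show "wt G (Cst N0)"
      by (rule wt_N0[OF wt_Ctx[OF S]])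
    fix E f c
    assume ext: "ext f G E" and c: "el E (tren f S) c" "tprov E (App (tren f \<alpha>) c)"
      and near: "tprov E (CNear (tren f S) (tren f C) (CSing (tren f S) (tren f b)) c)"
    note sp' = sp_ext[OF sp ext]
    note S' = sp_wt[OF sp'] and U' = fam_ext[OF U ext]
    note b' = fam_CSing[OF S' el_ext[OF b(1) ext]]
    have "tprov E (CNear (tren f S) (tren f C) (tren f U) c)"
    proof (rule CNear_elim[OF sp' b' c(1) wt_CNear[OF sp' U' c(1)] near])
      fix E1 g u
      assume g: "ext g E E1" and u: "el E1 (tren g (tren f S)) u"
        and n: "tprov E1 (App (App (tren g (tren f C)) (tren g c)) (CSing (tren g (tren f S)) u))"
      have "tprov E1 (App (tren g (tren f U)) u)"
        using full[OF ext_trans[OF ext g]] u by (simp add: tren_tren)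
      from CNear_intro[OF sp_ext[OF sp' g] fam_ext[OF U' g] el_ext[OF c(1) g] u this n]
      show "tprov E1 (tren g (CNear (tren f S) (tren f C) (tren f U) c))"
        by simp
    qed
    with near have "tprov E (App (CDown (tren f S) (tren f C) (CSing (tren f S) (tren f b)) (tren f U)) c)"
      by (simp add: CDown_iff[OF sp' b' U' c(1)])
    from CCovers_elim[OF sp' fam_CDown[OF sp' b' U'] fam_CNull[OF S'] tprov_ext[OF cov ext, simplified]
      c(1) this]
    have "tprov E (App (App (tren f C) c) CNull)" .
    from cov_null[OF pt_ext[OF pt ext] c this] show "tprov E (tren f (Cst N0))"
      by simp
  qed
qed

text \<open>An element of x down \<open>U\<close> would be near some element of \<open>U\<close>,
  which is absurd, so the required covering holds by ex falso.\<close>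

lemma CStar_full:
  assumes sp: "sp G S C" and U: "fam G S U" and x: "el G S x"
    and emp: "\<And>E f u. ext f G E \<Longrightarrow> el E (tren f S) u \<Longrightarrow> tprov E (App (tren f U) u) \<Longrightarrow> tprov E (Cst N0)"
  shows "tprov G (App (CStar S C U) x)"
  unfolding CStar_iff[OF sp U x]
proof (rule CCovers_intro)
  note S = sp_wt[OF sp]
  note x' = fam_CSing[OF S x]
  show "sp G S C" "fam G S (CDown S C (CSing S x) U)" "fam G S CNull"
    by (intro sp fam_CDown x' U fam_CNull S)+
  fix E f d
  assume ext: "ext f G E" and d: "el E (tren f S) d" and h: "tprov E (App (tren f (CDown S C (CSing S x) U)) d)"
  note sp' = sp_ext[OF sp ext] and U' = fam_ext[OF U ext]
  have "tprov E (CNear (tren f S) (tren f C) (tren f U) d)"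
    using h CDown_iff[OF sp' fam_ext[OF x' ext] U' d] by simp
  then have "tprov E (Cst N0)"
  proof (rule CNear_elim[OF sp' U' d wt_N0[OF wt_Ctx[OF sp_wt[OF sp']]]])
    fix E1 g u
    assume g: "ext g E E1" and u: "el E1 (tren g (tren f S)) u" "tprov E1 (App (tren g (tren f U)) u)"
    show "tprov E1 (tren g (Cst N0))"
      using emp[OF ext_trans[OF ext g], of u] u by (simp add: tren_tren)
  qed
  then show "tprov E (App (App (tren f C) d) (tren f CNull))"
    by (rule tprov_N0E) (simp add: wt_cov[OF sp' d fam_CNull[OF sp_wt[OF sp']]])
qed

text \<open>Subsets of a set are propositional functions on it, so {x in S. P} is the constant
  function with value \<open>P\<close>.\<close>

definition CRestr :: "ttm \<Rightarrow> ttm" where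
  "CRestr P = Lam P\<up>"

lemma tren_CRestr [simp]: "tren f (CRestr P) = CRestr (tren f P)"
  by (simp add: CRestr_def tren_tren)

lemma fam_CRestr: "wt G S \<Longrightarrow> wt G P \<Longrightarrow> fam G S (CRestr P)"
  unfolding CRestr_def by (intro fam_LamI wt_shift Ctx_El)

lemma CRestr_iff: "wt G S \<Longrightarrow> wt G P \<Longrightarrow> el G S a \<Longrightarrow> tprov G (App (CRestr P) a) \<longleftrightarrow> tprov G P"
  unfolding CRestr_def tprov_def using el_beta_const by blast

lemma CStar_CRestr_not:
  assumes pt: "pt G S C \<alpha>" and P: "wt G P" and b: "el G S b" "tprov G (App \<alpha> b)"
    and star: "tprov G (App (CStar S C (CRestr P)) b)"
  shows "tprov G (TNot P)"
proof -
  have sp: "sp G S C"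
    using pt by (simp add: pt_def)
  note S = sp_wt[OF sp]
  have "tprov G (TImp P (Cst N0))"
  proof (rule tprov_imp_intro)
    fix E f
    assume ext: "ext f G E" and p: "tprov E (tren f P)"
    note S' = wt_ext[OF S ext] and P' = wt_ext[OF P ext]
    have "tprov E (Cst N0)"
    proof (rule CStar_refute[OF pt_ext[OF pt ext] fam_CRestr[OF S' P'] el_ext[OF b(1) ext]])
      show "tprov E (App (tren f \<alpha>) (tren f b))"
        "tprov E (App (CStar (tren f S) (tren f C) (CRestr (tren f P))) (tren f b))"
        using tprov_ext[OF b(2) ext] tprov_ext[OF star ext] by simp_all
      fix E1 g u
      assume g: "ext g E E1" and u: "el E1 (tren g (tren f S)) u"
      show "tprov E1 (App (tren g (CRestr (tren f P))) u)"
        using CRestr_iff[OF wt_ext[OF S' g] wt_ext[OF P' g] u] tprov_ext[OF p g] by simp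
    qed
    then show "tprov E (tren f (Cst N0))"
      by simp
  qed (use P wt_N0[OF wt_Ctx[OF P]] in simp_all)
  then show ?thesis
    by simp
qed

lemma CStar2_CRestr_not_not:
  assumes pt: "pt G S C \<alpha>" and P: "wt G P" and b: "el G S b" "tprov G (App \<alpha> b)"
    and star: "tprov G (App (CStar S C (CStar S C (CRestr P))) b)"
  shows "tprov G (TNot (TNot P))"
proof -
  have sp: "sp G S C"
    using pt by (simp add: pt_def)
  note S = sp_wt[OF sp]
  have N: "wt G (TNot P)"
    using wt_TImp[OF P wt_N0[OF wt_Ctx[OF P]]] by simp
  have "tprov G (TImp (TNot P) (Cst N0))"
  proof (rule tprov_imp_intro)
    fix E f
    assume ext: "ext f G E" and p: "tprov E (tren f (TNot P))"
    note S' = wt_ext[OF S ext] and P' = wt_ext[OF P ext] and sp' = sp_ext[OF sp ext]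
    have "tprov E (Cst N0)"
    proof (rule CStar_refute[OF pt_ext[OF pt ext] fam_CStar[OF sp' fam_CRestr[OF S' P']] el_ext[OF b(1) ext]])
      show "tprov E (App (tren f \<alpha>) (tren f b))"
        "tprov E (App (CStar (tren f S) (tren f C) (CStar (tren f S) (tren f C) (CRestr (tren f P))))
          (tren f b))"
        using tprov_ext[OF b(2) ext] tprov_ext[OF star ext] by simp_all
      fix E1 g u
      assume g: "ext g E E1" and u: "el E1 (tren g (tren f S)) u"
      note S'' = wt_ext[OF S' g] and P'' = wt_ext[OF P' g] and sp'' = sp_ext[OF sp' g]
      have "tprov E1 (App (CStar (tren g (tren f S)) (tren g (tren f C)) (CRestr (tren g (tren f P)))) u)"
      proof (rule CStar_full[OF sp'' fam_CRestr[OF S'' P''] u])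
        fix E2 h v
        assume h: "ext h E1 E2" and v: "el E2 (tren h (tren g (tren f S))) v"
          "tprov E2 (App (tren h (CRestr (tren g (tren f P)))) v)"
        have "tprov E2 (tren h (tren g (tren f P)))"
          using v CRestr_iff[OF wt_ext[OF S'' h] wt_ext[OF P'' h] v(1)] by simp
        moreover have "tprov E2 (TImp (tren h (tren g (tren f P))) (Cst N0))"
          using tprov_ext[OF tprov_ext[OF p g] h] by simp
        ultimately show "tprov E2 (Cst N0)"
          using tprov_impE[OF wt_ext[OF P'' h] wt_N0] wt_Ctx[OF wt_ext[OF P'' h]] by blast
      qed
      then show "tprov E1 (App (tren g (CStar (tren f S) (tren f C) (CRestr (tren f P)))) u)"
        by simp
    qed
    then show "tprov E (tren f (Cst N0))"
      by simp
  qed (use N wt_N0[OF wt_Ctx[OF P]] in simp_all)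
  then show ?thesis
    by simp
qed

text \<open>Three later contexts are passed in turn: one with an element a of the point, one with an
  element b that the point shares with the cover of a, and one with a proof of a disjunct. The
  branch assumptions are stated for all later contexts so that they apply in the last of
  these.\<close>

lemma pt_cases:
  assumes pt: "pt G S C \<alpha>" and inh: "tprov G (TSg S (App \<alpha>\<up> (Var 0)))" and U: "fam G S U" and V: "fam G S V"
    and cov: "tprov G (TPi S (App (App C\<up> (Var 0)) (CCup U V)\<up>))" and P: "wt G P" and Q: "wt G Q"
    and "\<And>E f b. ext f G E \<Longrightarrow> el E (tren f S) b \<Longrightarrow> tprov E (App (tren f \<alpha>) b) \<Longrightarrow> tprov E (App (tren f U) b)
      \<Longrightarrow> tprov E (tren f P)"
    and "\<And>E f b. ext f G E \<Longrightarrow> el E (tren f S) b \<Longrightarrow> tprov E (App (tren f \<alpha>) b) \<Longrightarrow> tprov E (App (tren f V) b)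
      \<Longrightarrow> tprov E (tren f Q)"
  shows "tprov G (TOr P Q)"
proof -
  have sp: "sp G S C" and \<alpha>: "fam G S \<alpha>"
    using pt by (simp_all add: pt_def)
  note S = sp_wt[OF sp] and W = fam_CCup[OF sp_wt[OF sp] U V] and PQ = wt_TOr[OF P Q]
  show ?thesis
  proof (rule tprov_ex_elim[OF S wt_App0[OF S \<alpha>] PQ inh])
    fix E f a
    assume ext: "ext f G E" and a: "el E (tren f S) a" and "tprov E (tinst a (tren (up f) (App \<alpha>\<up> (Var 0))))"
    then have a\<alpha>: "tprov E (App (tren f \<alpha>) a)"
      by (simp add: tinst_simps)
    note W' = fam_ext[OF W ext]
    have "tprov E (TPi (tren f S) (App (App (tren f C)\<up> (Var 0)) (tren f (CCup U V))\<up>))"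
      using tprov_ext[OF cov ext] by (simp add: tren_tren)
    from tprov_allE[OF wt_ext[OF S ext] wt_cov0[OF sp_ext[OF sp ext] W'] this a]
    have c: "tprov E (App (App (tren f C) a) (tren f (CCup U V)))"
      by (simp add: tinst_simps)
    show "tprov E (tren f (TOr P Q))"
    proof (rule pt_split[OF pt_ext[OF pt ext] a W' wt_ext[OF PQ ext] a\<alpha> c])
      fix E1 g b
      assume g: "ext g E E1" and b: "el E1 (tren g (tren f S)) b"
        and bW: "tprov E1 (App (tren g (tren f (CCup U V))) b)" and b\<alpha>: "tprov E1 (App (tren g (tren f \<alpha>)) b)"
      let ?h = "\<lambda>n. g (f n)"
      have h: "ext ?h G E1"
        by (rule ext_trans[OF ext g])
      note S' = wt_ext[OF S h] and U' = fam_ext[OF U h] and V' = fam_ext[OF V h]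
      note P' = wt_ext[OF P h] and Q' = wt_ext[OF Q h] and PQ' = wt_ext[OF PQ h]
      have b': "el E1 (tren ?h S) b" and b\<alpha>': "tprov E1 (App (tren ?h \<alpha>) b)"
        using b b\<alpha> by (simp_all add: tren_tren)
      have "tprov E1 (TOr (App (tren ?h U) b) (App (tren ?h V) b))"
        using bW CCup_iff[OF S' U' V' b'] by (simp add: tren_tren)
      then have "tprov E1 (tren ?h (TOr P Q))"
      proof (rule tprov_or_elim[OF wt_App[OF U' b'] wt_App[OF V' b'] PQ'])
        fix E2 k
        assume k: "ext k E1 E2" and hU: "tprov E2 (tren k (App (tren ?h U) b))"
        have "tprov E2 (tren (\<lambda>n. k (g (f n))) P)"
          by (rule assms(8)[OF ext_trans[OF h k], of "tren k b"])
            (use el_ext[OF b' k] tprov_ext[OF b\<alpha>' k] hU in \<open>simp_all add: tren_tren\<close>)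
        then show "tprov E2 (tren k (tren ?h (TOr P Q)))"
          using tprov_orI(1)[OF wt_ext[OF P' k] wt_ext[OF Q' k]] by (simp add: tren_tren)
      next
        fix E2 k
        assume k: "ext k E1 E2" and hV: "tprov E2 (tren k (App (tren ?h V) b))"
        have "tprov E2 (tren (\<lambda>n. k (g (f n))) Q)"
          by (rule assms(9)[OF ext_trans[OF h k], of "tren k b"])
            (use el_ext[OF b' k] tprov_ext[OF b\<alpha>' k] hV in \<open>simp_all add: tren_tren\<close>)
        then show "tprov E2 (tren k (tren ?h (TOr P Q)))"
          using tprov_orI(2)[OF wt_ext[OF P' k] wt_ext[OF Q' k]] by (simp add: tren_tren)
      qed
      then show "tprov E1 (tren g (tren f (TOr P Q)))"
        by (simp add: tren_tren)
    qed
  qed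
qed

section \<open>Excluded middle and the De Morgan law from a point in type theory\<close>

lemma pt_EM:
  assumes pt: "pt G S C \<alpha>" and inh: "tprov G (TSg S (App \<alpha>\<up> (Var 0)))" and P: "wt G P"
    and cov: "\<And>U. fam G S U \<Longrightarrow> tprov G (TPi S (App (App C\<up> (Var 0)) (CCup U (CStar S C U))\<up>))"
  shows "tprov G (TOr P (TNot P))"
proof -
  have sp: "sp G S C"
    using pt by (simp add: pt_def)
  note S = sp_wt[OF sp]
  note U = fam_CRestr[OF S P]
  show ?thesis
  proof (rule pt_cases[OF pt inh U fam_CStar[OF sp U] cov[OF U] P wt_TImp[OF P wt_N0[OF wt_Ctx[OF P]]]])
    fix E f b
    assume ext: "ext f G E" and b: "el E (tren f S) b" "tprov E (App (tren f \<alpha>) b)"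
    show "tprov E (tren f P)" if "tprov E (App (tren f (CRestr P)) b)"
      using that CRestr_iff[OF wt_ext[OF S ext] wt_ext[OF P ext] b(1)] by simp
    show "tprov E (tren f (TNot P))" if "tprov E (App (tren f (CStar S C (CRestr P))) b)"
      using that CStar_CRestr_not[OF pt_ext[OF pt ext] wt_ext[OF P ext] b] by simp
  qed
qed

lemma pt_DML:
  assumes pt: "pt G S C \<alpha>" and inh: "tprov G (TSg S (App \<alpha>\<up> (Var 0)))" and P: "wt G P"
    and cov: "\<And>U. fam G S U \<Longrightarrow> tprov G (TPi S (App (App C\<up> (Var 0)) (CCup (CStar S C (CStar S C U)) (CStar
      S C U))\<up>))"
  shows "tprov G (TOr (TNot (TNot P)) (TNot P))"
proof -
  have sp: "sp G S C"
    using pt by (simp add: pt_def)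
  note S = sp_wt[OF sp] and N0 = wt_N0[OF wt_Ctx[OF P]]
  note U = fam_CRestr[OF S P] and N = wt_TImp[OF P N0]
  note U1 = fam_CStar[OF sp U]
  show ?thesis
  proof (rule pt_cases[OF pt inh fam_CStar[OF sp U1] U1 cov[OF U] wt_TImp[OF N N0] N])
    fix E f b
    assume ext: "ext f G E" and b: "el E (tren f S) b" "tprov E (App (tren f \<alpha>) b)"
    show "tprov E (tren f (TNot P))" if "tprov E (App (tren f (CStar S C (CRestr P))) b)"
      using that CStar_CRestr_not[OF pt_ext[OF pt ext] wt_ext[OF P ext] b] by simp
    show "tprov E (tren f (TNot (TNot P)))" if "tprov E (App (tren f (CStar S C (CStar S C (CRestr P)))) b)"
      using that CStar2_CRestr_not_not[OF pt_ext[OF pt ext] wt_ext[OF P ext] b] by simp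
  qed
qed

section \<open>Formation of the types of spaces and points\<close>

definition CovTy :: "ttm \<Rightarrow> tty" where
  "CovTy S = TFun (TEl S) (TFun (tyfam S\<up>) TSet)"

definition ReflTy :: "ttm \<Rightarrow> ttm \<Rightarrow> tty" where
  "ReflTy S C = tspace_refl (tlift S) (tlift C) 0"

definition TransTy :: "ttm \<Rightarrow> ttm \<Rightarrow> tty" where
  "TransTy S C = tspace_trans (tlift S) (tlift C) 0"

definition DownTy :: "ttm \<Rightarrow> ttm \<Rightarrow> tty" where
  "DownTy S C = tspace_down (tlift S) (tlift C) 0"

definition BoolTy :: "ttm \<Rightarrow> ttm \<Rightarrow> tty" where
  "BoolTy S C = tBoolean (tlift S) (tlift C) 0"

definition DeMTy :: "ttm \<Rightarrow> ttm \<Rightarrow> tty" where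
  "DeMTy S C = tDeMorgan (tlift S) (tlift C) 0"

lemma ReflTy_eq: "ReflTy S C = TFun (TEl S) (TFun (tyfam S\<up>) (tarr (App (Var 0) (Var 1)) (TEl (App (App
  C\<up>\<up> (Var 1)) (Var 0)))))"
  by (simp add: ReflTy_def tdefs tren_tren)

lemma TransTy_eq: "TransTy S C = TFun (TEl S) (TFun (tyfam S\<up>) (TFun (tyfam S\<up>\<up>)
   (tarr (App (App C\<up>\<up>\<up> (Var 2)) (Var 1)) (tarr (CCovers S\<up>\<up>\<up> C\<up>\<up>\<up> (Var 1) (Var 0)) (TEl (App (App C\<up>\<up>\<up>
     (Var 2)) (Var 0)))))))"
  by (simp add: TransTy_def tdefs cdefs TPi_def tren_tren)

lemma DownTy_eq: "DownTy S C = TFun (TEl S) (TFun (tyfam S\<up>) (TFun (tyfam S\<up>\<up>)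
   (tarr (App (App C\<up>\<up>\<up> (Var 2)) (Var 1)) (tarr (App (App C\<up>\<up>\<up> (Var 2)) (Var 0))
     (TEl (App (App C\<up>\<up>\<up> (Var 2)) (CDown S\<up>\<up>\<up> C\<up>\<up>\<up> (Var 1) (Var 0))))))))"
  by (simp add: DownTy_def tdefs cdefs TSg_def tren_tren)

lemma BoolTy_eq: "BoolTy S C = TFun (tyfam S) (TEl (TPi S\<up> (App (App C\<up>\<up> (Var 0)) (CCup (Var 0) (CStar S\<up>
  C\<up> (Var 0)))\<up>)))"
  by (simp add: BoolTy_def tdefs cdefs TSg_def TPi_def TOr_def tren_tren)

lemma DeMTy_eq: "DeMTy S C = TFun (tyfam S) (TEl (TPi S\<up> (App (App C\<up>\<up> (Var 0))
    (CCup (CStar S\<up> C\<up> (CStar S\<up> C\<up> (Var 0))) (CStar S\<up> C\<up> (Var 0)))\<up>)))"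
  by (simp add: DeMTy_def tdefs cdefs TSg_def TPi_def TOr_def tren_tren)

lemma tyren_BoolTy [simp]: "tyren f (BoolTy S C) = BoolTy (tren f S) (tren f C)"
  by (simp add: BoolTy_def tdefs tren_tren)

lemma tyren_DeMTy [simp]: "tyren f (DeMTy S C) = DeMTy (tren f S) (tren f C)"
  by (simp add: DeMTy_def tdefs tren_tren)

lemma IsTy_tarr:
  assumes "wt G X" "der (IsTy G B)"
  shows "der (IsTy G (tarr X B))"
  using assms(1) der_shift[OF assms(2)] Ctx_El[OF assms(1)] by (intro FunF') (auto simp: wt_def ElF')

lemma IsTy_El: "wt G X \<Longrightarrow> der (IsTy G (TEl X))"
  unfolding wt_def by (rule ElF')

lemma IsTy_tyfam: "wt G S \<Longrightarrow> der (IsTy G (tyfam S))"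
  by (intro FunF' IsTy_El SetF' Ctx_El)

text \<open>The codomain is checked with the new variable already typed, so that the formation
  proofs below work with typing facts and not with the shape of the context.\<close>

lemma IsTy_Fun_el:
  assumes "wt G A" "ext Suc G (TEl A # G) \<Longrightarrow> el (TEl A # G) A\<up> (Var 0) \<Longrightarrow> der (IsTy (TEl A # G) B)"
  shows "der (IsTy G (TFun (TEl A) B))"
  by (intro FunF' IsTy_El assms ext_Suc Ctx_El el_Var0)

lemma IsTy_Fun_fam:
  assumes S: "wt G S" and "ext Suc G (tyfam S # G) \<Longrightarrow> fam (tyfam S # G) S\<up> (Var 0) \<Longrightarrow> der (IsTy (tyfam S # G) B)"
  shows "der (IsTy G (TFun (tyfam S) B))"
proof -
  have c: "der (Ctx (tyfam S # G))"
    by (intro CtxCons' IsTy_tyfam S wt_Ctx[OF S])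
  have "fam (tyfam S # G) S\<up> (Var 0)"
    using HasTy_Var0[OF c] by (simp add: fam_def)
  then show ?thesis
    by (intro FunF' IsTy_tyfam assms ext_Suc c)
qed

lemma IsTy_Fun_el_fam:
  assumes sp: "sp G S C"
    and B: "\<And>E. ext plus2 G E \<Longrightarrow> sp E S\<up>\<up> C\<up>\<up> \<Longrightarrow> el E S\<up>\<up> (Var 1)
      \<Longrightarrow> fam E S\<up>\<up> (Var 0) \<Longrightarrow> der (IsTy E B)"
  shows "der (IsTy G (TFun (TEl S) (TFun (tyfam S\<up>) B)))"
proof (rule IsTy_Fun_el[OF sp_wt[OF sp]])
  let ?G = "TEl S # G"
  assume e: "ext Suc G ?G" and a: "el ?G S\<up> (Var 0)"
  note sp' = sp_ext[OF sp e]
  show "der (IsTy ?G (TFun (tyfam S\<up>) B))"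
  proof (rule IsTy_Fun_fam[OF sp_wt[OF sp']])
    assume e': "ext Suc ?G (tyfam S\<up> # ?G)" and U: "fam (tyfam S\<up> # ?G) S\<up>\<up> (Var 0)"
    show "der (IsTy (tyfam S\<up> # ?G) B)"
      using el_ext[OF a e'] by (intro B[OF ext_trans[OF e e'] sp_ext[OF sp' e'] _ U]) simp
  qed
qed

lemma IsTy_ReflTy:
  assumes sp: "sp G S C"
  shows "der (IsTy G (ReflTy S C))"
  unfolding ReflTy_eq
  by (rule IsTy_Fun_el_fam[OF sp]) (intro IsTy_tarr IsTy_El wt_App wt_cov; assumption)

lemma IsTy_Fun_el_fam_fam:
  assumes sp: "sp G S C"
    and B: "\<And>E. sp E S\<up>\<up>\<up> C\<up>\<up>\<up> \<Longrightarrow> el E S\<up>\<up>\<up> (Var 2) \<Longrightarrow> fam E S\<up>\<up>\<up> (Var 1) \<Longrightarrow> fam E S\<up>\<up>\<up> (Var 0) \<Longrightarrow> der (IsTy E B)"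
  shows "der (IsTy G (TFun (TEl S) (TFun (tyfam S\<up>) (TFun (tyfam S\<up>\<up>) B))))"
proof (rule IsTy_Fun_el_fam[OF sp])
  fix E
  assume sp': "sp E S\<up>\<up> C\<up>\<up>" and a: "el E S\<up>\<up> (Var 1)" and U: "fam E S\<up>\<up> (Var 0)"
  show "der (IsTy E (TFun (tyfam S\<up>\<up>) B))"
  proof (rule IsTy_Fun_fam[OF sp_wt[OF sp']])
    assume e: "ext Suc E (tyfam S\<up>\<up> # E)" and V: "fam (tyfam S\<up>\<up> # E) S\<up>\<up>\<up> (Var 0)"
    show "der (IsTy (tyfam S\<up>\<up> # E) B)"
      using el_ext[OF a e] fam_ext[OF U e] by (intro B[OF sp_ext[OF sp' e] _ _ V]) (simp_all add:
        numeral_eq_Suc)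
  qed
qed

lemma IsTy_TransTy:
  assumes sp: "sp G S C"
  shows "der (IsTy G (TransTy S C))"
  unfolding TransTy_eq
  by (rule IsTy_Fun_el_fam_fam[OF sp]) (intro IsTy_tarr IsTy_El wt_CCovers wt_cov; assumption)

lemma IsTy_DownTy:
  assumes sp: "sp G S C"
  shows "der (IsTy G (DownTy S C))"
  unfolding DownTy_eq
proof (rule IsTy_Fun_el_fam_fam[OF sp])
  fix E
  assume h: "sp E S\<up>\<up>\<up> C\<up>\<up>\<up>" "el E S\<up>\<up>\<up> (Var 2)" "fam E S\<up>\<up>\<up> (Var 1)" "fam E S\<up>\<up>\<up> (Var 0)"
  show "der (IsTy E (tarr (App (App C\<up>\<up>\<up> (Var 2)) (Var 1)) (tarr (App (App C\<up>\<up>\<up> (Var 2)) (Var 0))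
     (TEl (App (App C\<up>\<up>\<up> (Var 2)) (CDown S\<up>\<up>\<up> C\<up>\<up>\<up> (Var 1) (Var 0)))))))"
    by (intro IsTy_tarr IsTy_El wt_cov[OF h(1,2)] fam_CDown h)
qed

lemma IsTy_BoolTy:
  assumes sp: "sp G S C"
  shows "der (IsTy G (BoolTy S C))"
  unfolding BoolTy_eq
  by (rule IsTy_Fun_fam[OF sp_wt[OF sp]])
    (intro IsTy_El wt_TPi wt_cov0 fam_CCup fam_CStar sp_ext[OF sp] sp_wt[OF sp_ext[OF sp]]; assumption)

lemma IsTy_DeMTy:
  assumes sp: "sp G S C"
  shows "der (IsTy G (DeMTy S C))"
  unfolding DeMTy_eq
  by (rule IsTy_Fun_fam[OF sp_wt[OF sp]])
    (intro IsTy_El wt_TPi wt_cov0 fam_CCup fam_CStar sp_ext[OF sp] sp_wt[OF sp_ext[OF sp]]; assumption)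

lemma IsTy_PSplit:
  assumes sp: "sp G S C" and \<alpha>: "fam G S \<alpha>"
  shows "der (IsTy G (PSplit S C \<alpha>))"
  unfolding PSplit_eq
proof (rule IsTy_Fun_el_fam[OF sp])
  fix E
  assume e: "ext plus2 G E" and sp': "sp E S\<up>\<up> C\<up>\<up>" and a: "el E S\<up>\<up> (Var 1)" and U: "fam E S\<up>\<up> (Var 0)"
  have \<alpha>': "fam E S\<up>\<up> \<alpha>\<up>\<up>"
    using fam_ext[OF \<alpha> e] by (simp add: tren_tren)
  have "wt (TEl S\<up>\<up> # E) (App (Var 1) (Var 0))"
    using wt_App0[OF sp_wt[OF sp'] U] by simp
  then show "der (IsTy E (tarr (App \<alpha>\<up>\<up> (Var 1)) (tarr (App (App C\<up>\<up> (Var 1)) (Var 0))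
    (TEl (TSg S\<up>\<up> (TAnd (App (Var 1) (Var 0)) (App \<alpha>\<up>\<up>\<up> (Var 0))))))))"
    by (intro IsTy_tarr IsTy_El wt_TSg wt_TAnd wt_App0 wt_App[OF \<alpha>' a] wt_cov[OF sp' a U] sp_wt[OF sp'] \<alpha>')
qed

lemma IsTy_PDir:
  assumes sp: "sp G S C" and \<alpha>: "fam G S \<alpha>"
  shows "der (IsTy G (PDir S C \<alpha>))"
  unfolding PDir_eq
proof (rule IsTy_Fun_el[OF sp_wt[OF sp]])
  let ?G = "TEl S # G"
  assume e: "ext Suc G ?G" and a: "el ?G S\<up> (Var 0)"
  note sp' = sp_ext[OF sp e]
  let ?B = "tarr (App \<alpha>\<up>\<up> (Var 1)) (tarr (App \<alpha>\<up>\<up> (Var 0))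
    (TEl (TSg S\<up>\<up> (TAnd (App \<alpha>\<up>\<up>\<up> (Var 0)) (App (CDown S\<up>\<up> C\<up>\<up> (CSing S\<up>\<up> (Var 1)) (CSing S\<up>\<up> (Var 0)))\<up>
      (Var 0))))))"
  show "der (IsTy ?G (TFun (TEl S\<up>) ?B))"
  proof (rule IsTy_Fun_el[OF sp_wt[OF sp']])
    let ?E = "TEl S\<up> # ?G"
    assume e': "ext Suc ?G ?E" and b: "el ?E S\<up>\<up> (Var 0)"
    have a': "el ?E S\<up>\<up> (Var 1)"
      using el_ext[OF a e'] by simp
    note sp'' = sp_ext[OF sp' e'] and \<alpha>' = fam_ext[OF fam_ext[OF \<alpha> e] e']
    note S'' = sp_wt[OF sp'']
    show "der (IsTy ?E ?B)"
      by (intro IsTy_tarr IsTy_El wt_TSg wt_TAnd wt_App0 wt_App[OF \<alpha>'] a' b S'' \<alpha>' fam_CDown fam_CSing sp'')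
  qed
qed

text \<open>An extension of \<open>CTT\<close> need not admit weakening, so the term is built in \<open>CTT\<close> and moved to the
  extension when it is closed.\<close>

lemma Ctx_ConsD: "der (Ctx (A # G)) \<Longrightarrow> der (IsTy G A)"
  by (erule derives.cases) (auto simp: CTT_def elim!: LF.cases)

text \<open>Declarations are abstracted from the head of the context on, and inverting the
  well-formed context yields the formation of each domain.\<close>

lemma closed_LamI: "der (HasTy G t B) \<Longrightarrow> \<exists>t'. der (HasTy [] t' (foldl (\<lambda>B A. TFun A B) B G))"
proof (induction G arbitrary: t B)
  case (Cons A G)
  have "der (IsTy G A)"
    using der_Ctx[OF Cons.prems] by (simp add: Ctx_ConsD)
  then have "der (HasTy G (Lam t) (TFun A B))"
    by (rule LamI'[OF _ Cons.prems])
  from Cons.IH[OF this] show ?case by simp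
qed auto

text \<open>The domains of the function type \<open>tspace_with_point_implies\<close>, followed by the proposition \<open>P\<close>.\<close>

definition space_ctx :: "(ttm \<Rightarrow> ttm \<Rightarrow> tty) \<Rightarrow> tty list" where
  "space_ctx K = [TSet, PSplit (Var 8) (Var 7) (Var 2), PDir (Var 7) (Var 6) (Var 1), TEl (TSg (Var 6)
    (App (Var 1) (Var 0))),
     tyfam (Var 5), K (Var 4) (Var 3), DownTy (Var 3) (Var 2), TransTy (Var 2) (Var 1), ReflTy (Var 1)
       (Var 0), CovTy (Var 0), TSet]"

text \<open>A declaration can be added only once its type is formed, which in turn uses the typing
  of the earlier ones. The carrier and the cover recede by one index at each step and end as
  \<open>Var 10\<close> and \<open>Var 9\<close>, the point as \<open>Var 4\<close>.\<close>

lemma space_ctx: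
  assumes K: "\<And>G S C. sp G S C \<Longrightarrow> der (IsTy G (K S C))"
    and ren: "\<And>f S C. tyren f (K S C) = K (tren f S) (tren f C)"
  shows "\<exists>k. der (HasTy (space_ctx K) k (K (Var 10) (Var 9)))" "pt (space_ctx K) (Var 10) (Var 9) (Var 4)"
    "tprov (space_ctx K) (TSg (Var 10) (App (Var 5) (Var 0)))" "wt (space_ctx K) (Var 0)"
proof -
  let ?G1 = "[TSet]" let ?G2 = "CovTy (Var 0) # ?G1" let ?G3 = "ReflTy (Var 1) (Var 0) # ?G2"
  let ?G4 = "TransTy (Var 2) (Var 1) # ?G3" let ?G5 = "DownTy (Var 3) (Var 2) # ?G4"
  let ?G6 = "K (Var 4) (Var 3) # ?G5" let ?G7 = "tyfam (Var 5) # ?G6"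
  let ?G8 = "TEl (TSg (Var 6) (App (Var 1) (Var 0))) # ?G7"
  let ?G9 = "PDir (Var 7) (Var 6) (Var 1) # ?G8" let ?G10 = "PSplit (Var 8) (Var 7) (Var 2) # ?G9"
  let ?G11 = "TSet # ?G10"
  have c1: "der (Ctx ?G1)"
    by (intro CtxCons' CtxNil' SetF')
  have S1: "wt ?G1 (Var 0)"
    using HasTy_Var0[OF c1] by (simp add: wt_def)
  have "der (IsTy ?G1 (CovTy (Var 0)))"
    unfolding CovTy_def
  proof (rule IsTy_Fun_el[OF S1])
    assume e: "ext Suc ?G1 (TEl (Var 0) # ?G1)"
    show "der (IsTy (TEl (Var 0) # ?G1) (TFun (tyfam (Var 0)\<up>) TSet))"
      by (rule IsTy_Fun_fam[OF wt_ext[OF S1 e]]) (simp add: ext_def SetF')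
  qed
  then have c2: "der (Ctx ?G2)"
    by (rule CtxCons'[OF c1])
  have s2: "sp ?G2 (Var 1) (Var 0)"
    using HasTy_Var0[OF c2] wt_shift[OF S1 c2] by (simp add: sp_def CovTy_def)
  have c3: "der (Ctx ?G3)"
    by (rule CtxCons'[OF c2 IsTy_ReflTy[OF s2]])
  have s3: "sp ?G3 (Var 2) (Var 1)"
    using sp_shift[OF s2 c3] by (simp add: numeral_eq_Suc)
  have c4: "der (Ctx ?G4)"
    by (rule CtxCons'[OF c3 IsTy_TransTy[OF s3]])
  have s4: "sp ?G4 (Var 3) (Var 2)"
    using sp_shift[OF s3 c4] by (simp add: numeral_eq_Suc)
  have c5: "der (Ctx ?G5)"
    by (rule CtxCons'[OF c4 IsTy_DownTy[OF s4]])
  have s5: "sp ?G5 (Var 4) (Var 3)"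
    using sp_shift[OF s4 c5] by (simp add: numeral_eq_Suc)
  have c6: "der (Ctx ?G6)"
    by (rule CtxCons'[OF c5 K[OF s5]])
  have s6: "sp ?G6 (Var 5) (Var 4)"
    using sp_shift[OF s5 c6] by (simp add: numeral_eq_Suc)
  have k6: "der (HasTy ?G6 (Var 0) (K (Var 5) (Var 4)))"
    using HasTy_Var0[OF c6] by (simp add: ren numeral_eq_Suc)
  have c7: "der (Ctx ?G7)"
    by (rule CtxCons'[OF c6 IsTy_tyfam[OF sp_wt[OF s6]]])
  have s7: "sp ?G7 (Var 6) (Var 5)"
    using sp_shift[OF s6 c7] by (simp add: numeral_eq_Suc)
  have f7: "fam ?G7 (Var 6) (Var 0)"
    using HasTy_Var0[OF c7] by (simp add: fam_def numeral_eq_Suc)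
  have w7: "wt ?G7 (TSg (Var 6) (App (Var 1) (Var 0)))"
    using wt_TSg[OF sp_wt[OF s7] wt_App0[OF sp_wt[OF s7] f7]] by simp
  have c8: "der (Ctx ?G8)"
    by (rule Ctx_El[OF w7])
  have s8: "sp ?G8 (Var 7) (Var 6)" and f8: "fam ?G8 (Var 7) (Var 1)"
    using sp_shift[OF s7 c8] fam_shift[OF f7 c8] by (simp_all add: numeral_eq_Suc)
  have i8: "tprov ?G8 (TSg (Var 7) (App (Var 2) (Var 0)))"
    using tprov_hyp[OF w7] by (simp add: numeral_eq_Suc)
  have c9: "der (Ctx ?G9)"
    by (rule CtxCons'[OF c8 IsTy_PDir[OF s8 f8]])
  have s9: "sp ?G9 (Var 8) (Var 7)" and f9: "fam ?G9 (Var 8) (Var 2)"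
    using sp_shift[OF s8 c9] fam_shift[OF f8 c9] by (simp_all add: numeral_eq_Suc)
  have d9: "der (HasTy ?G9 (Var 0) (PDir (Var 8) (Var 7) (Var 2)))"
    using HasTy_Var0[OF c9] by (simp add: numeral_eq_Suc)
  have c10: "der (Ctx ?G10)"
    by (rule CtxCons'[OF c9 IsTy_PSplit[OF s9 f9]])
  have p10: "pt ?G10 (Var 9) (Var 8) (Var 3)"
    using sp_shift[OF s9 c10] fam_shift[OF f9 c10] HasTy_shift[OF d9 c10] HasTy_Var0[OF c10]
    by (auto simp: pt_def numeral_eq_Suc)
  have c11: "der (Ctx ?G11)"
    by (intro CtxCons' c10 SetF')
  have eq: "space_ctx K = ?G11"
    by (simp add: space_ctx_def)
  show "pt (space_ctx K) (Var 10) (Var 9) (Var 4)"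
    unfolding eq using pt_ext[OF p10 ext_Suc[OF c11]] by (simp add: numeral_eq_Suc)
  show "wt (space_ctx K) (Var 0)"
    unfolding eq using HasTy_Var0[OF c11] by (simp add: wt_def)
  have "tprov ?G11 (TSg (Var 7) (App (Var 2) (Var 0)))\<up>\<up>\<up>"
    by (intro tprov_shift c11 c10 c9 i8)
  then show "tprov (space_ctx K) (TSg (Var 10) (App (Var 5) (Var 0)))"
    unfolding eq by (simp add: numeral_eq_Suc)
  \<comment> \<open>Five declarations follow the one for \<open>K\<close>: the point, its
    inhabitation, its directedness, its splitting property and the proposition. Hence five
    shifts.\<close>
  have "der (HasTy ?G11 (Var 0)\<up>\<up>\<up>\<up>\<up> (tyren Suc (tyren Suc (tyren Suc (tyren Suc (tyren Suc (K (Var 5)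
    (Var 4))))))))"
    by (intro HasTy_shift c11 c10 c9 c8 c7 k6)
  then show "\<exists>k. der (HasTy (space_ctx K) k (K (Var 10) (Var 9)))"
    unfolding eq by (auto simp: ren numeral_eq_Suc)
qed

section \<open>Closed terms for the two implications in type theory\<close>

lemma BoolTy_elim:
  assumes "der (HasTy G k (BoolTy S C))" "fam G S U"
  shows "tprov G (TPi S (App (App C\<up> (Var 0)) (CCup U (CStar S C U))\<up>))"
  using AppE'[OF assms(1)[unfolded BoolTy_eq] assms(2)[unfolded fam_def]]
  by (auto simp: tprov_def el_def tinst_simps)

lemma DeMTy_elim:
  assumes "der (HasTy G k (DeMTy S C))" "fam G S U"
  shows "tprov G (TPi S (App (App C\<up> (Var 0)) (CCup (CStar S C (CStar S C U)) (CStar S C U))\<up>))"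
  using AppE'[OF assms(1)[unfolded DeMTy_eq] assms(2)[unfolded fam_def]]
  by (auto simp: tprov_def el_def tinst_simps)

lemmas space_defs = space_ctx_def tspace_with_point_implies_def CovTy_def ReflTy_def TransTy_def DownTy_def
  PSplit_def PDir_def tEM_def tDML_def TSg_def TOr_def TPi_def tdefs tren_tren

text \<open>The arbitrary proposition is the last declaration of \<open>space_ctx\<close>, so
  abstracting the whole context over the proof of the disjunction gives exactly the nested function
  type of the implication, ending in \<open>tEM\<close>.\<close>

lemma CTT_EM: "tinhabited CTT (tspace_with_point_implies tBoolean tEM)"
proof -
  note h = space_ctx[of BoolTy, OF IsTy_BoolTy tyren_BoolTy]
  from h(1) obtain k where k: "der (HasTy (space_ctx BoolTy) k (BoolTy (Var 10) (Var 9)))"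
    by blast
  have "tprov (space_ctx BoolTy) (TOr (Var 0) (TNot (Var 0)))"
    by (rule pt_EM[OF h(2) _ h(4) BoolTy_elim[OF k]]) (use h(3) in \<open>simp_all add: numeral_eq_Suc\<close>)
  then obtain t where "der (HasTy (space_ctx BoolTy) t (TEl (TOr (Var 0) (TNot (Var 0)))))"
    by (auto simp: tprov_def el_def)
  from closed_LamI[OF this] show ?thesis
    by (simp add: tinhabited_def space_defs BoolTy_def)
qed

lemma CTT_DML: "tinhabited CTT (tspace_with_point_implies tDeMorgan tDML)"
proof -
  note h = space_ctx[of DeMTy, OF IsTy_DeMTy tyren_DeMTy]
  from h(1) obtain k where k: "der (HasTy (space_ctx DeMTy) k (DeMTy (Var 10) (Var 9)))"
    by blast
  have "tprov (space_ctx DeMTy) (TOr (TNot (TNot (Var 0))) (TNot (Var 0)))"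
    by (rule pt_DML[OF h(2) _ h(4) DeMTy_elim[OF k]]) (use h(3) in \<open>simp_all add: numeral_eq_Suc\<close>)
  then obtain t where "der (HasTy (space_ctx DeMTy) t (TEl (TOr (TNot (TNot (Var 0))) (TNot (Var 0)))))"
    by (auto simp: tprov_def el_def)
  from closed_LamI[OF this] show ?thesis
    by (simp add: tinhabited_def space_defs DeMTy_def)
qed

lemma tinhabited_mono: "tinhabited R A \<Longrightarrow> R \<subseteq> R' \<Longrightarrow> tinhabited R' A"
  unfolding tinhabited_def using derives_mono by blast

theorem proposition4p2:
  shows
    "((\<forall>T. CZF_star T \<longrightarrow>
         (\<forall>\<phi>. sprov T {} ((CZF_Boolean_with_point \<phi> \<longrightarrow>\<^sub>s REM) 0))) \<and>
      (\<forall>R. CTT_star R \<longrightarrow> tinhabited R (tspace_with_point_implies tBoolean tEM)) \<and>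
      (\<forall>\<tau>. hprov [] {} ((HHA_Boolean_with_point \<tau> \<longrightarrow>\<^sub>h hEM) 0)) \<and>
      (\<forall>\<phi> \<psi>. sprov IZF {} ((IZF_Boolean_with_point \<phi> \<longrightarrow>\<^sub>s sEM \<psi>) 0)))
     \<and>
     ((\<forall>T. CZF_star T \<longrightarrow>
         (\<forall>\<phi>. sprov T {} ((CZF_DeMorgan_with_point \<phi> \<longrightarrow>\<^sub>s RDML) 0))) \<and>
      (\<forall>R. CTT_star R \<longrightarrow> tinhabited R (tspace_with_point_implies tDeMorgan tDML)) \<and>
      (\<forall>\<tau>. hprov [] {} ((HHA_DeMorgan_with_point \<tau> \<longrightarrow>\<^sub>h hDML) 0)) \<and>
      (\<forall>\<phi> \<psi>. sprov IZF {} ((IZF_DeMorgan_with_point \<phi> \<longrightarrow>\<^sub>s sDML \<psi>) 0)))"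
proof (intro conjI allI impI)
  fix T \<phi>
  assume "CZF_star T"
  then have T: "CZF \<subseteq> T"
    by (simp add: CZF_star_def)
  show "sprov T {} ((CZF_Boolean_with_point \<phi> \<longrightarrow>\<^sub>s REM) 0)"
    by (rule CZF_REM[OF T])
  show "sprov T {} ((CZF_DeMorgan_with_point \<phi> \<longrightarrow>\<^sub>s RDML) 0)"
    by (rule CZF_RDML[OF T])
next
  fix R
  assume "CTT_star R"
  then have R: "CTT \<subseteq> R"
    by (simp add: CTT_star_def)
  show "tinhabited R (tspace_with_point_implies tBoolean tEM)"
    by (rule tinhabited_mono[OF CTT_EM R])
  show "tinhabited R (tspace_with_point_implies tDeMorgan tDML)"
    by (rule tinhabited_mono[OF CTT_DML R])
qed (rule HHA_EM HHA_DML IZF_EM IZF_DML)+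

end
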